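(* For any CLWX 2-algebroid $\mathcal{E}=(E_0\xleftarrow{\partial}E_1,\rho,\circ,\Omega,S)$ over a smooth manifold $M$, there is an associated complex $$(L,d)=\big(\Gamma E_0\xleftarrow{\ \partial\ }\Gamma E_1\xleftarrow{\ \mathcal{D}\ }C^\infty(M)\big)$$ (with $L_0=\Gamma E_0$, $L_1=\Gamma E_1$, $L_2=C^\infty(M)$), which, equipped with the structure maps $$\lambda_2=(-\circ-)+S\circ_2\mathcal{D},\quad\lambda_{2;1}=S,\quad\lambda_3=\Omega,\quad\lambda_{2;1,1}=0,\quad\lambda_{3;1}=0,\quad\lambda_{3;2}=0,\quad\lambda_4=0,$$ defines a weak Lie 3-algebra.
   Context: CLWX 2-algebroid. Let $E=(E_0\xleftarrow{\partial}E_1)$ be a 2-term dg vector bundle over $M$ (degrees $0,1$), equipped with a morphism $\rho\colon E\to TM$ of dg vector bundles ($TM$ in degree 0), a graded bilinear map $\circ\colon\Gamma E\otimes\Gamma E\to\Gamma E$ which is skew-symmetric on $\Gamma E_0\otimes\Gamma E_0$, a graded 3-form $\Omega\colon\Gamma E\otimes\Gamma E\otimes\Gamma E\to\Gamma E[1]$ (skew-symmetric; raising degree by 1), and a non-degenerate symmetric bilinear form $S\colon\Gamma E\otimes\Gamma E\to C^\infty(M)$. Define $\mathcal{D}\colon C^\infty(M)\to\Gamma E_1$ by $S(e,\mathcal{D}f)=\rho(e)(f)$ for all $e\in\Gamma E$. This is a CLWX 2-algebroid if: (i) $E_0,E_1$ are isotropic: $S(E_i,E_i)=0$ for $i=0,1$;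 (ii) $(\Gamma E_0\xleftarrow{\partial}\Gamma E_1,\circ,\Omega)$ is a Leibniz 2-algebra, i.e. a Leibniz 3-algebra (below) with $L_2=0$, $\lambda_2=\circ$, $\lambda_3=\Omega$, $\lambda_4=0$; (iii) $e\circ e=\frac12\mathcal{D}S(e,e)$ for all $e\in\Gamma E$; (iv) $S(\partial e_1,e_2)=S(e_1,\partial e_2)$ for all $e_i\in\Gamma E$; (v) $\rho(e_1)S(e_2,e_3)=S(e_1\circ e_2,e_3)+S(e_2,e_1\circ e_3)$ for all $e_i\in\Gamma E$; (vi) $S(\Omega(e_1,e_2,e_3),e_4)=-S(e_3,\Omega(e_1,e_2,e_4))$ for all $e_i\in\Gamma E$. In the structure maps on $L$, $\circ$, $S$, $\Omega$ are extended by zero to tuples containing elements of $L_2=C^\infty(M)$, and $\mathcal{D}$ by zero to $\Gamma E$; $(S\circ_2\mathcal{D})(e,f)=S(e,\mathcal{D}f)\in C^\infty(M)$ for $e\in\Gamma E_0$, $f\in C^\infty(M)$. Conventions. Complexes are over $\Bbbk=\mathbb{R}$ with differential of degree $-1$; the Koszul sign rule is used. A 3-term complex is $(L,d)=L_0\xleftarrow{d}L_1\xleftarrow{d}L_2$, concentrated in degrees $0,1,2$. A map $L^{\otimes n}\to L[k]$ means a linear map raising degree by $k$. For a multilinear map $\mu$: $\mu^\sigma(v_1,\dots,v_n)=\varepsilon\,\mu(v_{\sigma^{-1}(1)},\dots,v_{\sigma^{-1}(n)})$ with $\varepsilon$ the Koszul sign ($(123)$ means $1\mapsto2\mapsto3\mapsto1$);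 $\partial(\mu)=d\circ\mu-(-1)^{|\mu|}\mu\circ d_{L^{\otimes n}}$; $(\mu\circ_i\nu)(v_1,\dots,v_{n+k-1})=(-1)^{|\nu|(|v_1|+\dots+|v_{i-1}|)}\mu(v_1,\dots,v_{i-1},\nu(v_i,\dots,v_{i+k-1}),v_{i+k},\dots)$ for $\nu$ of arity $k$. Leibniz 3-algebra. A 3-term complex $(L,d)$ with maps $\lambda_2\colon L^{\otimes2}\to L$, $\lambda_3\colon L^{\otimes3}\to L[1]$, $\lambda_4\colon L^{\otimes4}\to L[2]$ such that $\partial(\lambda_2)=0$; $\partial(\lambda_3)=\lambda_2\circ_2\lambda_2-\lambda_2\circ_1\lambda_2-(\lambda_2\circ_2\lambda_2)^{(12)}$; $\partial(\lambda_4)=\lambda_2\circ_1\lambda_3+\lambda_2\circ_2\lambda_3-(\lambda_2\circ_2\lambda_3)^{(12)}+(\lambda_2\circ_2\lambda_3)^{(123)}-\lambda_3\circ_1\lambda_2+\lambda_3\circ_2\lambda_2-(\lambda_3\circ_2\lambda_2)^{(12)}-\lambda_3\circ_3\lambda_2+(\lambda_3\circ_3\lambda_2)^{(23)}-(\lambda_3\circ_3\lambda_2)^{(132)}$; $0=\lambda_2\circ_1\lambda_4-\lambda_2\circ_2\lambda_4+(\lambda_2\circ_2\lambda_4)^{(12)}-(\lambda_2\circ_2\lambda_4)^{(123)}+(\lambda_2\circ_2\lambda_4)^{(1234)}+\lambda_3\circ_1\lambda_3+\lambda_3\circ_2\lambda_3-(\lambda_3\circ_2\lambda_3)^{(12)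}+(\lambda_3\circ_2\lambda_3)^{(123)}+\lambda_3\circ_3\lambda_3-(\lambda_3\circ_3\lambda_3)^{(23)}+(\lambda_3\circ_3\lambda_3)^{(132)}+(\lambda_3\circ_3\lambda_3)^{(234)}-(\lambda_3\circ_3\lambda_3)^{(1342)}+(\lambda_3\circ_3\lambda_3)^{(13)(24)}+\lambda_4\circ_1\lambda_2-\lambda_4\circ_2\lambda_2+(\lambda_4\circ_2\lambda_2)^{(12)}+\lambda_4\circ_3\lambda_2-(\lambda_4\circ_3\lambda_2)^{(23)}+(\lambda_4\circ_3\lambda_2)^{(132)}-\lambda_4\circ_4\lambda_2+(\lambda_4\circ_4\lambda_2)^{(34)}-(\lambda_4\circ_4\lambda_2)^{(243)}+(\lambda_4\circ_4\lambda_2)^{(1432)}$. Weak Lie 3-algebra $(L,d,\lambda)$. A Leibniz 3-algebra together with maps $\lambda_{2;1}\colon L^{\otimes2}\to L[1]$, $\lambda_{2;1,1}\colon L^{\otimes2}\to L[2]$, $\lambda_{3;1},\lambda_{3;2}\colon L^{\otimes3}\to L[2]$ such that $\partial(\lambda_{2;1})=\lambda_2+\lambda_2^{(12)}$; $\partial(\lambda_{2;1,1})=\lambda_{2;1}-\lambda_{2;1}^{(12)}$; $\partial(\lambda_{3;1})=\lambda_3+\lambda_3^{(12)}+\lambda_2\circ_1\lambda_{2;1}$; $\partial(\lambda_{3;2})=\lambda_3+\lambda_3^{(23)}-\lambda_2\circ_2\lambda_{2;1}+\lambda_{2;1}\circ_1\lambda_2+(\lambda_{2;1}\circ_2\lambda_2)^{(12)}$;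 $\lambda_{2;1,1}+\lambda_{2;1,1}^{(12)}=0$; $\lambda_{3;1}-\lambda_{3;1}^{(12)}=\lambda_2\circ_1\lambda_{2;1,1}$; $\lambda_{3;1}-\lambda_{3;2}^{(12)}+\lambda_{3;1}^{(132)}-\lambda_{3;2}+\lambda_{3;1}^{(23)}-\lambda_{3;2}^{(123)}=\lambda_{2;1}\circ_2\lambda_{2;1}+\lambda_{2;1}\circ_1\lambda_{2;1}+(\lambda_{2;1}\circ_2\lambda_{2;1})^{(12)}+(\lambda_{2;1,1}\circ_2\lambda_2)^{(132)}$; $\lambda_{3;2}-\lambda_{3;2}^{(23)}=-\lambda_2\circ_2\lambda_{2;1,1}+\lambda_{2;1,1}\circ_1\lambda_2+(\lambda_{2;1,1}\circ_2\lambda_2)^{(12)}$; $\lambda_4+\lambda_4^{(12)}=\lambda_2\circ_1\lambda_{3;1}-\lambda_{3;1}\circ_3\lambda_2+(\lambda_2\circ_2\lambda_{3;1})^{(123)}+\lambda_3\circ_1\lambda_{2;1}$; $\lambda_4+\lambda_4^{(23)}=\lambda_2\circ_1\lambda_{3;2}-\lambda_3\circ_2\lambda_{2;1}+\lambda_2\circ_2\lambda_{3;1}-\lambda_{3;1}\circ_1\lambda_2-(\lambda_{3;1}\circ_2\lambda_2)^{(12)}-(\lambda_{3;1}\circ_3\lambda_2)^{(132)}$; $\lambda_4+\lambda_4^{(34)}=\lambda_{2;1}\circ_1\lambda_3-\lambda_{3;2}\circ_1\lambda_2+\lambda_{3;2}\circ_2\lambda_2-(\lambda_{3;2}\circ_2\lambda_2)^{(12)}+\lambda_3\circ_3\lambda_{2;1}+(\lambda_{3;2}\circ_3\lambda_2)^{(23)}-(\lambda_{3;2}\circ_3\lambda_2)^{(132)}+\lambda_2\circ_2\lambda_{3;2}-(\lambda_2\circ_2\lambda_{3;2})^{(12)}+(\lambda_{2;1}\circ_2\lambda_3)^{(123)}$.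 *)

theory Defs
  imports "HOL-Analysis.Analysis" "HOL-Library.Function_Algebras" "HOL-Combinatorics.Cycles"
begin

text \<open>Pointwise real vector space structure on functions; the additive structure comes from
  \<^theory>\<open>HOL-Library.Function_Algebras\<close>. It is used for sections, for smooth functions
  and for the multilinear operations themselves.\<close>

instantiation "fun" :: (type, real_vector) real_vector
begin

definition scaleR_fun :: "real \<Rightarrow> ('a \<Rightarrow> 'b) \<Rightarrow> 'a \<Rightarrow> 'b"
  where "scaleR_fun r f = (\<lambda>x. r *\<^sub>R f x)"

instance
  by standard (auto simp: scaleR_fun_def fun_eq_iff plus_fun_def algebra_simps)

end

definition lin_on :: "'u::real_vector set \<Rightarrow> ('u \<Rightarrow> 'w::real_vector) \<Rightarrow> bool"
  where "lin_on V T \<longleftrightarrow>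
    (\<forall>u\<in>V. \<forall>v\<in>V. T (u + v) = T u + T v) \<and> (\<forall>r. \<forall>u\<in>V. T (r *\<^sub>R u) = r *\<^sub>R T u)"


section \<open>Smooth manifolds\<close>

text \<open>Maps of class \<open>C\<^sup>k\<close> on an open subset of a finite-dimensional space.\<close>

primrec Ck_on :: "nat \<Rightarrow> 'a::real_normed_vector set \<Rightarrow> ('a \<Rightarrow> 'b::real_normed_vector) \<Rightarrow> bool" where
  "Ck_on 0 S f \<longleftrightarrow> continuous_on S f"
| "Ck_on (Suc k) S f \<longleftrightarrow>
     (\<exists>f'. (\<forall>x\<in>S. (f has_derivative f' x) (at x)) \<and> (\<forall>v. Ck_on k S (\<lambda>x. f' x v)))"

definition smooth_on :: "'a::real_normed_vector set \<Rightarrow> ('a \<Rightarrow> 'b::real_normed_vector) \<Rightarrow> bool"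
  where "smooth_on S f \<longleftrightarrow> (\<forall>k. Ck_on k S f)"

text \<open>The manifold is the whole type \<open>'m\<close>. The model space \<open>'a\<close> is a finite-dimensional inner
  product space rather than a \<^class>\<open>euclidean_space\<close>, because the latter excludes dimension 0.\<close>

type_synonym ('m, 'a) atlas = "('m set \<times> ('m \<Rightarrow> 'a)) set"

definition smooth_manifold ::
    "('m::{t2_space, second_countable_topology}, 'a::real_inner) atlas \<Rightarrow> bool"
  where "smooth_manifold A \<longleftrightarrow>
    (\<exists>B::'a set. finite B \<and> span B = UNIV) \<and>
    (\<Union>(U, \<phi>)\<in>A. U) = UNIV \<and>
    (\<forall>(U, \<phi>)\<in>A. open U \<and> open (\<phi> ` U) \<and> homeomorphism U (\<phi> ` U) \<phi> (inv_into U \<phi>)) \<and>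
    (\<forall>(U, \<phi>)\<in>A. \<forall>(V, \<psi>)\<in>A. smooth_on (\<phi> ` (U \<inter> V)) (\<psi> \<circ> inv_into U \<phi>))"

definition smooth_fun_on :: "('m, 'a::real_inner) atlas \<Rightarrow> 'm set \<Rightarrow> ('m \<Rightarrow> real) \<Rightarrow> bool"
  where "smooth_fun_on A W f \<longleftrightarrow> (\<forall>(U, \<phi>)\<in>A. smooth_on (\<phi> ` (U \<inter> W)) (f \<circ> inv_into U \<phi>))"

definition Cinf :: "('m, 'a::real_inner) atlas \<Rightarrow> ('m \<Rightarrow> real) set"
  where "Cinf A = {f. smooth_fun_on A UNIV f}"

text \<open>Tangent vectors at \<open>x\<close> are derivations at \<open>x\<close> of the algebra of smooth functions.\<close>

definition tangent_space :: "('m, 'a::real_inner) atlas \<Rightarrow> 'm \<Rightarrow> (('m \<Rightarrow> real) \<Rightarrow> real) set"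
  where "tangent_space A x = {X. lin_on (Cinf A) X \<and>
    (\<forall>f\<in>Cinf A. \<forall>g\<in>Cinf A. X (\<lambda>y. f y * g y) = f x * X g + g x * X f)}"


section \<open>Vector bundles\<close>

text \<open>The fibres are linear subspaces of an ambient real vector space \<open>'v\<close>, which carries no
  topology and need not be finite-dimensional. A local trivialisation over \<open>U\<close> of rank \<open>r\<close> is
  given by the corresponding frame \<open>b 0, \<dots>, b (r - 1)\<close>. The rank may differ between
  trivialisations, so it is only locally constant.\<close>

record ('m, 'v) vbundle =
  fibre :: "'m \<Rightarrow> 'v set"
  frames :: "('m set \<times> nat \<times> (nat \<Rightarrow> 'm \<Rightarrow> 'v)) set"

definition smooth_in_frame :: "('m, 'a::real_inner) atlas \<Rightarrow> 'm set \<Rightarrow> nat \<Rightarrow>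
    (nat \<Rightarrow> 'm \<Rightarrow> 'v::real_vector) \<Rightarrow> ('m \<Rightarrow> 'v) \<Rightarrow> bool"
  where "smooth_in_frame A W r b s \<longleftrightarrow>
    (\<exists>c. (\<forall>i<r. smooth_fun_on A W (c i)) \<and> (\<forall>x\<in>W. s x = (\<Sum>i<r. c i x *\<^sub>R b i x)))"

definition vector_bundle ::
    "('m::topological_space, 'a::real_inner) atlas \<Rightarrow> ('m, 'v::real_vector) vbundle \<Rightarrow> bool"
  where "vector_bundle A E \<longleftrightarrow>
    (\<forall>x. subspace (fibre E x)) \<and>
    (\<Union>(U, r, b)\<in>frames E. U) = UNIV \<and>
    (\<forall>(U, r, b)\<in>frames E. open U \<and> (\<forall>x\<in>U. inj_on (\<lambda>i. b i x) {..<r} \<and>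
        independent ((\<lambda>i. b i x) ` {..<r}) \<and> span ((\<lambda>i. b i x) ` {..<r}) = fibre E x)) \<and>
    (\<forall>(U, r, b)\<in>frames E. \<forall>(V, q, c)\<in>frames E. \<forall>j<q. smooth_in_frame A (U \<inter> V) r b (c j))"

definition sections :: "('m, 'a::real_inner) atlas \<Rightarrow> ('m, 'v::real_vector) vbundle \<Rightarrow> ('m \<Rightarrow> 'v) set"
  where "sections A E = {s. (\<forall>x. s x \<in> fibre E x) \<and>
    (\<forall>(U, r, b)\<in>frames E. smooth_in_frame A U r b s)}"

definition fmult :: "('m \<Rightarrow> real) \<Rightarrow> ('m \<Rightarrow> 'v::real_vector) \<Rightarrow> 'm \<Rightarrow> 'v"
  where "fmult f s = (\<lambda>x. f x *\<^sub>R s x)"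

definition Cinf_linear_on :: "('m, 'a::real_inner) atlas \<Rightarrow> ('m \<Rightarrow> 'v::real_vector) set \<Rightarrow>
    (('m \<Rightarrow> 'v) \<Rightarrow> 'm \<Rightarrow> 'v) \<Rightarrow> bool"
  where "Cinf_linear_on A V T \<longleftrightarrow> (\<forall>s\<in>V. \<forall>t\<in>V. T (s + t) = T s + T t) \<and>
    (\<forall>f\<in>Cinf A. \<forall>s\<in>V. T (fmult f s) = fmult f (T s))"


section \<open>Multilinear maps on graded vector spaces\<close>

text \<open>A graded vector space is a family \<open>L\<close> of subspaces indexed by the degree. A map
  \<open>L\<^sup>\<otimes>\<^sup>n \<rightarrow> L[k]\<close> is given by its values on \<open>n\<close>-tuples of homogeneous elements, each of which comes
  with its degree; it carries its arity \<open>n\<close> and its degree \<open>k\<close>.\<close>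

type_synonym 'l tuple = "(int \<times> 'l) list"

datatype 'l gmap = GMap (arity: nat) (degree: int) (app: "'l tuple \<Rightarrow> 'l")

definition homogeneous :: "(int \<Rightarrow> 'l set) \<Rightarrow> nat \<Rightarrow> 'l tuple \<Rightarrow> bool"
  where "homogeneous L n vs \<longleftrightarrow> length vs = n \<and> (\<forall>(i, v)\<in>set vs. v \<in> L i)"

definition tdeg :: "'l tuple \<Rightarrow> int"
  where "tdeg vs = sum_list (map fst vs)"

definition sign_pow :: "int \<Rightarrow> real"
  where "sign_pow k = (if even k then 1 else - 1)"

definition is_gmap :: "(int \<Rightarrow> 'l::real_vector set) \<Rightarrow> nat \<Rightarrow> int \<Rightarrow> 'l gmap \<Rightarrow> bool"
  where "is_gmap L n k \<mu> \<longleftrightarrow> arity \<mu> = n \<and> degree \<mu> = k \<and>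
    (\<forall>vs. homogeneous L n vs \<longrightarrow> app \<mu> vs \<in> L (tdeg vs + k) \<and>
      (\<forall>i<n. lin_on (L (fst (vs ! i))) (\<lambda>u. app \<mu> (vs[i := (fst (vs ! i), u)]))))"

definition eq_on :: "(int \<Rightarrow> 'l set) \<Rightarrow> nat \<Rightarrow> ('l tuple \<Rightarrow> 'l) \<Rightarrow> ('l tuple \<Rightarrow> 'l) \<Rightarrow> bool"
  where "eq_on L n F G \<longleftrightarrow> (\<forall>vs. homogeneous L n vs \<longrightarrow> F vs = G vs)"

text \<open>The partial composition \<open>\<mu> \<circ>\<^sub>i \<nu>\<close>, with inputs numbered from 1.\<close>

definition pcomp :: "'l::real_vector gmap \<Rightarrow> nat \<Rightarrow> 'l gmap \<Rightarrow> 'l tuple \<Rightarrow> 'l"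
    ("(_ \<odot>\<^bsub>_\<^esub> _)" [76, 0, 76] 75)
  where "pcomp \<mu> i \<nu> = (\<lambda>vs.
    let us = take (i - 1) vs;
        ws = take (arity \<nu>) (drop (i - 1) vs);
        zs = drop (i - 1 + arity \<nu>) vs
    in sign_pow (degree \<nu> * tdeg us) *\<^sub>R app \<mu> (us @ (tdeg ws + degree \<nu>, app \<nu> ws) # zs))"

text \<open>The Koszul sign of the rearrangement \<open>v\<^sub>1, \<dots>, v\<^sub>n \<mapsto> v\<^bsub>\<sigma>\<inverse>(1)\<^esub>, \<dots>, v\<^bsub>\<sigma>\<inverse>(n)\<^esub>\<close>
  is the product of the signs of all transposed pairs.\<close>

definition koszul :: "(nat \<Rightarrow> nat) \<Rightarrow> 'l tuple \<Rightarrow> real"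
  where "koszul \<sigma> vs =
    (\<Prod>(a, b)\<in>{(a, b). a \<in> {1..length vs} \<and> b \<in> {1..length vs} \<and> a < b \<and> \<sigma> a > \<sigma> b}.
       sign_pow (fst (vs ! (a - 1)) * fst (vs ! (b - 1))))"

definition perm :: "(nat \<Rightarrow> nat) \<Rightarrow> ('l::real_vector tuple \<Rightarrow> 'l) \<Rightarrow> 'l tuple \<Rightarrow> 'l"
  where "perm \<sigma> F = (\<lambda>vs. koszul \<sigma> vs *\<^sub>R F (map (\<lambda>j. vs ! (inv \<sigma> j - 1)) [1..<length vs + 1]))"

abbreviation cyc :: "nat list \<Rightarrow> nat \<Rightarrow> nat"
  where "cyc \<equiv> cycle_of_list"

text \<open>The differential \<open>\<partial>(\<mu>) = d \<circ> \<mu> - (-1)\<^bsup>|\<mu>|\<^esup> \<mu> \<circ> d\<close>; the differential of the tensor power is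
  the sum of the \<open>1 \<otimes> \<dots> \<otimes> d \<otimes> \<dots> \<otimes> 1\<close>, whose Koszul signs are those of \<^const>\<open>pcomp\<close>.\<close>

definition bdry :: "'l::real_vector gmap \<Rightarrow> 'l gmap \<Rightarrow> 'l tuple \<Rightarrow> 'l"
  where "bdry d \<mu> = (d \<odot>\<^bsub>1\<^esub> \<mu>) - sign_pow (degree \<mu>) *\<^sub>R (\<Sum>i=1..arity \<mu>. \<mu> \<odot>\<^bsub>i\<^esub> d)"

definition three_term_complex :: "(int \<Rightarrow> 'l::real_vector set) \<Rightarrow> 'l gmap \<Rightarrow> bool"
  where "three_term_complex L d \<longleftrightarrow>
    (\<forall>i. subspace (L i)) \<and> (\<forall>i. i \<notin> {0, 1, 2} \<longrightarrow> L i = {0}) \<and>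
    is_gmap L 1 (- 1) d \<and> eq_on L 1 (d \<odot>\<^bsub>1\<^esub> d) 0"


section \<open>Leibniz 3-algebras and weak Lie 3-algebras\<close>

definition leibniz_3_algebra :: "(int \<Rightarrow> 'l::real_vector set) \<Rightarrow> 'l gmap \<Rightarrow>
    'l gmap \<Rightarrow> 'l gmap \<Rightarrow> 'l gmap \<Rightarrow> bool"
  where "leibniz_3_algebra L d l2 l3 l4 \<longleftrightarrow>
    three_term_complex L d \<and> is_gmap L 2 0 l2 \<and> is_gmap L 3 1 l3 \<and> is_gmap L 4 2 l4 \<and>
    eq_on L 2 (bdry d l2) 0 \<and>
    eq_on L 3 (bdry d l3)
      ((l2 \<odot>\<^bsub>2\<^esub> l2) - (l2 \<odot>\<^bsub>1\<^esub> l2) - perm (cyc [1,2]) (l2 \<odot>\<^bsub>2\<^esub> l2)) \<and>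
    eq_on L 4 (bdry d l4)
      ((l2 \<odot>\<^bsub>1\<^esub> l3) + (l2 \<odot>\<^bsub>2\<^esub> l3)
       - perm (cyc [1,2]) (l2 \<odot>\<^bsub>2\<^esub> l3) + perm (cyc [1,2,3]) (l2 \<odot>\<^bsub>2\<^esub> l3)
       - (l3 \<odot>\<^bsub>1\<^esub> l2) + (l3 \<odot>\<^bsub>2\<^esub> l2) - perm (cyc [1,2]) (l3 \<odot>\<^bsub>2\<^esub> l2)
       - (l3 \<odot>\<^bsub>3\<^esub> l2) + perm (cyc [2,3]) (l3 \<odot>\<^bsub>3\<^esub> l2) - perm (cyc [1,3,2]) (l3 \<odot>\<^bsub>3\<^esub> l2)) \<and>
    eq_on L 5 0
      ((l2 \<odot>\<^bsub>1\<^esub> l4) - (l2 \<odot>\<^bsub>2\<^esub> l4)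
       + perm (cyc [1,2]) (l2 \<odot>\<^bsub>2\<^esub> l4) - perm (cyc [1,2,3]) (l2 \<odot>\<^bsub>2\<^esub> l4)
       + perm (cyc [1,2,3,4]) (l2 \<odot>\<^bsub>2\<^esub> l4)
       + (l3 \<odot>\<^bsub>1\<^esub> l3)
       + (l3 \<odot>\<^bsub>2\<^esub> l3) - perm (cyc [1,2]) (l3 \<odot>\<^bsub>2\<^esub> l3) + perm (cyc [1,2,3]) (l3 \<odot>\<^bsub>2\<^esub> l3)
       + (l3 \<odot>\<^bsub>3\<^esub> l3) - perm (cyc [2,3]) (l3 \<odot>\<^bsub>3\<^esub> l3) + perm (cyc [1,3,2]) (l3 \<odot>\<^bsub>3\<^esub> l3)
       + perm (cyc [2,3,4]) (l3 \<odot>\<^bsub>3\<^esub> l3) - perm (cyc [1,3,4,2]) (l3 \<odot>\<^bsub>3\<^esub> l3)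
       + perm (cyc [1,3] \<circ> cyc [2,4]) (l3 \<odot>\<^bsub>3\<^esub> l3)
       + (l4 \<odot>\<^bsub>1\<^esub> l2)
       - (l4 \<odot>\<^bsub>2\<^esub> l2) + perm (cyc [1,2]) (l4 \<odot>\<^bsub>2\<^esub> l2)
       + (l4 \<odot>\<^bsub>3\<^esub> l2) - perm (cyc [2,3]) (l4 \<odot>\<^bsub>3\<^esub> l2) + perm (cyc [1,3,2]) (l4 \<odot>\<^bsub>3\<^esub> l2)
       - (l4 \<odot>\<^bsub>4\<^esub> l2) + perm (cyc [3,4]) (l4 \<odot>\<^bsub>4\<^esub> l2)
       - perm (cyc [2,4,3]) (l4 \<odot>\<^bsub>4\<^esub> l2) + perm (cyc [1,4,3,2]) (l4 \<odot>\<^bsub>4\<^esub> l2))"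

text \<open>The arguments \<open>s\<close>, \<open>s11\<close>, \<open>t1\<close>, \<open>t2\<close> are \<open>\<lambda>\<^bsub>2;1\<^esub>\<close>, \<open>\<lambda>\<^bsub>2;1,1\<^esub>\<close>, \<open>\<lambda>\<^bsub>3;1\<^esub>\<close>, \<open>\<lambda>\<^bsub>3;2\<^esub>\<close>.\<close>

definition weak_lie_3_algebra :: "(int \<Rightarrow> 'l::real_vector set) \<Rightarrow> 'l gmap \<Rightarrow>
    'l gmap \<Rightarrow> 'l gmap \<Rightarrow> 'l gmap \<Rightarrow> 'l gmap \<Rightarrow> 'l gmap \<Rightarrow> 'l gmap \<Rightarrow> 'l gmap \<Rightarrow> bool"
  where "weak_lie_3_algebra L d l2 s l3 s11 t1 t2 l4 \<longleftrightarrow>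
    leibniz_3_algebra L d l2 l3 l4 \<and>
    is_gmap L 2 1 s \<and> is_gmap L 2 2 s11 \<and> is_gmap L 3 2 t1 \<and> is_gmap L 3 2 t2 \<and>
    eq_on L 2 (bdry d s) (app l2 + perm (cyc [1,2]) (app l2)) \<and>
    eq_on L 2 (bdry d s11) (app s - perm (cyc [1,2]) (app s)) \<and>
    eq_on L 3 (bdry d t1) (app l3 + perm (cyc [1,2]) (app l3) + (l2 \<odot>\<^bsub>1\<^esub> s)) \<and>
    eq_on L 3 (bdry d t2)
      (app l3 + perm (cyc [2,3]) (app l3) - (l2 \<odot>\<^bsub>2\<^esub> s) + (s \<odot>\<^bsub>1\<^esub> l2)
       + perm (cyc [1,2]) (s \<odot>\<^bsub>2\<^esub> l2)) \<and>
    eq_on L 2 (app s11 + perm (cyc [1,2]) (app s11)) 0 \<and>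
    eq_on L 3 (app t1 - perm (cyc [1,2]) (app t1)) (l2 \<odot>\<^bsub>1\<^esub> s11) \<and>
    eq_on L 3
      (app t1 - perm (cyc [1,2]) (app t2) + perm (cyc [1,3,2]) (app t1)
       - app t2 + perm (cyc [2,3]) (app t1) - perm (cyc [1,2,3]) (app t2))
      ((s \<odot>\<^bsub>2\<^esub> s) + (s \<odot>\<^bsub>1\<^esub> s) + perm (cyc [1,2]) (s \<odot>\<^bsub>2\<^esub> s)
       + perm (cyc [1,3,2]) (s11 \<odot>\<^bsub>2\<^esub> l2)) \<and>
    eq_on L 3 (app t2 - perm (cyc [2,3]) (app t2))
      (- (l2 \<odot>\<^bsub>2\<^esub> s11) + (s11 \<odot>\<^bsub>1\<^esub> l2) + perm (cyc [1,2]) (s11 \<odot>\<^bsub>2\<^esub> l2)) \<and>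
    eq_on L 4 (app l4 + perm (cyc [1,2]) (app l4))
      ((l2 \<odot>\<^bsub>1\<^esub> t1) - (t1 \<odot>\<^bsub>3\<^esub> l2) + perm (cyc [1,2,3]) (l2 \<odot>\<^bsub>2\<^esub> t1) + (l3 \<odot>\<^bsub>1\<^esub> s)) \<and>
    eq_on L 4 (app l4 + perm (cyc [2,3]) (app l4))
      ((l2 \<odot>\<^bsub>1\<^esub> t2) - (l3 \<odot>\<^bsub>2\<^esub> s) + (l2 \<odot>\<^bsub>2\<^esub> t1) - (t1 \<odot>\<^bsub>1\<^esub> l2)
       - perm (cyc [1,2]) (t1 \<odot>\<^bsub>2\<^esub> l2) - perm (cyc [1,3,2]) (t1 \<odot>\<^bsub>3\<^esub> l2)) \<and>
    eq_on L 4 (app l4 + perm (cyc [3,4]) (app l4))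
      ((s \<odot>\<^bsub>1\<^esub> l3) - (t2 \<odot>\<^bsub>1\<^esub> l2) + (t2 \<odot>\<^bsub>2\<^esub> l2) - perm (cyc [1,2]) (t2 \<odot>\<^bsub>2\<^esub> l2)
       + (l3 \<odot>\<^bsub>3\<^esub> s) + perm (cyc [2,3]) (t2 \<odot>\<^bsub>3\<^esub> l2) - perm (cyc [1,3,2]) (t2 \<odot>\<^bsub>3\<^esub> l2)
       + (l2 \<odot>\<^bsub>2\<^esub> t2) - perm (cyc [1,2]) (l2 \<odot>\<^bsub>2\<^esub> t2) + perm (cyc [1,2,3]) (s \<odot>\<^bsub>2\<^esub> l3))"


section \<open>CLWX 2-algebroids\<close>

text \<open>The graded bundle is an internal direct sum: the fibres of \<open>E0\<close> and \<open>E1\<close> at \<open>x\<close> are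
  independent subspaces of \<open>'v\<close>. The bundle maps \<open>bnd\<close> (that is, \<open>\<partial>\<close>), \<open>anchor\<close> (that is, \<open>\<rho>\<close>,
  with values acting on functions) and \<open>pair\<close> (that is, \<open>S\<close>) are given fibrewise; \<open>circ\<close> and
  \<open>Omega\<close> act on sections of the total bundle.\<close>

record ('m, 'a, 'v) clwx =
  base :: "('m, 'a) atlas"
  E0 :: "('m, 'v) vbundle"
  E1 :: "('m, 'v) vbundle"
  bnd :: "'m \<Rightarrow> 'v \<Rightarrow> 'v"
  anchor :: "'m \<Rightarrow> 'v \<Rightarrow> ('m \<Rightarrow> real) \<Rightarrow> real"
  circ :: "('m \<Rightarrow> 'v) \<Rightarrow> ('m \<Rightarrow> 'v) \<Rightarrow> 'm \<Rightarrow> 'v"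
  Omega :: "('m \<Rightarrow> 'v) \<Rightarrow> ('m \<Rightarrow> 'v) \<Rightarrow> ('m \<Rightarrow> 'v) \<Rightarrow> 'm \<Rightarrow> 'v"
  pair :: "'m \<Rightarrow> 'v \<Rightarrow> 'v \<Rightarrow> real"

definition total_fibre :: "('m, 'a, 'v::real_vector) clwx \<Rightarrow> 'm \<Rightarrow> 'v set"
  where "total_fibre E x = {u + v | u v. u \<in> fibre (E0 E) x \<and> v \<in> fibre (E1 E) x}"

definition GammaE :: "('m, 'a::real_inner, 'v::real_vector) clwx \<Rightarrow> int \<Rightarrow> ('m \<Rightarrow> 'v) set"
  where "GammaE E i =
    (if i = 0 then sections (base E) (E0 E) else if i = 1 then sections (base E) (E1 E) else {0})"

definition total_GammaE :: "('m, 'a::real_inner, 'v::real_vector) clwx \<Rightarrow> ('m \<Rightarrow> 'v) set"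
  where "total_GammaE E = {s + t | s t. s \<in> GammaE E 0 \<and> t \<in> GammaE E 1}"

definition bnd_sec :: "('m, 'a, 'v) clwx \<Rightarrow> ('m \<Rightarrow> 'v) \<Rightarrow> 'm \<Rightarrow> 'v"
  where "bnd_sec E e = (\<lambda>x. bnd E x (e x))"

definition anchor_sec :: "('m, 'a, 'v) clwx \<Rightarrow> ('m \<Rightarrow> 'v) \<Rightarrow> ('m \<Rightarrow> real) \<Rightarrow> 'm \<Rightarrow> real"
  where "anchor_sec E e f = (\<lambda>x. anchor E x (e x) f)"

definition pair_sec :: "('m, 'a, 'v) clwx \<Rightarrow> ('m \<Rightarrow> 'v) \<Rightarrow> ('m \<Rightarrow> 'v) \<Rightarrow> 'm \<Rightarrow> real"
  where "pair_sec E e e' = (\<lambda>x. pair E x (e x) (e' x))"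

definition Dop :: "('m, 'a::real_inner, 'v::real_vector) clwx \<Rightarrow> ('m \<Rightarrow> real) \<Rightarrow> 'm \<Rightarrow> 'v"
  where "Dop E f = (THE s. s \<in> GammaE E 1 \<and> (\<forall>e\<in>total_GammaE E. pair_sec E e s = anchor_sec E e f))"

text \<open>A fibrewise linear map is a smooth bundle map iff it preserves smoothness of sections; a
  vector field \<open>X\<close> is smooth iff \<open>X f\<close> is smooth for every smooth function \<open>f\<close>.\<close>

definition dg_vector_bundle_2 ::
    "('m::topological_space, 'a::real_inner, 'v::real_vector) clwx \<Rightarrow> bool"
  where "dg_vector_bundle_2 E \<longleftrightarrow>
    vector_bundle (base E) (E0 E) \<and> vector_bundle (base E) (E1 E) \<and>
    (\<forall>x. fibre (E0 E) x \<inter> fibre (E1 E) x = {0}) \<and>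
    (\<forall>x. lin_on (total_fibre E x) (bnd E x)) \<and>
    (\<forall>x. \<forall>u\<in>fibre (E0 E) x. bnd E x u = 0) \<and>
    (\<forall>x. \<forall>u\<in>fibre (E1 E) x. bnd E x u \<in> fibre (E0 E) x) \<and>
    (\<forall>e\<in>GammaE E 1. bnd_sec E e \<in> GammaE E 0)"

definition anchor_morphism :: "('m, 'a::real_inner, 'v::real_vector) clwx \<Rightarrow> bool"
  where "anchor_morphism E \<longleftrightarrow>
    (\<forall>x. \<forall>f\<in>Cinf (base E). lin_on (total_fibre E x) (\<lambda>u. anchor E x u f)) \<and>
    (\<forall>x. \<forall>u\<in>total_fibre E x. anchor E x u \<in> tangent_space (base E) x) \<and>
    (\<forall>e\<in>total_GammaE E. \<forall>f\<in>Cinf (base E). anchor_sec E e f \<in> Cinf (base E)) \<and>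
    (\<forall>x. \<forall>u\<in>fibre (E1 E) x. \<forall>f\<in>Cinf (base E). anchor E x u f = 0) \<and>
    (\<forall>x. \<forall>u\<in>fibre (E1 E) x. \<forall>f\<in>Cinf (base E). anchor E x (bnd E x u) f = 0)"

definition circ_product :: "('m, 'a::real_inner, 'v::real_vector) clwx \<Rightarrow> bool"
  where "circ_product E \<longleftrightarrow>
    (\<forall>e\<in>total_GammaE E. lin_on (total_GammaE E) (circ E e)) \<and>
    (\<forall>e\<in>total_GammaE E. lin_on (total_GammaE E) (\<lambda>e'. circ E e' e)) \<and>
    (\<forall>i j. \<forall>e\<in>GammaE E i. \<forall>e'\<in>GammaE E j. circ E e e' \<in> GammaE E (i + j)) \<and>
    (\<forall>e\<in>GammaE E 0. \<forall>e'\<in>GammaE E 0. circ E e e' = - circ E e' e)"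

text \<open>For degree reasons \<open>Omega\<close> is nonzero only on triples from \<open>E0\<close>, where the graded
  skew-symmetry is the ordinary one.\<close>

definition graded_3_form :: "('m, 'a::real_inner, 'v::real_vector) clwx \<Rightarrow> bool"
  where "graded_3_form E \<longleftrightarrow>
    (\<forall>e1\<in>total_GammaE E. \<forall>e2\<in>total_GammaE E.
      Cinf_linear_on (base E) (total_GammaE E) (\<lambda>e. Omega E e e1 e2) \<and>
      Cinf_linear_on (base E) (total_GammaE E) (\<lambda>e. Omega E e1 e e2) \<and>
      Cinf_linear_on (base E) (total_GammaE E) (\<lambda>e. Omega E e1 e2 e)) \<and>
    (\<forall>i j k. \<forall>e1\<in>GammaE E i. \<forall>e2\<in>GammaE E j. \<forall>e3\<in>GammaE E k.
      Omega E e1 e2 e3 \<in> GammaE E (i + j + k + 1)) \<and>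
    (\<forall>e1\<in>GammaE E 0. \<forall>e2\<in>GammaE E 0. \<forall>e3\<in>GammaE E 0.
      Omega E e2 e1 e3 = - Omega E e1 e2 e3 \<and> Omega E e1 e3 e2 = - Omega E e1 e2 e3)"

definition bundle_metric :: "('m, 'a::real_inner, 'v::real_vector) clwx \<Rightarrow> bool"
  where "bundle_metric E \<longleftrightarrow>
    (\<forall>x. \<forall>u\<in>total_fibre E x. lin_on (total_fibre E x) (pair E x u)) \<and>
    (\<forall>x. \<forall>u\<in>total_fibre E x. \<forall>v\<in>total_fibre E x. pair E x u v = pair E x v u) \<and>
    (\<forall>e\<in>total_GammaE E. \<forall>e'\<in>total_GammaE E. pair_sec E e e' \<in> Cinf (base E)) \<and>
    (\<forall>x. \<forall>u\<in>total_fibre E x. (\<forall>v\<in>total_fibre E x. pair E x u v = 0) \<longrightarrow> u = 0)"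

definition clwx_2_algebroid ::
    "('m::topological_space, 'a::real_inner, 'v::real_vector) clwx \<Rightarrow> bool"
  where "clwx_2_algebroid E \<longleftrightarrow>
    dg_vector_bundle_2 E \<and> anchor_morphism E \<and> circ_product E \<and> graded_3_form E \<and>
    bundle_metric E \<and>
    (\<forall>i\<in>{0, 1}. \<forall>e\<in>GammaE E i. \<forall>e'\<in>GammaE E i. pair_sec E e e' = 0) \<and>
    leibniz_3_algebra (GammaE E)
      (GMap 1 (- 1) (\<lambda>vs. bnd_sec E (snd (vs ! 0))))
      (GMap 2 0 (\<lambda>vs. circ E (snd (vs ! 0)) (snd (vs ! 1))))
      (GMap 3 1 (\<lambda>vs. Omega E (snd (vs ! 0)) (snd (vs ! 1)) (snd (vs ! 2))))
      (GMap 4 2 0) \<and>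
    (\<forall>e\<in>total_GammaE E. circ E e e = (1/2) *\<^sub>R Dop E (pair_sec E e e)) \<and>
    (\<forall>e1\<in>total_GammaE E. \<forall>e2\<in>total_GammaE E.
      pair_sec E (bnd_sec E e1) e2 = pair_sec E e1 (bnd_sec E e2)) \<and>
    (\<forall>e1\<in>total_GammaE E. \<forall>e2\<in>total_GammaE E. \<forall>e3\<in>total_GammaE E.
      anchor_sec E e1 (pair_sec E e2 e3) =
        pair_sec E (circ E e1 e2) e3 + pair_sec E e2 (circ E e1 e3)) \<and>
    (\<forall>e1\<in>total_GammaE E. \<forall>e2\<in>total_GammaE E. \<forall>e3\<in>total_GammaE E. \<forall>e4\<in>total_GammaE E.
      pair_sec E (Omega E e1 e2 e3) e4 = - pair_sec E e3 (Omega E e1 e2 e4))"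


section \<open>The associated 3-term complex and its structure maps\<close>

text \<open>The graded space is realised inside \<open>\<Gamma>E \<oplus> C\<^sup>\<infinity>(M)\<close>. Since all maps are linear in each
  argument, extension by zero amounts to projecting to the relevant summand.\<close>

type_synonym ('m, 'v) assoc = "('m \<Rightarrow> 'v) \<times> ('m \<Rightarrow> real)"

definition assoc_space ::
    "('m, 'a::real_inner, 'v::real_vector) clwx \<Rightarrow> int \<Rightarrow> ('m, 'v) assoc set"
  where "assoc_space E i =
    (if i \<in> {0, 1} then {(e, 0) | e. e \<in> GammaE E i}
     else if i = 2 then {(0, f) | f. f \<in> Cinf (base E)} else {0})"

definition D_map :: "('m, 'a::real_inner, 'v::real_vector) clwx \<Rightarrow> ('m, 'v) assoc gmap"
  where "D_map E = GMap 1 (- 1) (\<lambda>vs. (Dop E (snd (snd (vs ! 0))), 0))"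

definition assoc_d :: "('m, 'a::real_inner, 'v::real_vector) clwx \<Rightarrow> ('m, 'v) assoc gmap"
  where "assoc_d E =
    GMap 1 (- 1) (\<lambda>vs. (bnd_sec E (fst (snd (vs ! 0))) + Dop E (snd (snd (vs ! 0))), 0))"

definition circ_map :: "('m, 'a::real_inner, 'v::real_vector) clwx \<Rightarrow> ('m, 'v) assoc gmap"
  where "circ_map E = GMap 2 0 (\<lambda>vs. (circ E (fst (snd (vs ! 0))) (fst (snd (vs ! 1))), 0))"

definition S_map :: "('m, 'a::real_inner, 'v::real_vector) clwx \<Rightarrow> ('m, 'v) assoc gmap"
  where "S_map E = GMap 2 1 (\<lambda>vs. (0, pair_sec E (fst (snd (vs ! 0))) (fst (snd (vs ! 1)))))"

definition Omega_map :: "('m, 'a::real_inner, 'v::real_vector) clwx \<Rightarrow> ('m, 'v) assoc gmap"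
  where "Omega_map E = GMap 3 1
    (\<lambda>vs. (Omega E (fst (snd (vs ! 0))) (fst (snd (vs ! 1))) (fst (snd (vs ! 2))), 0))"

definition lambda2 :: "('m, 'a::real_inner, 'v::real_vector) clwx \<Rightarrow> ('m, 'v) assoc gmap"
  where "lambda2 E = GMap 2 0 (app (circ_map E) + (S_map E \<odot>\<^bsub>2\<^esub> D_map E))"

end

theory Submission
  imports Defs "Jordan_Normal_Form.Determinant"
begin

text \<open>
  The section \<open>D f\<close> is found locally by solving a linear system: in frames \<open>b\<close> of \<open>E0\<close> and \<open>c\<close> of
  \<open>E1\<close>, isotropy and nondegeneracy make the matrix \<open>S(b\<^sub>i, c\<^sub>j)\<close> square and invertible, and Cramer's
  rule makes the solution smooth. Nondegeneracy gives uniqueness, hence a global section. Bump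
  functions turn the axioms, which speak about global sections, into statements about fibres.

  Axiom (v) gives the Leibniz rule for \<open>\<circ>\<close>; inserting it into the Jacobi identity shows that
  \<open>\<rho>(e\<^sub>1 \<circ> e\<^sub>2)\<close> is the commutator of \<open>\<rho>(e\<^sub>1)\<close> and \<open>\<rho>(e\<^sub>2)\<close>. Pairing with sections of \<open>E0\<close> then yields
  \<open>e \<circ> D f = D(\<rho>(e) f)\<close>, and polarising axiom (iii) yields \<open>D f \<circ> e = 0\<close>. The identities of the weak
  Lie 3-algebra not involving \<open>D\<close> are those of \<open>\<Gamma>E\<close>, extended by zero; in the others the terms with
  \<open>D\<close> cancel by these two facts and (iii)--(vi).
\<close>

section \<open>Calculus of smooth maps\<close>

text \<open>Isotropy and nondegeneracy make \<open>E1\<close> the dual of \<open>E0\<close>, and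
  \<open>D f\<close> is the functional sending u to \<rho>(u) f, that is, the transpose of the
  anchor applied to df. In a single fibre its existence is linear algebra. The analytic work goes
  into smoothness, because metric and anchor are known to be smooth only when fed with global
  sections, whereas frames are local.

  That the anchor respects the product is not among the axioms, and the Jacobi identity holds only
  up to \<open>bd (Omega E e1 e2 e3)\<close>. This correction is linear over functions in
  \<open>e3\<close>, so it drops out when f e3 is compared with \<open>e3\<close>.

  Signs are mostly settled by degree: \<rho> sees only degree 0, \<open>Omega\<close> only three
  arguments of degree 0, and \<open>S\<close> only pairs of total degree 1. In the identities
  resting on (iii), (v) and (vi), wherever a Koszul sign differs from the plain axiom, the terms
  concerned already vanish.\<close>

lemma Ck_on_subset:
  assumes "Ck_on k S f" "T \<subseteq> S"
  shows "Ck_on k T f"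
  using assms
proof (induction k arbitrary: f)
  case 0
  then show ?case using continuous_on_subset by auto
next
  case (Suc k)
  then obtain f' where "\<forall>x\<in>S. (f has_derivative f' x) (at x)" "\<forall>v. Ck_on k S (\<lambda>x. f' x v)" by auto
  with Suc.IH Suc.prems(2) show ?case unfolding Ck_on.simps by (intro exI[of _ f']) blast
qed

text \<open>The derivative in \<open>Ck_on\<close> is taken at the point and not within
  \<open>S\<close>; openness turns agreement on \<open>S\<close> into agreement near each
  point.\<close>

lemma Ck_on_cong:
  assumes "Ck_on k S f" "open S" "\<And>x. x \<in> S \<Longrightarrow> f x = g x"
  shows "Ck_on k S g"
  using assms
proof (cases k)
  case 0
  then show ?thesis using assms by (metis Ck_on.simps(1) continuous_on_cong)
next
  case (Suc m)
  with assms obtain f' where f': "\<And>x. x \<in> S \<Longrightarrow> (f has_derivative f' x) (at x)"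
    "\<And>v. Ck_on m S (\<lambda>x. f' x v)" by auto
  have "(g has_derivative f' x) (at x)" if "x \<in> S" for x
    using has_derivative_transform_within_open[OF f'(1)[OF that] assms(2) that] assms(3) by blast
  with f'(2) Suc show ?thesis by auto
qed

lemma Ck_on_SucD: "Ck_on (Suc k) S f \<Longrightarrow> Ck_on k S f"
proof (induction k arbitrary: f)
  case 0
  then show ?case
    by (auto intro!: continuous_at_imp_continuous_on intro: has_derivative_continuous)
next
  case (Suc k)
  then obtain f' where "\<forall>x\<in>S. (f has_derivative f' x) (at x)" "\<forall>v. Ck_on (Suc k) S (\<lambda>x. f' x v)"
    using Ck_on.simps(2) by blast
  with Suc.IH show ?case by auto
qed

text \<open>\<open>Ck_on\<close> asks for one derivative on all of \<open>S\<close>, while each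
  neighbourhood brings its own. Derivatives at a point are unique, so a pointwise choice agrees with
  all of them, and the induction hypothesis applies to its directional derivatives.\<close>

lemma Ck_on_local:
  assumes "\<And>x. x \<in> S \<Longrightarrow> \<exists>T. open T \<and> x \<in> T \<and> Ck_on k T f"
  shows "Ck_on k S f"
  using assms
proof (induction k arbitrary: f)
  case 0
  show ?case unfolding Ck_on.simps
  proof (rule continuous_at_imp_continuous_on, intro ballI)
    fix x assume "x \<in> S"
    with 0 obtain T where "open T" "x \<in> T" "continuous_on T f" by auto
    then show "isCont f x" by (simp add: continuous_on_eq_continuous_at)
  qed
next
  case (Suc k)
  define f' where "f' x = (SOME D. (f has_derivative D) (at x))" for x
  have f': "f' x = D" if "(f has_derivative D) (at x)" for x D
    unfolding f'_def using that by (metis (mono_tags) has_derivative_unique someI)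
  have "(f has_derivative f' x) (at x)" if "x \<in> S" for x
  proof -
    obtain T where T: "x \<in> T" "Ck_on (Suc k) T f"
      using Suc.prems \<open>x \<in> S\<close> by blast
    then obtain g where "\<forall>y\<in>T. (f has_derivative g y) (at y)" by auto
    then show ?thesis using T(1) f' by metis
  qed
  moreover have "Ck_on k S (\<lambda>x. f' x v)" for v
  proof (rule Suc.IH)
    fix x assume "x \<in> S"
    then obtain T where T: "open T" "x \<in> T" "Ck_on (Suc k) T f"
      using Suc.prems by blast
    then obtain g where g: "\<forall>y\<in>T. (f has_derivative g y) (at y)" "\<forall>v. Ck_on k T (\<lambda>y. g y v)" by auto
    have "Ck_on k T (\<lambda>x. f' x v)"
      by (rule Ck_on_cong[of k T "\<lambda>y. g y v"]) (use g f' T in auto)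
    then show "\<exists>T. open T \<and> x \<in> T \<and> Ck_on k T (\<lambda>x. f' x v)" using T by blast
  qed
  ultimately show ?case unfolding Ck_on.simps by blast
qed

lemma Ck_on_const: "Ck_on k S (\<lambda>x. c)"
proof (induction k arbitrary: c)
  case (Suc k)
  show ?case unfolding Ck_on.simps by (rule exI[of _ "\<lambda>x v. 0"]) (auto simp: Suc)
qed auto

lemma Ck_on_add:
  assumes "Ck_on k S f" "Ck_on k S g"
  shows "Ck_on k S (\<lambda>x. f x + g x)"
  using assms
proof (induction k arbitrary: f g)
  case 0
  then show ?case by (auto intro: continuous_on_add)
next
  case (Suc k)
  obtain f' where f': "\<forall>x\<in>S. (f has_derivative f' x) (at x)" "\<forall>v. Ck_on k S (\<lambda>x. f' x v)"
    using Suc.prems by auto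
  obtain g' where g': "\<forall>x\<in>S. (g has_derivative g' x) (at x)" "\<forall>v. Ck_on k S (\<lambda>x. g' x v)"
    using Suc.prems by auto
  show ?case unfolding Ck_on.simps
    by (rule exI[of _ "\<lambda>x v. f' x v + g' x v"]) (use f' g' Suc.IH in \<open>auto intro: has_derivative_add\<close>)
qed

text \<open>The product rule expresses the derivative through the same \<open>m\<close>, with
  \<open>f\<close> and \<open>g\<close> themselves among the arguments; \<open>Ck_on_SucD\<close>
  lowers their class for the induction. General bilinear \<open>m\<close> covers both products of
  functions and inner products in the model space.\<close>

lemma Ck_on_bilinear:
  assumes "bounded_bilinear m" "Ck_on k S f" "Ck_on k S g"
  shows "Ck_on k S (\<lambda>x. m (f x) (g x))"
  using assms(2,3)
proof (induction k arbitrary: f g)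
  case 0
  then show ?case by (auto intro: bounded_bilinear.continuous_on[OF assms(1)])
next
  case (Suc k)
  obtain f' where f': "\<forall>x\<in>S. (f has_derivative f' x) (at x)" "\<forall>v. Ck_on k S (\<lambda>x. f' x v)"
    using Suc.prems by auto
  obtain g' where g': "\<forall>x\<in>S. (g has_derivative g' x) (at x)" "\<forall>v. Ck_on k S (\<lambda>x. g' x v)"
    using Suc.prems by auto
  show ?case unfolding Ck_on.simps
    by (rule exI[of _ "\<lambda>x v. m (f x) (g' x v) + m (f' x v) (g x)"])
      (use f' g' Suc.IH Ck_on_SucD[OF Suc.prems(1)] Ck_on_SucD[OF Suc.prems(2)] in
        \<open>auto intro!: bounded_bilinear.FDERIV[OF assms(1)] Ck_on_add\<close>)
qed

text \<open>For a real argument \<open>h' (f x) v\<close> is v times \<open>h' (f x) 1\<close>, so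
  the chain rule becomes a product of a directional derivative of \<open>f\<close> and a composition
  of lower class. The outer functions will be the reciprocal and \<open>flat\<close>.\<close>

lemma Ck_on_compose_real:
  fixes h :: "real \<Rightarrow> real" and f :: "'a::real_normed_vector \<Rightarrow> real"
  assumes "Ck_on k T h" "Ck_on k S f" "f ` S \<subseteq> T"
  shows "Ck_on k S (\<lambda>x. h (f x))"
  using assms
proof (induction k arbitrary: h)
  case 0
  then show ?case using continuous_on_compose2 by auto
next
  case (Suc k)
  obtain h' where h': "\<forall>x\<in>T. (h has_derivative h' x) (at x)" "\<forall>v. Ck_on k T (\<lambda>x. h' x v)"
    using Suc.prems by auto
  obtain f' where f': "\<forall>x\<in>S. (f has_derivative f' x) (at x)" "\<forall>v. Ck_on k S (\<lambda>x. f' x v)"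
    using Suc.prems by auto
  have eq: "h' (f x) v = v * h' (f x) 1" if "x \<in> S" for x v
  proof -
    have "linear (h' (f x))" using that h' Suc.prems(3) has_derivative_linear by blast
    from linear_cmul[OF this, of v 1] show ?thesis by simp
  qed
  have "((\<lambda>x. h (f x)) has_derivative (\<lambda>v. f' x v * h' (f x) 1)) (at x)" if "x \<in> S" for x
  proof -
    have "((\<lambda>x. h (f x)) has_derivative (\<lambda>v. h' (f x) (f' x v))) (at x)"
      by (rule has_derivative_compose) (use that h' f' Suc.prems(3) in auto)
    also have "(\<lambda>v. h' (f x) (f' x v)) = (\<lambda>v. f' x v * h' (f x) 1)"
      by (rule ext) (rule eq[OF that])
    finally show ?thesis .
  qed
  moreover have "Ck_on k S (\<lambda>x. f' x v * h' (f x) 1)" for v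
    by (rule Ck_on_bilinear[OF bounded_bilinear_mult])
      (use f'(2) Suc.IH[OF h'(2)[THEN spec] Ck_on_SucD[OF Suc.prems(2)] Suc.prems(3)] in auto)
  ultimately show ?case unfolding Ck_on.simps
    by (intro exI[of _ "\<lambda>x v. f' x v * h' (f x) 1"]) auto
qed

text \<open>The derivative of the reciprocal is a polynomial in the reciprocal, so the induction
  closes on itself.\<close>

lemma Ck_on_inverse: "Ck_on k (- {0}) (inverse :: real \<Rightarrow> real)"
proof (induction k)
  case 0
  then show ?case by (auto intro!: continuous_intros)
next
  case (Suc k)
  have "Ck_on k (- {0}) (\<lambda>x::real. - 1 * v * (inverse x * inverse x))" for v :: real
    by (intro Ck_on_bilinear[OF bounded_bilinear_mult] Suc Ck_on_const)
  then show ?case unfolding Ck_on.simps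
    by (intro exI[of _ "\<lambda>x v. - 1 * v * (inverse x * inverse x)"])
      (auto intro!: derivative_eq_intros simp: field_simps)
qed

text \<open>The derivative of each \<open>flat n\<close> is a combination of \<open>flat (n + 1)\<close> and \<open>flat (n + 2)\<close>, so the
  smoothness of the whole family follows from its differentiability.\<close>

definition flat :: "nat \<Rightarrow> real \<Rightarrow> real"
  where "flat n x = (if x > 0 then inverse x ^ n * exp (- inverse x) else 0)"

lemma flat_tendsto_0: "(flat n \<longlongrightarrow> 0) (at_right 0)"
proof -
  have "((\<lambda>x. inverse x ^ n / exp (inverse x)) \<longlongrightarrow> 0) (at_right (0::real))"
    using filterlim_compose[OF tendsto_power_div_exp_0 filterlim_inverse_at_top_right] .
  moreover have "eventually (\<lambda>x. inverse x ^ n / exp (inverse x) = flat n x) (at_right (0::real))"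
    by (auto simp: flat_def eventually_at_right_field exp_minus field_simps intro: exI[of _ 1])
  ultimately show ?thesis by (simp add: tendsto_cong)
qed

lemma flat_has_derivative:
  "(flat n has_real_derivative flat (n + 2) x - real n * flat (n + 1) x) (at x)"
proof -
  consider "x > 0" | "x < 0" | "x = 0" by linarith
  then show ?thesis
  proof cases
    case 1
    have "((\<lambda>x. inverse x ^ n * exp (- inverse x)) has_real_derivative
        real n * (- (inverse x * inverse x) * inverse x ^ (n - Suc 0)) * exp (- inverse x) +
        exp (- inverse x) * (inverse x * inverse x) * inverse x ^ n) (at x)"
      using 1 by (auto intro!: derivative_eq_intros)
    also have "real n * (- (inverse x * inverse x) * inverse x ^ (n - Suc 0)) * exp (- inverse x) +
        exp (- inverse x) * (inverse x * inverse x) * inverse x ^ n =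
        flat (n + 2) x - real n * flat (n + 1) x"
      using 1 by (cases n) (auto simp: flat_def algebra_simps)
    finally have "((\<lambda>x. inverse x ^ n * exp (- inverse x)) has_real_derivative
        flat (n + 2) x - real n * flat (n + 1) x) (at x)" .
    then show ?thesis
      by (rule has_field_derivative_transform_within_open[of _ _ _ "{0<..}"]) (use 1 in \<open>auto simp: flat_def\<close>)
  next
    case 2
    have "((\<lambda>x. 0) has_real_derivative flat (n + 2) x - real n * flat (n + 1) x) (at x)"
      using 2 by (auto simp: flat_def)
    then show ?thesis
      by (rule has_field_derivative_transform_within_open[of _ _ _ "{..<0}"]) (use 2 in \<open>auto simp: flat_def\<close>)
  next
    case 3
    \<comment> \<open>The right difference quotient of \<open>flat n\<close> at 0 is
      \<open>flat (n + 1)\<close>, which tends to 0; on the left it is constantly 0.\<close>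
    have "((\<lambda>y. (flat n y - flat n 0) / (y - 0)) \<longlongrightarrow> 0) (at_right 0)"
      by (rule Lim_transform_eventually[OF flat_tendsto_0[of "n + 1"]])
        (auto simp: flat_def eventually_at_right_field field_simps intro: exI[of _ 1])
    moreover have "((\<lambda>y. (flat n y - flat n 0) / (y - 0)) \<longlongrightarrow> 0) (at_left 0)"
      by (rule tendsto_eventually) (auto simp: flat_def eventually_at_left_field intro: exI[of _ "-1"])
    ultimately have "((\<lambda>y. (flat n y - flat n 0) / (y - 0)) \<longlongrightarrow> 0) (at 0)"
      by (simp add: filterlim_split_at)
    then show ?thesis using 3 by (simp add: has_field_derivative_iff flat_def)
  qed
qed

lemma Ck_on_flat: "Ck_on k S (flat n)"
proof (induction k arbitrary: n)
  case 0
  show ?case unfolding Ck_on.simps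
    by (intro continuous_at_imp_continuous_on ballI DERIV_isCont[OF flat_has_derivative])
next
  case (Suc k)
  have eq: "(\<lambda>x. (flat (n + 2) x - real n * flat (n + 1) x) * v) =
    (\<lambda>x. flat (n + 2) x * v + (- real n * v) * flat (n + 1) x)" for v
    by (auto simp: algebra_simps)
  have "Ck_on k S (\<lambda>x. (flat (n + 2) x - real n * flat (n + 1) x) * v)" for v
    unfolding eq
    by (intro Ck_on_add Ck_on_bilinear[OF bounded_bilinear_mult] Suc Ck_on_const)
  then show ?case unfolding Ck_on.simps
    by (intro exI[of _ "\<lambda>x v. (flat (n + 2) x - real n * flat (n + 1) x) * v"])
      (use flat_has_derivative in \<open>auto simp: has_field_derivative_def\<close>)
qed

text \<open>The model space of a manifold is not of class \<^class>\<open>heine_borel\<close>.\<close>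

lemma bounded_closed_imp_compact_finite_span:
  fixes S :: "'a::real_inner set" and B :: "'a set"
  assumes B: "finite B" "span B = UNIV" and S: "closed S" "bounded S"
  shows "compact S"
proof -
  obtain C :: "'a set" where C: "finite C" "span C = span B" "pairwise Linear_Algebra.orthogonal C"
    using basis_orthogonal[OF B(1)] by blast
  obtain R where R: "\<And>x. x \<in> S \<Longrightarrow> norm x \<le> R" using S(2) by (auto simp: bounded_iff)
  \<comment> \<open>A box along the normalised directions of the orthogonal set: a Minkowski sum of
    segments, hence compact. Orthogonality bounds the coefficients of a point of \<open>S\<close> by
    its norm, so \<open>K C\<close> contains \<open>S\<close>. A zero vector in \<open>C\<close> is
    harmless, since its normalisation is 0.\<close>
  define K where "K D = {(\<Sum>c\<in>D. t c *\<^sub>R (c /\<^sub>R norm c)) | t. \<forall>c\<in>D. \<bar>t c\<bar> \<le> R}" for D :: "'a set"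
  have K: "compact (K D)" if "finite D" for D
    using that
  proof (induction D)
    case empty
    have "K {} = {0}" by (auto simp: K_def)
    then show ?case by simp
  next
    case (insert d D)
    have "K (insert d D) = {x + y | x y. x \<in> (\<lambda>t. t *\<^sub>R (d /\<^sub>R norm d)) ` {-R..R} \<and> y \<in> K D}"
      (is "?l = ?r")
    proof
      show "?l \<subseteq> ?r" unfolding K_def using insert by (fastforce simp: abs_le_iff)
      show "?r \<subseteq> ?l"
      proof
        fix z assume "z \<in> ?r"
        then obtain a t where z: "z = a *\<^sub>R (d /\<^sub>R norm d) + (\<Sum>c\<in>D. t c *\<^sub>R (c /\<^sub>R norm c))"
          "\<bar>a\<bar> \<le> R" "\<forall>c\<in>D. \<bar>t c\<bar> \<le> R" by (auto simp: K_def abs_le_iff)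
        have "(\<Sum>c\<in>D. (t(d := a)) c *\<^sub>R (c /\<^sub>R norm c)) = (\<Sum>c\<in>D. t c *\<^sub>R (c /\<^sub>R norm c))"
          by (rule sum.cong) (use insert in auto)
        then show "z \<in> ?l" unfolding K_def using z insert
          by (intro CollectI exI[of _ "t(d := a)"]) auto
      qed
    qed
    moreover have "compact ((\<lambda>t. t *\<^sub>R (d /\<^sub>R norm d)) ` {-R..R})"
      by (intro compact_continuous_image continuous_intros compact_Icc)
    ultimately show ?case using compact_sums insert by auto
  qed
  have "S \<subseteq> K C"
  proof
    fix x assume "x \<in> S"
    have "x \<in> span C" using C B by simp
    then obtain u where u: "x = (\<Sum>c\<in>C. u c *\<^sub>R c)" using span_finite[OF C(1)] by auto
    have "\<bar>u c * norm c\<bar> \<le> R" if "c \<in> C" for c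
    proof -
      have "inner x c = (\<Sum>d\<in>C. u d * inner d c)" by (simp add: u inner_sum_left)
      also have "\<dots> = (\<Sum>d\<in>C. if d = c then u c * inner c c else 0)"
        using C(3) that by (intro sum.cong) (auto simp: pairwise_def Linear_Algebra.orthogonal_def)
      also have "\<dots> = u c * norm c * norm c"
        using that C(1) by (simp add: power2_norm_eq_inner[symmetric] power2_eq_square)
      finally have "\<bar>u c * norm c\<bar> * norm c \<le> norm x * norm c"
        using Cauchy_Schwarz_ineq2[of x c] by (simp add: abs_mult)
      then show ?thesis
        using R[OF \<open>x \<in> S\<close>] by (cases "c = 0") (auto intro: order_trans[OF norm_ge_zero])
    qed
    moreover have "x = (\<Sum>c\<in>C. (u c * norm c) *\<^sub>R (c /\<^sub>R norm c))"
      unfolding u by (intro sum.cong) auto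
    ultimately show "x \<in> K C" unfolding K_def
      by (intro CollectI exI[of _ "\<lambda>c. u c * norm c"] conjI ballI) blast+
  qed
  then show ?thesis using K[OF C(1)] S(1) by (metis compact_Int_closed inf.absorb_iff2 )
qed

section \<open>Smooth functions and sections on a manifold\<close>

lemma smooth_manifold_open_chart_image:
  assumes "smooth_manifold A" "(U, \<phi>) \<in> A" "open W"
  shows "open (\<phi> ` (U \<inter> W))"
proof -
  from assms have "open (\<phi> ` U)" and h: "homeomorphism U (\<phi> ` U) \<phi> (inv_into U \<phi>)"
    unfolding smooth_manifold_def by auto
  moreover have "\<phi> ` (U \<inter> W) = \<phi> ` U \<inter> inv_into U \<phi> -` W"
    using homeomorphism_apply1[OF h] by force
  ultimately show ?thesis
    using continuous_open_preimage[OF homeomorphism_cont2[OF h]] assms(3) by simp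
qed

lemma smooth_fun_on_subset: "smooth_fun_on A W f \<Longrightarrow> V \<subseteq> W \<Longrightarrow> smooth_fun_on A V f"
  unfolding smooth_fun_on_def smooth_on_def
  by (force intro: Ck_on_subset)

lemma smooth_fun_on_cong:
  assumes A: "smooth_manifold A" and W: "open W" and f: "smooth_fun_on A W f"
    and eq: "\<And>x. x \<in> W \<Longrightarrow> f x = g x"
  shows "smooth_fun_on A W g"
  unfolding smooth_fun_on_def smooth_on_def
proof clarify
  fix U \<phi> k assume U: "(U, \<phi>) \<in> A"
  then have h: "homeomorphism U (\<phi> ` U) \<phi> (inv_into U \<phi>)"
    using A unfolding smooth_manifold_def by auto
  have "Ck_on k (\<phi> ` (U \<inter> W)) (f \<circ> inv_into U \<phi>)"
    using f U unfolding smooth_fun_on_def smooth_on_def by auto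
  then show "Ck_on k (\<phi> ` (U \<inter> W)) (g \<circ> inv_into U \<phi>)"
    by (rule Ck_on_cong)
      (use smooth_manifold_open_chart_image[OF A U W] homeomorphism_apply1[OF h] eq in auto)
qed

lemma smooth_fun_on_local:
  assumes A: "smooth_manifold A"
    and loc: "\<And>x. x \<in> W \<Longrightarrow> \<exists>N. open N \<and> x \<in> N \<and> smooth_fun_on A N f"
  shows "smooth_fun_on A W f"
  unfolding smooth_fun_on_def smooth_on_def
proof clarify
  fix U \<phi> k assume U: "(U, \<phi>) \<in> A"
  show "Ck_on k (\<phi> ` (U \<inter> W)) (f \<circ> inv_into U \<phi>)"
  proof (rule Ck_on_local)
    fix y assume "y \<in> \<phi> ` (U \<inter> W)"
    then obtain x where x: "x \<in> U" "x \<in> W" "y = \<phi> x" by auto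
    from loc[OF x(2)] obtain N where N: "open N" "x \<in> N" "smooth_fun_on A N f" by auto
    then have "Ck_on k (\<phi> ` (U \<inter> N)) (f \<circ> inv_into U \<phi>)"
      using U unfolding smooth_fun_on_def smooth_on_def by auto
    then show "\<exists>T. open T \<and> y \<in> T \<and> Ck_on k T (f \<circ> inv_into U \<phi>)"
      using smooth_manifold_open_chart_image[OF A U N(1)] x N by blast
  qed
qed

lemma smooth_fun_on_const: "smooth_fun_on A W (\<lambda>x. c)"
  unfolding smooth_fun_on_def smooth_on_def by (auto simp: comp_def Ck_on_const)

lemma smooth_fun_on_add:
  "smooth_fun_on A W f \<Longrightarrow> smooth_fun_on A W g \<Longrightarrow> smooth_fun_on A W (\<lambda>x. f x + g x)"
  unfolding smooth_fun_on_def smooth_on_def by (auto simp: comp_def intro!: Ck_on_add)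

lemma smooth_fun_on_mult:
  "smooth_fun_on A W f \<Longrightarrow> smooth_fun_on A W g \<Longrightarrow> smooth_fun_on A W (\<lambda>x. f x * g x)"
  unfolding smooth_fun_on_def smooth_on_def
  by (auto simp: comp_def intro!: Ck_on_bilinear[OF bounded_bilinear_mult])

lemma smooth_fun_on_sum:
  "(\<And>i. i \<in> I \<Longrightarrow> smooth_fun_on A W (f i)) \<Longrightarrow> smooth_fun_on A W (\<lambda>x. \<Sum>i\<in>I. f i x)"
  by (induction I rule: infinite_finite_induct)
    (auto intro: smooth_fun_on_add smooth_fun_on_const)

lemma smooth_fun_on_prod:
  "(\<And>i. i \<in> I \<Longrightarrow> smooth_fun_on A W (f i)) \<Longrightarrow> smooth_fun_on A W (\<lambda>x. \<Prod>i\<in>I. f i x)"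
  by (induction I rule: infinite_finite_induct)
    (auto intro: smooth_fun_on_mult smooth_fun_on_const)

lemma smooth_fun_on_inverse:
  assumes A: "smooth_manifold A" and f: "smooth_fun_on A W f" "\<And>x. x \<in> W \<Longrightarrow> f x \<noteq> 0"
  shows "smooth_fun_on A W (\<lambda>x. inverse (f x))"
  unfolding smooth_fun_on_def smooth_on_def
proof clarify
  fix U \<phi> k assume U: "(U, \<phi>) \<in> A"
  then have h: "homeomorphism U (\<phi> ` U) \<phi> (inv_into U \<phi>)"
    using A unfolding smooth_manifold_def by auto
  have "Ck_on k (\<phi> ` (U \<inter> W)) (f \<circ> inv_into U \<phi>)"
    using f U unfolding smooth_fun_on_def smooth_on_def by auto
  then show "Ck_on k (\<phi> ` (U \<inter> W)) ((\<lambda>x. inverse (f x)) \<circ> inv_into U \<phi>)"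
    unfolding comp_def
    by (rule Ck_on_compose_real[OF Ck_on_inverse]) (use f(2) homeomorphism_apply1[OF h] in auto)
qed

text \<open>The closed set \<open>K\<close> makes products with \<open>g\<close> extendable by zero,
  and on \<open>N\<close> one can divide by \<open>g\<close>; nonvanishing on \<open>N\<close> takes
  the place of the usual plateau of value 1.\<close>

lemma exists_bump:
  fixes A :: "('m::{t2_space, second_countable_topology}, 'a::real_inner) atlas"
  assumes A: "smooth_manifold A" and W: "open W" "x \<in> W"
  obtains g K N where "smooth_fun_on A UNIV g" "closed K" "K \<subseteq> W" "\<And>y. y \<notin> K \<Longrightarrow> g y = 0"
    "open N" "x \<in> N" "\<And>y. y \<in> N \<Longrightarrow> g y \<noteq> 0"
proof -
  obtain B :: "'a set" where B: "finite B" "span B = UNIV" using A unfolding smooth_manifold_def by auto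
  have "x \<in> (\<Union>(U, \<phi>)\<in>A. U)" using A unfolding smooth_manifold_def by simp
  then obtain U \<phi> where U: "(U, \<phi>) \<in> A" "x \<in> U" by auto
  then have h: "homeomorphism U (\<phi> ` U) \<phi> (inv_into U \<phi>)" and "open U"
    using A unfolding smooth_manifold_def by auto
  define p where "p = \<phi> x"
  obtain r where r: "r > 0" "cball p r \<subseteq> \<phi> ` (U \<inter> W)"
    using smooth_manifold_open_chart_image[OF A U(1) W(1)] U(2) W(2) open_contains_cball
    unfolding p_def by blast
  define K where "K = inv_into U \<phi> ` cball p r"
  define N where "N = {y\<in>U. \<phi> y \<in> ball p r}"
  \<comment> \<open>The squared norm is smooth also at the centre, and \<open>flat 0\<close> is
    positive exactly for positive arguments. Since the closed ball lies in the chart image,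
    \<open>K\<close> is compact and hence closed in the Hausdorff space. The open sets
    \<open>U\<close> and \<open>- K\<close> then cover the manifold, and \<open>g\<close> is smooth
    on each.\<close>
  define g where "g y = (if y \<in> U then flat 0 (r\<^sup>2 - inner (\<phi> y - p) (\<phi> y - p)) else 0)" for y
  have "compact (cball p r)"
    by (rule bounded_closed_imp_compact_finite_span[OF B]) auto
  then have "compact K" unfolding K_def
    using homeomorphism_cont2[OF h] r(2) by (intro compact_continuous_image) (auto intro: continuous_on_subset)
  then have "closed K" by (rule compact_imp_closed)
  have KW: "K \<subseteq> U \<inter> W" unfolding K_def using r(2) homeomorphism_apply1[OF h] by fastforce
  have "open N"
  proof -
    have "N = U \<inter> \<phi> -` ball p r" unfolding N_def by auto
    then show ?thesis using continuous_open_preimage[OF homeomorphism_cont1[OF h] \<open>open U\<close>] by simp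
  qed
  have g0: "g y = 0" if "y \<notin> K" for y
  proof (cases "y \<in> U")
    case True
    then have "\<phi> y \<notin> cball p r"
      using that homeomorphism_apply1[OF h] unfolding K_def by force
    then have "r \<le> norm (\<phi> y - p)" by (simp add: dist_norm norm_minus_commute)
    then have "r\<^sup>2 \<le> inner (\<phi> y - p) (\<phi> y - p)" using r(1) power_mono[of r "norm (\<phi> y - p)" 2]
      by (simp add: power2_norm_eq_inner)
    then show ?thesis by (simp add: g_def flat_def)
  qed (simp add: g_def)
  have gN: "g y \<noteq> 0" if "y \<in> N" for y
  proof -
    have "norm (\<phi> y - p) < r" using that by (simp add: N_def dist_norm norm_minus_commute)
    then have "inner (\<phi> y - p) (\<phi> y - p) < r\<^sup>2"
      by (simp add: power2_norm_eq_inner[symmetric] power_strict_mono)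
    then show ?thesis using that by (simp add: g_def flat_def N_def)
  qed
  have gU: "smooth_fun_on A U (\<lambda>y. flat 0 (r\<^sup>2 - inner (\<phi> y - p) (\<phi> y - p)))"
    unfolding smooth_fun_on_def smooth_on_def
  proof clarify
    fix V \<psi> k assume V: "(V, \<psi>) \<in> A"
    then have \<tau>: "Ck_on k (\<psi> ` (V \<inter> U)) (\<phi> \<circ> inv_into V \<psi>)"
      using A U unfolding smooth_manifold_def smooth_on_def by blast
    have "Ck_on k (\<psi> ` (V \<inter> U)) (\<lambda>z. (\<phi> \<circ> inv_into V \<psi>) z + (- p))"
      by (intro Ck_on_add \<tau> Ck_on_const)
    then have t: "Ck_on k (\<psi> ` (V \<inter> U)) (\<lambda>z. \<phi> (inv_into V \<psi> z) - p)" by simp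
    have "Ck_on k (\<psi> ` (V \<inter> U)) (\<lambda>z. r\<^sup>2 + (- 1) * inner (\<phi> (inv_into V \<psi> z) - p) (\<phi> (inv_into V \<psi> z) - p))"
      by (intro Ck_on_add Ck_on_const Ck_on_bilinear[OF bounded_bilinear_mult]
          Ck_on_bilinear[OF bounded_bilinear_inner] t)
    then show "Ck_on k (\<psi> ` (V \<inter> U)) ((\<lambda>y. flat 0 (r\<^sup>2 - inner (\<phi> y - p) (\<phi> y - p))) \<circ> inv_into V \<psi>)"
      unfolding comp_def by (intro Ck_on_compose_real[OF Ck_on_flat[of _ UNIV]]) auto
  qed
  have "smooth_fun_on A UNIV g"
  proof (rule smooth_fun_on_local[OF A])
    fix y
    show "\<exists>N. open N \<and> y \<in> N \<and> smooth_fun_on A N g"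
    proof (cases "y \<in> U")
      case True
      have "smooth_fun_on A U g"
        by (rule smooth_fun_on_cong[OF A \<open>open U\<close> gU]) (simp add: g_def)
      with True \<open>open U\<close> show ?thesis by blast
    next
      case False
      have "smooth_fun_on A (- K) g"
        by (rule smooth_fun_on_cong[OF A _ smooth_fun_on_const[of _ _ 0]]) (use \<open>closed K\<close> g0 in auto)
      moreover have "y \<in> - K" using False KW by auto
      ultimately show ?thesis using \<open>closed K\<close> by blast
    qed
  qed
  moreover have "x \<in> N" using U r by (simp add: N_def p_def)
  ultimately show thesis using that \<open>closed K\<close> \<open>open N\<close> KW g0 gN by blast
qed

text \<open>\<open>c\<close> may blow up towards the boundary of \<open>W\<close>, but
  \<open>g\<close> vanishes off the closed set \<open>K\<close> inside \<open>W\<close>. So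
  \<open>V\<close> is covered by the open sets \<open>V \<inter> W\<close>, where the function is a
  product of smooth ones, and \<open>- K\<close>, where it is 0.\<close>

lemma smooth_fun_on_extend:
  assumes A: "smooth_manifold A" and o: "open W" "open V"
    and g: "smooth_fun_on A UNIV g" "closed K" "K \<subseteq> W" "\<And>y. y \<notin> K \<Longrightarrow> g y = 0"
    and c: "smooth_fun_on A (V \<inter> W) c"
  shows "smooth_fun_on A V (\<lambda>y. if y \<in> W then g y * c y else 0)"
proof (rule smooth_fun_on_local[OF A])
  fix y assume y: "y \<in> V"
  show "\<exists>N. open N \<and> y \<in> N \<and> smooth_fun_on A N (\<lambda>y. if y \<in> W then g y * c y else 0)"
  proof (cases "y \<in> W")
    case True
    have "smooth_fun_on A (V \<inter> W) (\<lambda>y. if y \<in> W then g y * c y else 0)"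
      by (rule smooth_fun_on_cong[OF A _ smooth_fun_on_mult[OF smooth_fun_on_subset[OF g(1)] c]])
        (use o in auto)
    then show ?thesis using True y o by blast
  next
    case False
    have "smooth_fun_on A (- K) (\<lambda>y. if y \<in> W then g y * c y else 0)"
      by (rule smooth_fun_on_cong[OF A _ smooth_fun_on_const[of _ _ 0]]) (use g in auto)
    then show ?thesis using False g by blast
  qed
qed

section \<open>Sections and local frames of a vector bundle\<close>

lemma Cinf_subspace: "subspace (Cinf A)"
  unfolding subspace_def Cinf_def
  using smooth_fun_on_const[of A UNIV 0] smooth_fun_on_add[of A UNIV]
    smooth_fun_on_mult[OF smooth_fun_on_const[of A UNIV]]
  by (auto simp: plus_fun_def zero_fun_def scaleR_fun_def)

lemma smooth_in_frame_subset:
  "smooth_in_frame A W r b s \<Longrightarrow> V \<subseteq> W \<Longrightarrow> smooth_in_frame A V r b s"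
  unfolding smooth_in_frame_def by (meson smooth_fun_on_subset subsetD)

lemma smooth_in_frame_zero: "smooth_in_frame A W r b (\<lambda>x. 0)"
  unfolding smooth_in_frame_def
  by (rule exI[of _ "\<lambda>i x. 0"]) (simp add: smooth_fun_on_const)

lemma smooth_in_frame_add:
  assumes "smooth_in_frame A W r b s" "smooth_in_frame A W r b t"
  shows "smooth_in_frame A W r b (\<lambda>x. s x + t x)"
proof -
  obtain c where "\<forall>i<r. smooth_fun_on A W (c i)" "\<forall>x\<in>W. s x = (\<Sum>i<r. c i x *\<^sub>R b i x)"
    using assms(1) unfolding smooth_in_frame_def by auto
  moreover obtain d where "\<forall>i<r. smooth_fun_on A W (d i)" "\<forall>x\<in>W. t x = (\<Sum>i<r. d i x *\<^sub>R b i x)"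
    using assms(2) unfolding smooth_in_frame_def by auto
  ultimately show ?thesis unfolding smooth_in_frame_def
    by (intro exI[of _ "\<lambda>i x. c i x + d i x"])
      (auto simp: sum.distrib scaleR_left_distrib intro: smooth_fun_on_add)
qed

lemma smooth_in_frame_scale:
  assumes "smooth_fun_on A W f" "smooth_in_frame A W r b s"
  shows "smooth_in_frame A W r b (\<lambda>x. f x *\<^sub>R s x)"
proof -
  obtain c where "\<forall>i<r. smooth_fun_on A W (c i)" "\<forall>x\<in>W. s x = (\<Sum>i<r. c i x *\<^sub>R b i x)"
    using assms(2) unfolding smooth_in_frame_def by auto
  then show ?thesis unfolding smooth_in_frame_def
    by (intro exI[of _ "\<lambda>i x. f x * c i x"])
      (auto simp: scaleR_sum_right intro: smooth_fun_on_mult assms(1))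
qed

lemma smooth_in_frame_sum:
  "(\<And>i. i \<in> I \<Longrightarrow> smooth_in_frame A W r b (s i)) \<Longrightarrow> smooth_in_frame A W r b (\<lambda>x. \<Sum>i\<in>I. s i x)"
  by (induction I rule: infinite_finite_induct)
    (auto intro: smooth_in_frame_add smooth_in_frame_zero)

lemma sections_fmult:
  assumes "vector_bundle A B" "f \<in> Cinf A" "s \<in> sections A B"
  shows "fmult f s \<in> sections A B"
proof -
  have "smooth_in_frame A U r b (\<lambda>x. f x *\<^sub>R s x)" if "(U, r, b) \<in> frames B" for U r b
    by (rule smooth_in_frame_scale[OF smooth_fun_on_subset[of _ UNIV]])
      (use assms(2,3) that in \<open>auto simp: Cinf_def sections_def\<close>)
  then show ?thesis
    using assms(1,3) by (auto simp: sections_def fmult_def vector_bundle_def subspace_def)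
qed

lemma vector_bundle_frame:
  assumes "vector_bundle A B" "(U, r, b) \<in> frames B"
  shows "open U" and "x \<in> U \<Longrightarrow> inj_on (\<lambda>i. b i x) {..<r}"
    and "x \<in> U \<Longrightarrow> independent ((\<lambda>i. b i x) ` {..<r})"
    and "x \<in> U \<Longrightarrow> span ((\<lambda>i. b i x) ` {..<r}) = fibre B x"
    and "i < r \<Longrightarrow> x \<in> U \<Longrightarrow> b i x \<in> fibre B x"
proof -
  have fr: "\<forall>(U, r, b)\<in>frames B. open U \<and> (\<forall>x\<in>U. inj_on (\<lambda>i. b i x) {..<r} \<and>
      independent ((\<lambda>i. b i x) ` {..<r}) \<and> span ((\<lambda>i. b i x) ` {..<r}) = fibre B x)"
    using assms(1) unfolding vector_bundle_def by simp
  show "open U" and "x \<in> U \<Longrightarrow> inj_on (\<lambda>i. b i x) {..<r}"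
    "x \<in> U \<Longrightarrow> independent ((\<lambda>i. b i x) ` {..<r})"
    and sp: "x \<in> U \<Longrightarrow> span ((\<lambda>i. b i x) ` {..<r}) = fibre B x"
    using bspec[OF fr assms(2)] by auto
  show "i < r \<Longrightarrow> x \<in> U \<Longrightarrow> b i x \<in> fibre B x"
    using sp by (metis imageI lessThan_iff span_base)
qed

lemma fibre_frame_expansion:
  assumes "vector_bundle A B" "(U, r, b) \<in> frames B" "x \<in> U" "u \<in> fibre B x"
  obtains a where "u = (\<Sum>i<r. a i *\<^sub>R b i x)"
proof -
  have "u \<in> span ((\<lambda>i. b i x) ` {..<r})" using vector_bundle_frame(4)[OF assms(1-3)] assms(4) by simp
  then obtain c where "u = (\<Sum>v\<in>(\<lambda>i. b i x) ` {..<r}. c v *\<^sub>R v)"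
    using span_finite[of "(\<lambda>i. b i x) ` {..<r}"] by auto
  also have "\<dots> = (\<Sum>i<r. c (b i x) *\<^sub>R b i x)"
    by (subst sum.reindex[OF vector_bundle_frame(2)[OF assms(1-3)]]) simp
  finally show thesis using that[of "\<lambda>i. c (b i x)"] by simp
qed

lemma frame_coefficients_zero:
  assumes "vector_bundle A B" "(U, r, b) \<in> frames B" "x \<in> U" "(\<Sum>i<r. a i *\<^sub>R b i x) = 0" "i < r"
  shows "a i = 0"
proof -
  let ?b = "\<lambda>i. b i x"
  note inj = vector_bundle_frame(2)[OF assms(1-3)]
  define c where "c = (\<lambda>v. a (inv_into {..<r} ?b v))"
  have c: "c (?b j) = a j" if "j < r" for j
    unfolding c_def using inv_into_f_f[OF inj] that by simp
  have "(\<Sum>v\<in>?b ` {..<r}. c v *\<^sub>R v) = (\<Sum>i<r. c (?b i) *\<^sub>R ?b i)"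
    by (subst sum.reindex[OF inj]) simp
  also have "\<dots> = 0" using assms(4) c by simp
  finally have "c (?b i) = 0"
    using real_vector.independentD[OF vector_bundle_frame(3)[OF assms(1-3)], of "?b ` {..<r}" c "?b i"]
      assms(5) by auto
  then show ?thesis using c[OF assms(5)] by simp
qed

text \<open>Coefficients in a frame are unique, so coefficients chosen point by point coincide with
  the smooth ones given near each point.\<close>

lemma smooth_in_frame_local:
  assumes A: "smooth_manifold A" and B: "vector_bundle A B" "(V, q, c) \<in> frames B"
    and loc: "\<And>x. x \<in> V \<Longrightarrow> \<exists>N. open N \<and> x \<in> N \<and> N \<subseteq> V \<and> smooth_in_frame A N q c s"
  shows "smooth_in_frame A V q c s"
proof -
  have ex: "\<forall>x. \<exists>\<alpha>. x \<in> V \<longrightarrow> s x = (\<Sum>j<q. \<alpha> j *\<^sub>R c j x)"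
  proof
    fix x
    show "\<exists>\<alpha>. x \<in> V \<longrightarrow> s x = (\<Sum>j<q. \<alpha> j *\<^sub>R c j x)"
    proof (cases "x \<in> V")
      case True
      then obtain N where "x \<in> N" "smooth_in_frame A N q c s" using loc by blast
      then obtain d where "s x = (\<Sum>j<q. d j x *\<^sub>R c j x)" unfolding smooth_in_frame_def by auto
      then show ?thesis by (intro exI[of _ "\<lambda>j. d j x"]) simp
    qed simp
  qed
  obtain \<alpha> where \<alpha>: "\<And>x. x \<in> V \<Longrightarrow> s x = (\<Sum>j<q. \<alpha> x j *\<^sub>R c j x)"
    using choice[OF ex] by auto
  have "smooth_fun_on A V (\<lambda>x. \<alpha> x j)" if j: "j < q" for j
  proof (rule smooth_fun_on_local[OF A])
    fix x assume "x \<in> V"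
    then obtain N d where N: "open N" "x \<in> N" "N \<subseteq> V" "\<And>i. i < q \<Longrightarrow> smooth_fun_on A N (d i)"
      "\<And>y. y \<in> N \<Longrightarrow> s y = (\<Sum>i<q. d i y *\<^sub>R c i y)"
      using loc unfolding smooth_in_frame_def by metis
    have "d j y = \<alpha> y j" if "y \<in> N" for y
    proof -
      have "y \<in> V" using that N by blast
      have "(\<Sum>i<q. (d i y - \<alpha> y i) *\<^sub>R c i y) = 0"
        using N(5)[OF that] \<alpha>[OF \<open>y \<in> V\<close>] by (simp add: scaleR_left_diff_distrib sum_subtractf)
      from frame_coefficients_zero[OF B \<open>y \<in> V\<close> this j] show ?thesis by simp
    qed
    then have "smooth_fun_on A N (\<lambda>x. \<alpha> x j)"
      by (rule smooth_fun_on_cong[OF A N(1) N(4)[OF j]])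
    then show "\<exists>N. open N \<and> x \<in> N \<and> smooth_fun_on A N (\<lambda>x. \<alpha> x j)" using N by blast
  qed
  then show ?thesis unfolding smooth_in_frame_def using \<alpha> by (intro exI[of _ "\<lambda>j x. \<alpha> x j"]) auto
qed

text \<open>The device that turns local frame vectors into global sections, to which the axioms
  apply.\<close>

lemma bump_section:
  assumes A: "smooth_manifold A" and B: "vector_bundle A B" and W: "open W"
    and g: "smooth_fun_on A UNIV g" "closed K" "K \<subseteq> W" "\<And>y. y \<notin> K \<Longrightarrow> g y = 0"
    and t: "\<And>y. y \<in> W \<Longrightarrow> t y \<in> fibre B y"
      "\<And>V q c. (V, q, c) \<in> frames B \<Longrightarrow> smooth_in_frame A (V \<inter> W) q c t"
  shows "(\<lambda>y. if y \<in> W then g y *\<^sub>R t y else 0) \<in> sections A B"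
proof -
  have "smooth_in_frame A V q c (\<lambda>y. if y \<in> W then g y *\<^sub>R t y else 0)"
    if V: "(V, q, c) \<in> frames B" for V q c
  proof -
    obtain d where d: "\<And>i. i < q \<Longrightarrow> smooth_fun_on A (V \<inter> W) (d i)"
      "\<And>y. y \<in> V \<inter> W \<Longrightarrow> t y = (\<Sum>i<q. d i y *\<^sub>R c i y)"
      using t(2)[OF V] unfolding smooth_in_frame_def by blast
    have "smooth_fun_on A V (\<lambda>y. if y \<in> W then g y * d i y else 0)" if "i < q" for i
      using smooth_fun_on_extend[OF A W vector_bundle_frame(1)[OF B V] g d(1)[OF that]] .
    then show ?thesis unfolding smooth_in_frame_def
      by (intro exI[of _ "\<lambda>i y. if y \<in> W then g y * d i y else 0"])
        (auto simp: d(2) scaleR_sum_right)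
  qed
  moreover have "subspace (fibre B y)" for y using B by (auto simp: vector_bundle_def)
  ultimately show ?thesis unfolding sections_def
    using t(1) by (auto simp: subspace_def)
qed

lemma vector_bundle_frame_smooth:
  assumes "vector_bundle A B" "(U, r, b) \<in> frames B" "(V, q, c) \<in> frames B" "i < r"
  shows "smooth_in_frame A (V \<inter> U) q c (b i)"
proof -
  have "\<forall>(U, r, b)\<in>frames B. \<forall>(V, q, c)\<in>frames B. \<forall>j<q. smooth_in_frame A (U \<inter> V) r b (c j)"
    using assms(1) unfolding vector_bundle_def by simp
  from bspec[OF bspec[OF this assms(3), simplified] assms(2)] assms(4) show ?thesis by simp
qed

lemma vector_bundle_frame_at:
  assumes "vector_bundle A B"
  obtains U r b where "(U, r, b) \<in> frames B" "x \<in> U"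
proof -
  have "x \<in> (\<Union>(U, r, b)\<in>frames B. U)" using assms unfolding vector_bundle_def by simp
  then show thesis using that by auto
qed

lemma exists_section_through:
  fixes A :: "('m::{t2_space, second_countable_topology}, 'a::real_inner) atlas"
  assumes A: "smooth_manifold A" and B: "vector_bundle A B" and u: "u \<in> fibre B x"
  obtains s where "s \<in> sections A B" "s x = u"
proof -
  obtain U r b where U: "(U, r, b) \<in> frames B" "x \<in> U"
    using vector_bundle_frame_at[OF B] .
  obtain a where a: "u = (\<Sum>i<r. a i *\<^sub>R b i x)" using fibre_frame_expansion[OF B U u] .
  obtain g K N where g: "smooth_fun_on A UNIV g" "closed K" "K \<subseteq> U" "\<And>y. y \<notin> K \<Longrightarrow> g y = 0"
    "x \<in> N" "\<And>y. y \<in> N \<Longrightarrow> g y \<noteq> 0"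
    using exists_bump[OF A vector_bundle_frame(1)[OF B U(1)] U(2)] by metis
  \<comment> \<open>Dividing by \<open>g x\<close> compensates for the factor \<open>g\<close> to
    come, so that the value at \<open>x\<close> is exactly \<open>u\<close>.\<close>
  define t where "t y = (\<Sum>i<r. (a i / g x) *\<^sub>R b i y)" for y
  have "(\<lambda>y. if y \<in> U then g y *\<^sub>R t y else 0) \<in> sections A B"
  proof (rule bump_section[OF A B vector_bundle_frame(1)[OF B U(1)] g(1-4)])
    have sub: "subspace (fibre B y)" for y using B by (auto simp: vector_bundle_def)
    show "t y \<in> fibre B y" if "y \<in> U" for y
      unfolding t_def using vector_bundle_frame(5)[OF B U(1) _ that]
      by (intro subspace_sum[OF sub] subspace_scale[OF sub]) auto
    show "smooth_in_frame A (V \<inter> U) q c t" if "(V, q, c) \<in> frames B" for V q c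
      unfolding t_def using vector_bundle_frame_smooth[OF B U(1) that]
      by (intro smooth_in_frame_sum smooth_in_frame_scale smooth_fun_on_const) auto
  qed
  moreover have "g x *\<^sub>R t x = u" using g(5,6) unfolding t_def a by (simp add: scaleR_sum_right)
  ultimately show thesis using that U(2) by fastforce
qed

text \<open>The solution is the adjugate applied to \<open>h\<close>, divided by the determinant.
  Adjugate and determinant are polynomials in the entries \<open>P i j\<close>, hence smooth, and
  the absence of kernel vectors at each point makes the determinant nonzero.\<close>

lemma smooth_linear_system:
  fixes P :: "nat \<Rightarrow> nat \<Rightarrow> 'm::{t2_space, second_countable_topology} \<Rightarrow> real"
    and A :: "('m, 'a::real_inner) atlas"
  assumes A: "smooth_manifold A"
    and P: "\<And>i j. i < n \<Longrightarrow> j < n \<Longrightarrow> smooth_fun_on A W (P i j)"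
    and h: "\<And>i. i < n \<Longrightarrow> smooth_fun_on A W (h i)"
    and inj: "\<And>y v j. y \<in> W \<Longrightarrow> (\<forall>i<n. (\<Sum>j<n. P i j y * v j) = 0) \<Longrightarrow> j < n \<Longrightarrow> v j = 0"
  obtains a where "\<And>j. j < n \<Longrightarrow> smooth_fun_on A W (a j)"
    and "\<And>y i. y \<in> W \<Longrightarrow> i < n \<Longrightarrow> (\<Sum>j<n. P i j y * a j y) = h i y"
proof -
  define M where "M y = mat n n (\<lambda>(i, j). P i j y)" for y
  have M: "M y \<in> carrier_mat n n" for y by (simp add: M_def)
  have det_smooth: "smooth_fun_on A W (\<lambda>y. Determinant.det (Q y))"
    if "\<And>y. Q y \<in> carrier_mat m m" "\<And>i j. i < m \<Longrightarrow> j < m \<Longrightarrow> smooth_fun_on A W (\<lambda>y. Q y $$ (i, j))"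
    for Q :: "'m \<Rightarrow> real mat" and m
    unfolding Determinant.det_def'[OF that(1)]
    by (intro smooth_fun_on_sum smooth_fun_on_mult smooth_fun_on_prod smooth_fun_on_const that(2))
      (auto simp: permutes_in_image)
  have det: "Determinant.det (M y) \<noteq> 0" if "y \<in> W" for y
  proof
    assume "Determinant.det (M y) = 0"
    then obtain v where v: "v \<in> carrier_vec n" "v \<noteq> 0\<^sub>v n" "M y *\<^sub>v v = 0\<^sub>v n"
      using det_0_iff_vec_prod_zero[OF M] by blast
    have "(\<Sum>j<n. P i j y * vec_index v j) = 0" if "i < n" for i
    proof -
      have "(\<Sum>j<n. P i j y * vec_index v j) = vec_index (M y *\<^sub>v v) i"
        using that v(1) by (simp add: M_def scalar_prod_def atLeast0LessThan)
      then show ?thesis using v(3) that by simp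
    qed
    then have "vec_index v j = 0" if "j < n" for j
      using inj[OF \<open>y \<in> W\<close>, of "\<lambda>j. vec_index v j"] that by blast
    then show False using v(1,2) by auto
  qed
  define a where "a j y = (\<Sum>i<n. adj_mat (M y) $$ (j, i) * h i y) * inverse (Determinant.det (M y))" for j y
  have cof: "smooth_fun_on A W (\<lambda>y. adj_mat (M y) $$ (j, i))" if "i < n" "j < n" for i j
  proof -
    have "smooth_fun_on A W (\<lambda>y. (- 1) ^ (i + j) * Determinant.det (mat_delete (M y) i j))"
    proof (intro smooth_fun_on_mult smooth_fun_on_const det_smooth)
      show "mat_delete (M y) i j \<in> carrier_mat (n - 1) (n - 1)" for y
        using M by (rule mat_delete_carrier)
      fix k l assume "k < n - 1" "l < n - 1"
      then show "smooth_fun_on A W (\<lambda>y. mat_delete (M y) i j $$ (k, l))"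
        by (simp add: mat_delete_def M_def P)
    qed
    then show ?thesis using that by (simp add: adj_mat_def cofactor_def M_def)
  qed
  have "smooth_fun_on A W (a j)" if "j < n" for j
    unfolding a_def
    by (intro smooth_fun_on_mult smooth_fun_on_sum cof h smooth_fun_on_inverse[OF A] det_smooth[of M, OF M] det)
      (use that P in \<open>auto simp: M_def\<close>)
  moreover have "(\<Sum>j<n. P i j y * a j y) = h i y" if "y \<in> W" "i < n" for y i
  proof -
    have "(\<Sum>j<n. P i j y * adj_mat (M y) $$ (j, k)) = (if i = k then Determinant.det (M y) else 0)"
      if "k < n" for k
    proof -
      have "(\<Sum>j<n. P i j y * adj_mat (M y) $$ (j, k)) = (M y * adj_mat (M y)) $$ (i, k)"
        using \<open>i < n\<close> \<open>k < n\<close> adj_mat(1)[OF M, of y]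
        by (simp add: M_def scalar_prod_def atLeast0LessThan)
      also have "\<dots> = (if i = k then Determinant.det (M y) else 0)"
        using adj_mat(2)[OF M, of y] \<open>i < n\<close> \<open>k < n\<close> by simp
      finally show ?thesis .
    qed
    moreover have "(\<Sum>j<n. P i j y * a j y) =
        (\<Sum>k<n. (\<Sum>j<n. P i j y * adj_mat (M y) $$ (j, k)) * h k y) * inverse (Determinant.det (M y))"
      unfolding a_def sum_distrib_right sum_distrib_left
      by (subst sum.swap) (simp add: mult.assoc)
    moreover have "(\<Sum>k<n. (if i = k then Determinant.det (M y) else 0) * h k y) =
        (\<Sum>k<n. if k = i then Determinant.det (M y) * h k y else 0)"
      by (rule sum.cong) auto
    ultimately have "(\<Sum>j<n. P i j y * a j y) =
        (\<Sum>k<n. if k = i then Determinant.det (M y) * h k y else 0) * inverse (Determinant.det (M y))"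
      by simp
    then show ?thesis using that det by simp
  qed
  ultimately show thesis using that by blast
qed

text \<open>Zero rows pad the matrix to a square one. Row \<open>r\<close> is zero, so every product
  in the permutation expansion of the determinant has a zero factor, and a kernel vector
  exists.\<close>

lemma underdetermined_system:
  fixes P :: "nat \<Rightarrow> nat \<Rightarrow> real"
  assumes "r < q"
  obtains v j where "j < q" "v j \<noteq> 0" "\<And>i. i < r \<Longrightarrow> (\<Sum>j<q. P i j * v j) = 0"
proof -
  define M where "M = mat q q (\<lambda>(i, j). if i < r then P i j else 0)"
  have M: "M \<in> carrier_mat q q" by (simp add: M_def)
  have "Determinant.det M = 0"
    unfolding Determinant.det_def'[OF M]
    using assms by (intro sum.neutral) (auto simp: M_def permutes_in_image intro!: bexI[of _ r] prod_zero)
  then obtain v where v: "v \<in> carrier_vec q" "v \<noteq> 0\<^sub>v q" "M *\<^sub>v v = 0\<^sub>v q"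
    using det_0_iff_vec_prod_zero[OF M] by blast
  have "(\<Sum>j<q. P i j * vec_index v j) = 0" if "i < r" for i
  proof -
    have "(\<Sum>j<q. P i j * vec_index v j) = vec_index (M *\<^sub>v v) i"
      using that assms v(1) by (simp add: M_def scalar_prod_def atLeast0LessThan)
    then show ?thesis using v(3) that assms by simp
  qed
  moreover obtain j where "j < q" "vec_index v j \<noteq> 0"
    using v(1,2) by (metis carrier_vecD eq_vecI index_zero_vec)
  ultimately show thesis using that by blast
qed

section \<open>The gradient of a function\<close>

lemma lin_on_add: "lin_on V T \<Longrightarrow> u \<in> V \<Longrightarrow> v \<in> V \<Longrightarrow> T (u + v) = T u + T v"
  and lin_on_scale: "lin_on V T \<Longrightarrow> u \<in> V \<Longrightarrow> T (r *\<^sub>R u) = r *\<^sub>R T u"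
  by (auto simp: lin_on_def)

lemma lin_on_zero: "lin_on V T \<Longrightarrow> 0 \<in> V \<Longrightarrow> T 0 = 0"
  using lin_on_scale[of V T 0 0] by simp

lemma lin_on_minus: "lin_on V T \<Longrightarrow> u \<in> V \<Longrightarrow> T (- u) = - T u"
  using lin_on_scale[of V T u "- 1"] by simp

lemma lin_on_diff:
  assumes "lin_on V T" "subspace V" "u \<in> V" "v \<in> V"
  shows "T (u - v) = T u - T v"
  using lin_on_add[OF assms(1) assms(3) subspace_neg[OF assms(2,4)]] lin_on_minus[OF assms(1,4)] by simp

lemma lin_on_sum:
  assumes "lin_on V T" "subspace V" "\<And>i. i \<in> I \<Longrightarrow> u i \<in> V"
  shows "T (\<Sum>i\<in>I. a i *\<^sub>R u i) = (\<Sum>i\<in>I. a i *\<^sub>R T (u i))"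
  using assms(3)
proof (induction I rule: infinite_finite_induct)
  case (insert i I)
  have "(\<Sum>i\<in>I. a i *\<^sub>R u i) \<in> V" "a i *\<^sub>R u i \<in> V"
    using insert.prems assms(2) by (auto intro!: subspace_sum subspace_scale)
  then show ?case using insert assms(1) by (simp add: lin_on_add lin_on_scale)
qed (use lin_on_zero[OF assms(1) subspace_0[OF assms(2)]] in auto)

section \<open>Sections, metric and anchor of a CLWX 2-algebroid, and existence of the
  gradient\<close>

locale clwx_on_manifold =
  fixes E :: "('m::{t2_space, second_countable_topology}, 'a::real_inner, 'v::real_vector) clwx"
  assumes manifold: "smooth_manifold (base E)" and clwx: "clwx_2_algebroid E"
begin

abbreviation "\<Gamma> \<equiv> GammaE E"
abbreviation "T \<equiv> total_GammaE E"
abbreviation "S \<equiv> pair_sec E"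
abbreviation "\<rho> \<equiv> anchor_sec E"
abbreviation "C \<equiv> Cinf (base E)"
abbreviation "bd \<equiv> bnd_sec E"

lemma bundles: "vector_bundle (base E) (E0 E)" "vector_bundle (base E) (E1 E)"
  using clwx by (auto simp: clwx_2_algebroid_def dg_vector_bundle_2_def)

lemma fibre_subspace: "subspace (fibre (E0 E) x)" "subspace (fibre (E1 E) x)"
  using bundles by (auto simp: vector_bundle_def)

lemma total_fibre_subspace: "subspace (total_fibre E x)"
  unfolding total_fibre_def by (rule subspace_sums[OF fibre_subspace])

lemma fibre_subset_total: "fibre (E0 E) x \<subseteq> total_fibre E x" "fibre (E1 E) x \<subseteq> total_fibre E x"
  unfolding total_fibre_def using subspace_0[OF fibre_subspace(1)] subspace_0[OF fibre_subspace(2)]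
  by force+

lemma Gamma_other: "i \<noteq> 0 \<Longrightarrow> i \<noteq> 1 \<Longrightarrow> \<Gamma> i = {0}"
  by (simp add: GammaE_def)

lemma leibniz:
  "leibniz_3_algebra \<Gamma>
      (GMap 1 (- 1) (\<lambda>vs. bd (snd (vs ! 0))))
      (GMap 2 0 (\<lambda>vs. circ E (snd (vs ! 0)) (snd (vs ! 1))))
      (GMap 3 1 (\<lambda>vs. Omega E (snd (vs ! 0)) (snd (vs ! 1)) (snd (vs ! 2))))
      (GMap 4 2 0)"
  using clwx by (simp add: clwx_2_algebroid_def)

lemma Gamma_subspace: "subspace (\<Gamma> i)"
  using leibniz by (simp add: leibniz_3_algebra_def three_term_complex_def)

lemmas Gamma_closed [simp, intro] = subspace_0[OF Gamma_subspace] subspace_add[OF Gamma_subspace]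
  subspace_scale[OF Gamma_subspace] subspace_neg[OF Gamma_subspace] subspace_diff[OF Gamma_subspace]

lemma Gamma_subset_T [simp, intro]: "e \<in> \<Gamma> i \<Longrightarrow> e \<in> T"
proof -
  assume e: "e \<in> \<Gamma> i"
  then consider "i = 0" | "i = 1" | "e = 0" using Gamma_other[of i] by blast
  then show "e \<in> T"
  proof cases
    case 1
    then show ?thesis unfolding total_GammaE_def using e by (intro CollectI exI[of _ e] exI[of _ 0]) auto
  next
    case 2
    then show ?thesis unfolding total_GammaE_def using e by (intro CollectI exI[of _ 0] exI[of _ e]) auto
  next
    case 3
    then show ?thesis unfolding total_GammaE_def by (intro CollectI exI[of _ 0]) auto
  qed
qed

lemma T_subspace: "subspace T"
  unfolding total_GammaE_def by (rule subspace_sums[OF Gamma_subspace Gamma_subspace])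

lemmas T_closed [simp, intro] = subspace_0[OF T_subspace] subspace_add[OF T_subspace]
  subspace_scale[OF T_subspace] subspace_neg[OF T_subspace] subspace_diff[OF T_subspace]

lemmas C_closed [simp, intro] = subspace_0[OF Cinf_subspace] subspace_add[OF Cinf_subspace]
  subspace_scale[OF Cinf_subspace] subspace_neg[OF Cinf_subspace] subspace_diff[OF Cinf_subspace]

lemma T_cases:
  assumes "e \<in> T"
  obtains e0 e1 where "e0 \<in> \<Gamma> 0" "e1 \<in> \<Gamma> 1" "e = e0 + e1"
  using assms unfolding total_GammaE_def by auto

lemma Gamma_fibre: "e \<in> \<Gamma> 0 \<Longrightarrow> e x \<in> fibre (E0 E) x" "e \<in> \<Gamma> 1 \<Longrightarrow> e x \<in> fibre (E1 E) x"
  by (auto simp: GammaE_def sections_def)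

lemma T_fibre: "e \<in> T \<Longrightarrow> e x \<in> total_fibre E x"
  by (erule T_cases) (auto simp: total_fibre_def dest: Gamma_fibre[of _ x])

lemma Gamma_through:
  "u \<in> fibre (E0 E) x \<Longrightarrow> \<exists>e\<in>\<Gamma> 0. e x = u" "u \<in> fibre (E1 E) x \<Longrightarrow> \<exists>e\<in>\<Gamma> 1. e x = u"
  using exists_section_through[OF manifold bundles(1)] exists_section_through[OF manifold bundles(2)]
  by (auto simp: GammaE_def) metis+

lemma Gamma_fmult: "f \<in> C \<Longrightarrow> e \<in> \<Gamma> i \<Longrightarrow> fmult f e \<in> \<Gamma> i"
  using sections_fmult[OF bundles(1)] sections_fmult[OF bundles(2)]
  by (auto simp: GammaE_def fmult_def zero_fun_def)

lemma T_fmult: "f \<in> C \<Longrightarrow> e \<in> T \<Longrightarrow> fmult f e \<in> T"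
proof (erule T_cases)
  fix e0 e1 assume "f \<in> C" "e0 \<in> \<Gamma> 0" "e1 \<in> \<Gamma> 1" "e = e0 + e1"
  moreover have "fmult f (e0 + e1) = fmult f e0 + fmult f e1"
    by (simp add: fmult_def fun_eq_iff scaleR_right_distrib)
  ultimately show "fmult f e \<in> T" using Gamma_fmult by (metis Gamma_subset_T T_closed(2))
qed

lemma pair_lin: "u \<in> total_fibre E x \<Longrightarrow> lin_on (total_fibre E x) (pair E x u)"
  and pair_commute: "u \<in> total_fibre E x \<Longrightarrow> v \<in> total_fibre E x \<Longrightarrow> pair E x u v = pair E x v u"
  and pair_nondegenerate:
    "u \<in> total_fibre E x \<Longrightarrow> (\<And>v. v \<in> total_fibre E x \<Longrightarrow> pair E x u v = 0) \<Longrightarrow> u = 0"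
  and S_Cinf [simp, intro]: "e \<in> T \<Longrightarrow> e' \<in> T \<Longrightarrow> S e e' \<in> C"
proof -
  have "bundle_metric E" using clwx by (simp add: clwx_2_algebroid_def)
  then show "u \<in> total_fibre E x \<Longrightarrow> lin_on (total_fibre E x) (pair E x u)"
    "u \<in> total_fibre E x \<Longrightarrow> v \<in> total_fibre E x \<Longrightarrow> pair E x u v = pair E x v u"
    "u \<in> total_fibre E x \<Longrightarrow> (\<And>v. v \<in> total_fibre E x \<Longrightarrow> pair E x u v = 0) \<Longrightarrow> u = 0"
    "e \<in> T \<Longrightarrow> e' \<in> T \<Longrightarrow> S e e' \<in> C"
    by (simp_all add: bundle_metric_def)
qed

lemma S_commute: "e \<in> T \<Longrightarrow> e' \<in> T \<Longrightarrow> S e e' = S e' e"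
  using pair_commute T_fibre by (auto simp: pair_sec_def)

lemma S_lin_right: "e \<in> T \<Longrightarrow> lin_on T (S e)"
  using pair_lin T_fibre
  by (auto simp: pair_sec_def lin_on_def fun_eq_iff scaleR_fun_def)

lemma S_lin_left: "e \<in> T \<Longrightarrow> lin_on T (\<lambda>e'. S e' e)"
  using S_lin_right[of e] S_commute by (auto simp: lin_on_def)

lemma S_isotropic: "e \<in> \<Gamma> 0 \<Longrightarrow> e' \<in> \<Gamma> 0 \<Longrightarrow> S e e' = 0" "e \<in> \<Gamma> 1 \<Longrightarrow> e' \<in> \<Gamma> 1 \<Longrightarrow> S e e' = 0"
  using clwx unfolding clwx_2_algebroid_def by auto

text \<open>Axiom (i) speaks about sections; a section through each fibre vector brings it down to
  the fibres.\<close>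

lemma pair_isotropic:
  "u \<in> fibre (E0 E) x \<Longrightarrow> v \<in> fibre (E0 E) x \<Longrightarrow> pair E x u v = 0"
  "u \<in> fibre (E1 E) x \<Longrightarrow> v \<in> fibre (E1 E) x \<Longrightarrow> pair E x u v = 0"
  using Gamma_through[of _ x] S_isotropic
  by (metis pair_sec_def zero_fun_apply)+

text \<open>By isotropy, vectors of the same degree pair to zero anyway, so nondegeneracy has to be
  tested only against the other summand.\<close>

lemma fibre_zeroI:
  "u \<in> fibre (E1 E) x \<Longrightarrow> (\<And>v. v \<in> fibre (E0 E) x \<Longrightarrow> pair E x v u = 0) \<Longrightarrow> u = 0"
  "u \<in> fibre (E0 E) x \<Longrightarrow> (\<And>v. v \<in> fibre (E1 E) x \<Longrightarrow> pair E x v u = 0) \<Longrightarrow> u = 0"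
proof -
  assume u: "u \<in> fibre (E1 E) x" and 0: "\<And>v. v \<in> fibre (E0 E) x \<Longrightarrow> pair E x v u = 0"
  have uT: "u \<in> total_fibre E x" using u fibre_subset_total by blast
  show "u = 0"
  proof (rule pair_nondegenerate[OF uT])
    fix v assume "v \<in> total_fibre E x"
    then obtain v0 v1 where v: "v = v0 + v1" "v0 \<in> fibre (E0 E) x" "v1 \<in> fibre (E1 E) x"
      by (auto simp: total_fibre_def)
    then show "pair E x u v = 0"
      using 0[OF v(2)] pair_isotropic(2)[OF u v(3)] lin_on_add[OF pair_lin[OF uT]] fibre_subset_total
        pair_commute[OF uT] by (metis add.right_neutral subsetD)
  qed
next
  assume u: "u \<in> fibre (E0 E) x" and 0: "\<And>v. v \<in> fibre (E1 E) x \<Longrightarrow> pair E x v u = 0"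
  have uT: "u \<in> total_fibre E x" using u fibre_subset_total by blast
  show "u = 0"
  proof (rule pair_nondegenerate[OF uT])
    fix v assume "v \<in> total_fibre E x"
    then obtain v0 v1 where v: "v = v0 + v1" "v0 \<in> fibre (E0 E) x" "v1 \<in> fibre (E1 E) x"
      by (auto simp: total_fibre_def)
    then show "pair E x u v = 0"
      using 0[OF v(3)] pair_isotropic(1)[OF u v(2)] lin_on_add[OF pair_lin[OF uT]] fibre_subset_total
        pair_commute[OF uT] by (metis add.right_neutral subsetD)
  qed
qed

text \<open>The uniqueness principle that makes \<open>D\<close> well defined and, through
  \<open>D_eqI\<close>, identifies its values. Its counterpart \<open>Gamma0_eqI\<close> serves
  identities between sections of \<open>E0\<close>, such as the Leibniz rule.\<close>

lemma Gamma1_eqI: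
  assumes "s \<in> \<Gamma> 1" "t \<in> \<Gamma> 1" "\<And>e. e \<in> \<Gamma> 0 \<Longrightarrow> S e s = S e t"
  shows "s = t"
proof
  fix x
  have "(s - t) x = 0"
  proof (rule fibre_zeroI(1))
    show "(s - t) x \<in> fibre (E1 E) x" using assms Gamma_fibre(2)[of "s - t"] by auto
    fix v assume "v \<in> fibre (E0 E) x"
    then obtain e where e: "e \<in> \<Gamma> 0" "e x = v" using Gamma_through by blast
    have "S e (s - t) = 0"
      using lin_on_diff[OF S_lin_right T_subspace, of e s t] assms e by auto
    then show "pair E x v ((s - t) x) = 0" using e by (metis pair_sec_def zero_fun_apply)
  qed
  then show "s x = t x" by simp
qed

lemma Gamma0_eqI:
  assumes "s \<in> \<Gamma> 0" "t \<in> \<Gamma> 0" "\<And>e. e \<in> \<Gamma> 1 \<Longrightarrow> S e s = S e t"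
  shows "s = t"
proof
  fix x
  have "(s - t) x = 0"
  proof (rule fibre_zeroI(2))
    show "(s - t) x \<in> fibre (E0 E) x" using assms Gamma_fibre(1)[of "s - t"] by auto
    fix v assume "v \<in> fibre (E1 E) x"
    then obtain e where e: "e \<in> \<Gamma> 1" "e x = v" using Gamma_through by blast
    have "S e (s - t) = 0"
      using lin_on_diff[OF S_lin_right T_subspace, of e s t] assms e by auto
    then show "pair E x v ((s - t) x) = 0" using e by (metis pair_sec_def zero_fun_apply)
  qed
  then show "s x = t x" by simp
qed

lemma anchor_lin: "f \<in> C \<Longrightarrow> lin_on (total_fibre E x) (\<lambda>u. anchor E x u f)"
  and anchor_tangent: "u \<in> total_fibre E x \<Longrightarrow> anchor E x u \<in> tangent_space (base E) x"
  and rho_Cinf [simp, intro]: "e \<in> T \<Longrightarrow> f \<in> C \<Longrightarrow> \<rho> e f \<in> C"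
  and anchor_E1: "u \<in> fibre (E1 E) x \<Longrightarrow> f \<in> C \<Longrightarrow> anchor E x u f = 0"
  and anchor_bnd: "u \<in> fibre (E1 E) x \<Longrightarrow> f \<in> C \<Longrightarrow> anchor E x (bnd E x u) f = 0"
proof -
  have "anchor_morphism E" using clwx by (simp add: clwx_2_algebroid_def)
  then show "f \<in> C \<Longrightarrow> lin_on (total_fibre E x) (\<lambda>u. anchor E x u f)"
    "u \<in> total_fibre E x \<Longrightarrow> anchor E x u \<in> tangent_space (base E) x"
    "e \<in> T \<Longrightarrow> f \<in> C \<Longrightarrow> \<rho> e f \<in> C"
    "u \<in> fibre (E1 E) x \<Longrightarrow> f \<in> C \<Longrightarrow> anchor E x u f = 0"
    "u \<in> fibre (E1 E) x \<Longrightarrow> f \<in> C \<Longrightarrow> anchor E x (bnd E x u) f = 0"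
    by (simp_all add: anchor_morphism_def)
qed

text \<open>The axiom gives smoothness of \<open>S\<close> on global sections only. Multiplying both
  frame vectors by a bump function \<open>g\<close> makes them global; their pairing is
  \<open>g\<close> squared times the wanted entry, and near \<open>x\<close> one divides by
  it.\<close>

lemma pair_frame_smooth:
  assumes U: "(U, r, b) \<in> frames (E0 E)" and V: "(V, q, c) \<in> frames (E1 E)" and ij: "i < r" "j < q"
  shows "smooth_fun_on (base E) (U \<inter> V) (\<lambda>y. pair E y (b i y) (c j y))"
proof (rule smooth_fun_on_local[OF manifold])
  fix x assume x: "x \<in> U \<inter> V"
  let ?W = "U \<inter> V"
  have oU: "open U" and oV: "open V" using vector_bundle_frame(1)[OF bundles(1) U] vector_bundle_frame(1)[OF bundles(2) V] .
  then have oW: "open ?W" by auto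
  obtain g K N where g: "smooth_fun_on (base E) UNIV g" "closed K" "K \<subseteq> ?W" "\<And>y. y \<notin> K \<Longrightarrow> g y = 0"
    and N: "open N" "x \<in> N" "\<And>y. y \<in> N \<Longrightarrow> g y \<noteq> 0"
    using exists_bump[OF manifold oW x] by metis
  define s where "s = (\<lambda>y. if y \<in> ?W then g y *\<^sub>R b i y else 0)"
  define t where "t = (\<lambda>y. if y \<in> ?W then g y *\<^sub>R c j y else 0)"
  have bf: "b i y \<in> fibre (E0 E) y" and cf: "c j y \<in> fibre (E1 E) y" if "y \<in> ?W" for y
    using vector_bundle_frame(5)[OF bundles(1) U ij(1)] vector_bundle_frame(5)[OF bundles(2) V ij(2)] that by auto
  have bs: "smooth_in_frame (base E) (V' \<inter> ?W) q' c' (b i)" if "(V', q', c') \<in> frames (E0 E)" for V' q' c'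
    using smooth_in_frame_subset[OF vector_bundle_frame_smooth[OF bundles(1) U that ij(1)]] by auto
  have cs: "smooth_in_frame (base E) (V' \<inter> ?W) q' c' (c j)" if "(V', q', c') \<in> frames (E1 E)" for V' q' c'
    using smooth_in_frame_subset[OF vector_bundle_frame_smooth[OF bundles(2) V that ij(2)]] by auto
  have "s \<in> \<Gamma> 0"
    using bump_section[OF manifold bundles(1) oW g bf bs] by (simp add: s_def GammaE_def)
  moreover have "t \<in> \<Gamma> 1"
    using bump_section[OF manifold bundles(2) oW g cf cs] by (simp add: t_def GammaE_def)
  ultimately have "smooth_fun_on (base E) UNIV (S s t)"
    using S_Cinf[of s t] by (auto simp: Cinf_def)
  then have sm: "smooth_fun_on (base E) (N \<inter> ?W) (\<lambda>y. S s t y * inverse (g y * g y))"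
    by (intro smooth_fun_on_mult smooth_fun_on_inverse[OF manifold] smooth_fun_on_subset[OF g(1)])
      (auto intro: smooth_fun_on_subset simp: N(3))
  have "S s t y * inverse (g y * g y) = pair E y (b i y) (c j y)" if y: "y \<in> N \<inter> ?W" for y
  proof -
    have T: "b i y \<in> total_fibre E y" "c j y \<in> total_fibre E y"
      using bf cf y fibre_subset_total by blast+
    have gT: "g y *\<^sub>R b i y \<in> total_fibre E y"
      using T(1) total_fibre_subspace by (simp add: subspace_scale)
    have "S s t y = pair E y (g y *\<^sub>R b i y) (g y *\<^sub>R c j y)" using y by (simp add: s_def t_def pair_sec_def)
    also have "\<dots> = g y * pair E y (c j y) (g y *\<^sub>R b i y)"
      using lin_on_scale[OF pair_lin[OF gT] T(2)] pair_commute[OF gT T(2)] by simp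
    also have "\<dots> = g y * (g y * pair E y (b i y) (c j y))"
      using lin_on_scale[OF pair_lin[OF T(2)] T(1)] pair_commute[OF T] by simp
    finally show ?thesis using N(3)[of y] y by (simp add: field_simps)
  qed
  then have "smooth_fun_on (base E) (N \<inter> ?W) (\<lambda>y. pair E y (b i y) (c j y))"
    by (rule smooth_fun_on_cong[OF manifold open_Int[OF N(1) oW] sm])
  then show "\<exists>N. open N \<and> x \<in> N \<and> smooth_fun_on (base E) N (\<lambda>y. pair E y (b i y) (c j y))"
    using N oW x by (intro exI[of _ "N \<inter> ?W"]) auto
qed

lemma anchor_frame_smooth:
  assumes U: "(U, r, b) \<in> frames (E0 E)" and i: "i < r" and f: "f \<in> C"
  shows "smooth_fun_on (base E) U (\<lambda>y. anchor E y (b i y) f)"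
proof (rule smooth_fun_on_local[OF manifold])
  fix x assume x: "x \<in> U"
  have oU: "open U" using vector_bundle_frame(1)[OF bundles(1) U] .
  obtain g K N where g: "smooth_fun_on (base E) UNIV g" "closed K" "K \<subseteq> U" "\<And>y. y \<notin> K \<Longrightarrow> g y = 0"
    and N: "open N" "x \<in> N" "\<And>y. y \<in> N \<Longrightarrow> g y \<noteq> 0"
    using exists_bump[OF manifold oU x] by metis
  define s where "s = (\<lambda>y. if y \<in> U then g y *\<^sub>R b i y else 0)"
  have bf: "b i y \<in> fibre (E0 E) y" if "y \<in> U" for y
    using vector_bundle_frame(5)[OF bundles(1) U i] that by auto
  have "s \<in> \<Gamma> 0"
    using bump_section[OF manifold bundles(1) oU g bf vector_bundle_frame_smooth[OF bundles(1) U _ i]]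
    by (simp add: s_def GammaE_def)
  then have "smooth_fun_on (base E) UNIV (\<rho> s f)"
    using rho_Cinf[of s f] f by (auto simp: Cinf_def)
  then have sm: "smooth_fun_on (base E) (N \<inter> U) (\<lambda>y. \<rho> s f y * inverse (g y))"
    by (intro smooth_fun_on_mult smooth_fun_on_inverse[OF manifold] smooth_fun_on_subset[OF g(1)])
      (auto intro: smooth_fun_on_subset simp: N(3))
  have "\<rho> s f y * inverse (g y) = anchor E y (b i y) f" if y: "y \<in> N \<inter> U" for y
  proof -
    have T: "b i y \<in> total_fibre E y"
      using bf y fibre_subset_total by blast+
    have "\<rho> s f y = anchor E y (g y *\<^sub>R b i y) f" using y by (simp add: s_def anchor_sec_def)
    also have "\<dots> = g y * anchor E y (b i y) f"
      using lin_on_scale[OF anchor_lin[OF f] T] by simp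
    finally show ?thesis using N(3)[of y] y by (simp add: field_simps)
  qed
  then have "smooth_fun_on (base E) (N \<inter> U) (\<lambda>y. anchor E y (b i y) f)"
    by (rule smooth_fun_on_cong[OF manifold open_Int[OF N(1) oU] sm])
  then show "\<exists>N. open N \<and> x \<in> N \<and> smooth_fun_on (base E) N (\<lambda>y. anchor E y (b i y) f)"
    using N oU x by (intro exI[of _ "N \<inter> U"]) auto
qed

text \<open>A kernel vector of the matrix of pairings, read as coefficients in one frame, is a fibre
  vector orthogonal to the other summand, hence zero. Both sides are recorded because together they
  force equal ranks.\<close>

lemma pair_frame_injective:
  assumes U: "(U, r, b) \<in> frames (E0 E)" and V: "(V, q, c) \<in> frames (E1 E)" and y: "y \<in> U" "y \<in> V"
  shows "(\<And>i. i < r \<Longrightarrow> (\<Sum>j<q. pair E y (b i y) (c j y) * v j) = 0) \<Longrightarrow> j < q \<Longrightarrow> v j = 0"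
    and "(\<And>j. j < q \<Longrightarrow> (\<Sum>i<r. pair E y (b i y) (c j y) * w i) = 0) \<Longrightarrow> i < r \<Longrightarrow> w i = 0"
proof -
  have bf: "b i y \<in> fibre (E0 E) y" if "i < r" for i
    using vector_bundle_frame(5)[OF bundles(1) U that y(1)] .
  have cf: "c j y \<in> fibre (E1 E) y" if "j < q" for j
    using vector_bundle_frame(5)[OF bundles(2) V that y(2)] .
  have bT: "b i y \<in> total_fibre E y" if "i < r" for i using bf[OF that] fibre_subset_total by blast
  have cT: "c j y \<in> total_fibre E y" if "j < q" for j using cf[OF that] fibre_subset_total by blast
  {
    assume 0: "\<And>i. i < r \<Longrightarrow> (\<Sum>j<q. pair E y (b i y) (c j y) * v j) = 0" and j: "j < q"
    define u where "u = (\<Sum>j<q. v j *\<^sub>R c j y)"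
    have uf: "u \<in> fibre (E1 E) y" unfolding u_def using cf
      by (intro subspace_sum[OF fibre_subspace(2)] subspace_scale[OF fibre_subspace(2)]) auto
    then have uT: "u \<in> total_fibre E y" using fibre_subset_total by blast
    have bu: "pair E y u (b i y) = 0" if "i < r" for i
      using 0[OF that] lin_on_sum[where I="{..<q}" and a=v, OF pair_lin[OF bT[OF that]] total_fibre_subspace cT]
        pair_commute[OF uT bT[OF that]]
      by (simp add: u_def mult.commute)
    have "u = 0"
    proof (rule fibre_zeroI(1)[OF uf])
      fix z assume z: "z \<in> fibre (E0 E) y"
      obtain a where "z = (\<Sum>i<r. a i *\<^sub>R b i y)" using fibre_frame_expansion[OF bundles(1) U y(1) z] .
      then have "pair E y u z = 0"
        using lin_on_sum[where I="{..<r}" and a=a, OF pair_lin[OF uT] total_fibre_subspace bT] bu by simp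
      then show "pair E y z u = 0" using pair_commute[OF uT] z fibre_subset_total by (metis subsetD)
    qed
    then show "v j = 0" using frame_coefficients_zero[OF bundles(2) V y(2) _ j, of v] u_def by simp
  }
  {
    assume 0: "\<And>j. j < q \<Longrightarrow> (\<Sum>i<r. pair E y (b i y) (c j y) * w i) = 0" and i: "i < r"
    define u where "u = (\<Sum>i<r. w i *\<^sub>R b i y)"
    have uf: "u \<in> fibre (E0 E) y" unfolding u_def using bf
      by (intro subspace_sum[OF fibre_subspace(1)] subspace_scale[OF fibre_subspace(1)]) auto
    then have uT: "u \<in> total_fibre E y" using fibre_subset_total by blast
    have cu: "pair E y u (c j y) = 0" if "j < q" for j
    proof -
      have "pair E y (c j y) u = (\<Sum>i<r. pair E y (c j y) (b i y) * w i)"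
        using lin_on_sum[where I="{..<r}" and a=w, OF pair_lin[OF cT[OF that]] total_fibre_subspace bT]
        by (simp add: u_def mult.commute)
      also have "\<dots> = (\<Sum>i<r. pair E y (b i y) (c j y) * w i)"
        using pair_commute[OF cT[OF that] bT] by (intro sum.cong) auto
      finally show ?thesis using 0[OF that] pair_commute[OF uT cT[OF that]] by simp
    qed
    have "u = 0"
    proof (rule fibre_zeroI(2)[OF uf])
      fix z assume z: "z \<in> fibre (E1 E) y"
      obtain a where "z = (\<Sum>i<q. a i *\<^sub>R c i y)" using fibre_frame_expansion[OF bundles(2) V y(2) z] .
      then have "pair E y u z = 0"
        using lin_on_sum[where I="{..<q}" and a=a, OF pair_lin[OF uT] total_fibre_subspace cT] cu by simp
      then show "pair E y z u = 0" using pair_commute[OF uT] z fibre_subset_total by (metis subsetD)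
    qed
    then show "w i = 0" using frame_coefficients_zero[OF bundles(1) U y(1) _ i, of w] u_def by simp
  }
qed

lemma local_gradient:
  assumes f: "f \<in> C" and V: "(V, q, c) \<in> frames (E1 E)" and x: "x \<in> V"
  obtains N a where "open N" "x \<in> N" "N \<subseteq> V" "\<forall>j<q. smooth_fun_on (base E) N (a j)"
    "\<forall>y\<in>N. \<forall>u\<in>fibre (E0 E) y. pair E y u (\<Sum>j<q. a j y *\<^sub>R c j y) = anchor E y u f"
proof -
  obtain U r b where U: "(U, r, b) \<in> frames (E0 E)" "x \<in> U"
    using vector_bundle_frame_at[OF bundles(1)] .
  have oU: "open U" and oV: "open V" using vector_bundle_frame(1)[OF bundles(1) U(1)] vector_bundle_frame(1)[OF bundles(2) V] .
  note inj = pair_frame_injective[OF U(1) V]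
  \<comment> \<open>Were the ranks different, the pairing matrix or its transpose would have more
    unknowns than equations and thus a nonzero kernel vector, against injectivity.\<close>
  have "\<not> r < q"
  proof
    assume "r < q"
    then obtain v j where "j < q" "v j \<noteq> 0" "\<And>i. i < r \<Longrightarrow> (\<Sum>j<q. pair E x (b i x) (c j x) * v j) = 0"
      using underdetermined_system[of r q "\<lambda>i j. pair E x (b i x) (c j x)"] by metis
    then show False using inj(1)[OF U(2) x] by blast
  qed
  moreover have "\<not> q < r"
  proof
    assume "q < r"
    then obtain v j where "j < r" "v j \<noteq> 0" "\<And>i. i < q \<Longrightarrow> (\<Sum>j<r. pair E x (b j x) (c i x) * v j) = 0"
      using underdetermined_system[of q r "\<lambda>j i. pair E x (b i x) (c j x)"] by metis
    then show False using inj(2)[OF U(2) x] by blast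
  qed
  ultimately have rq: "r = q" by simp
  obtain a where a: "\<And>j. j < q \<Longrightarrow> smooth_fun_on (base E) (U \<inter> V) (a j)"
    "\<And>y i. y \<in> U \<inter> V \<Longrightarrow> i < q \<Longrightarrow> (\<Sum>j<q. pair E y (b i y) (c j y) * a j y) = anchor E y (b i y) f"
  proof (rule smooth_linear_system[OF manifold, of q "U \<inter> V" "\<lambda>i j y. pair E y (b i y) (c j y)"
        "\<lambda>i y. anchor E y (b i y) f"])
    show "smooth_fun_on (base E) (U \<inter> V) (\<lambda>y. pair E y (b i y) (c j y))" if "i < q" "j < q" for i j
      using pair_frame_smooth[OF U(1) V] that rq by simp
    show "smooth_fun_on (base E) (U \<inter> V) (\<lambda>y. anchor E y (b i y) f)" if "i < q" for i
      using smooth_fun_on_subset[OF anchor_frame_smooth[OF U(1) _ f]] that rq by simp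
    show "v j = 0" if "y \<in> U \<inter> V" "\<forall>i<q. (\<Sum>j<q. pair E y (b i y) (c j y) * v j) = 0" "j < q" for y v j
      using inj(1)[of y v j] that rq by simp
  qed blast
  show thesis
  proof (rule that[of "U \<inter> V" a]; (intro ballI)?)
    fix y u assume y: "y \<in> U \<inter> V" and u: "u \<in> fibre (E0 E) y"
    define w where "w = (\<Sum>j<q. a j y *\<^sub>R c j y)"
    have bT: "b i y \<in> total_fibre E y" if "i < q" for i
      using vector_bundle_frame(5)[OF bundles(1) U(1)] rq that y fibre_subset_total by blast
    have cT: "c i y \<in> total_fibre E y" if "i < q" for i
      using vector_bundle_frame(5)[OF bundles(2) V] that y fibre_subset_total by blast
    have wT: "w \<in> total_fibre E y" unfolding w_def using cT
      by (intro subspace_sum[OF total_fibre_subspace] subspace_scale[OF total_fibre_subspace]) auto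
    obtain d where d: "u = (\<Sum>i<q. d i *\<^sub>R b i y)"
      using fibre_frame_expansion[OF bundles(1) U(1) _ u] y rq by auto
    have uT: "u \<in> total_fibre E y" using u fibre_subset_total by blast
    have bw: "pair E y w (b i y) = anchor E y (b i y) f" if "i < q" for i
      using a(2)[OF y that] lin_on_sum[where I="{..<q}" and a="\<lambda>j. a j y", OF pair_lin[OF bT[OF that]] total_fibre_subspace cT]
        pair_commute[OF wT bT[OF that]] by (simp add: w_def mult.commute)
    have "pair E y w u = (\<Sum>i<q. d i *\<^sub>R pair E y w (b i y))"
      unfolding d by (rule lin_on_sum[OF pair_lin[OF wT] total_fibre_subspace]) (use bT in auto)
    also have "\<dots> = (\<Sum>i<q. d i *\<^sub>R anchor E y (b i y) f)" using bw by simp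
    also have "\<dots> = anchor E y u f"
      unfolding d by (rule lin_on_sum[OF anchor_lin[OF f] total_fibre_subspace, symmetric]) (use bT in auto)
    finally show "pair E y u (\<Sum>j<q. a j y *\<^sub>R c j y) = anchor E y u f"
      using pair_commute[OF wT uT] by (simp add: w_def)
  qed (use oU oV U(2) x a(1) in auto)
qed

text \<open>Pointwise solutions are unique by \<open>fibre_zeroI\<close>, so a mere choice of them
  coincides near each point with the smooth solution of \<open>local_gradient\<close>. Solving
  against \<open>E0\<close> suffices: on \<open>E1\<close> the pairing with \<open>s\<close>
  vanishes by isotropy, and so does the anchor.\<close>

lemma exists_gradient:
  assumes f: "f \<in> C"
  obtains s where "s \<in> \<Gamma> 1" "\<forall>e\<in>T. S e s = \<rho> e f"
proof -
  have grad: "\<exists>w\<in>fibre (E1 E) x. \<forall>u\<in>fibre (E0 E) x. pair E x u w = anchor E x u f" for x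
  proof -
    obtain V q c where V: "(V, q, c) \<in> frames (E1 E)" "x \<in> V"
      using vector_bundle_frame_at[OF bundles(2)] .
    obtain N a where "x \<in> N"
      "\<forall>y\<in>N. \<forall>u\<in>fibre (E0 E) y. pair E y u (\<Sum>j<q. a j y *\<^sub>R c j y) = anchor E y u f"
      by (rule local_gradient[OF f V])
    moreover have "(\<Sum>j<q. a j x *\<^sub>R c j x) \<in> fibre (E1 E) x"
      using vector_bundle_frame(5)[OF bundles(2) V(1) _ V(2)]
      by (intro subspace_sum[OF fibre_subspace(2)] subspace_scale[OF fibre_subspace(2)]) auto
    ultimately show ?thesis by blast
  qed
  then obtain s where s: "\<And>x. s x \<in> fibre (E1 E) x"
    "\<And>x u. u \<in> fibre (E0 E) x \<Longrightarrow> pair E x u (s x) = anchor E x u f" by metis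
  have "smooth_in_frame (base E) V q c s" if V: "(V, q, c) \<in> frames (E1 E)" for V q c
  proof (rule smooth_in_frame_local[OF manifold bundles(2) V])
    fix x assume x: "x \<in> V"
    obtain N a where N: "open N" "x \<in> N" "N \<subseteq> V" "\<forall>j<q. smooth_fun_on (base E) N (a j)"
      "\<forall>y\<in>N. \<forall>u\<in>fibre (E0 E) y. pair E y u (\<Sum>j<q. a j y *\<^sub>R c j y) = anchor E y u f"
      using local_gradient[OF f V x] .
    have "s y = (\<Sum>j<q. a j y *\<^sub>R c j y)" if y: "y \<in> N" for y
    proof -
      have w: "(\<Sum>j<q. a j y *\<^sub>R c j y) \<in> fibre (E1 E) y"
        using vector_bundle_frame(5)[OF bundles(2) V] N(3) y
        by (intro subspace_sum[OF fibre_subspace(2)] subspace_scale[OF fibre_subspace(2)]) auto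
      have "s y - (\<Sum>j<q. a j y *\<^sub>R c j y) = 0"
      proof (rule fibre_zeroI(1)[of _ y])
        show "s y - (\<Sum>j<q. a j y *\<^sub>R c j y) \<in> fibre (E1 E) y"
          using s(1) w by (rule subspace_diff[OF fibre_subspace(2)])
        fix v assume v: "v \<in> fibre (E0 E) y"
        then have "v \<in> total_fibre E y" using fibre_subset_total by blast
        then show "pair E y v (s y - (\<Sum>j<q. a j y *\<^sub>R c j y)) = 0"
          using lin_on_diff[OF pair_lin total_fibre_subspace, of v y "s y"] s w v N(5) y v fibre_subset_total(2)
          by (metis diff_self subsetD)
      qed
      then show ?thesis by simp
    qed
    then have "smooth_in_frame (base E) N q c s"
      unfolding smooth_in_frame_def using N(4) by blast
    then show "\<exists>N. open N \<and> x \<in> N \<and> N \<subseteq> V \<and> smooth_in_frame (base E) N q c s" using N by blast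
  qed
  then have sG: "s \<in> \<Gamma> 1" using s(1) by (auto simp: GammaE_def sections_def)
  have "S e s = \<rho> e f" if e: "e \<in> T" for e
  proof
    fix x
    obtain e0 e1 where e01: "e0 \<in> \<Gamma> 0" "e1 \<in> \<Gamma> 1" "e = e0 + e1" using T_cases[OF e] .
    have "S e s x = S e0 s x + S e1 s x"
      using e01 sG lin_on_add[OF S_lin_left, of s e0 e1] by auto
    also have "\<dots> = anchor E x (e0 x) f + anchor E x (e1 x) f"
      using e01 sG S_isotropic(2) anchor_E1[OF Gamma_fibre(2)] s(2)[OF Gamma_fibre(1)] f
      by (simp add: pair_sec_def fun_eq_iff)
    also have "\<dots> = \<rho> e f x"
      using e01 lin_on_add[OF anchor_lin[OF f] T_fibre[of e0 x] T_fibre[of e1 x]] by (auto simp: anchor_sec_def)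
    finally show "S e s x = \<rho> e f x" .
  qed
  then show thesis using that sG by blast
qed

abbreviation "D \<equiv> Dop E"

text \<open>\<open>Dop\<close> is a definite description tested on all of \<open>T\<close>.
  Existence supplies a candidate, and \<open>Gamma1_eqI\<close> identifies it with any section of
  \<open>E1\<close> that satisfies the equation on degree 0 alone.\<close>

lemma D_eqI:
  assumes "f \<in> C" "s \<in> \<Gamma> 1" "\<And>e. e \<in> \<Gamma> 0 \<Longrightarrow> S e s = \<rho> e f"
  shows "D f = s"
proof -
  obtain s' where s': "s' \<in> \<Gamma> 1" "\<forall>e\<in>T. S e s' = \<rho> e f" using exists_gradient[OF assms(1)] .
  have "s' = s" by (rule Gamma1_eqI) (use s' assms in auto)
  show ?thesis unfolding Dop_def
  proof (rule the_equality)
    show "s \<in> \<Gamma> 1 \<and> (\<forall>e\<in>T. S e s = \<rho> e f)" using s' \<open>s' = s\<close> by simp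
    show "t = s" if "t \<in> \<Gamma> 1 \<and> (\<forall>e\<in>T. S e t = \<rho> e f)" for t
      by (rule Gamma1_eqI) (use that assms in auto)
  qed
qed

lemma D_Gamma [simp, intro]: "f \<in> C \<Longrightarrow> D f \<in> \<Gamma> 1"
  and S_D: "f \<in> C \<Longrightarrow> e \<in> T \<Longrightarrow> S e (D f) = \<rho> e f"
  using exists_gradient[of f] D_eqI[of f] by (metis Gamma_subset_T)+

end

section \<open>Multilinear maps on small tuples\<close>

lemma sign_pow_simps [simp]: "sign_pow 0 = 1" "sign_pow 1 = - 1" "sign_pow (- 1) = - 1" "sign_pow 2 = 1"
  by (simp_all add: sign_pow_def)

lemma sign_pow_minus [simp]: "sign_pow (- i) = sign_pow i"
  by (simp add: sign_pow_def)

lemma bdry_2: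
  assumes "arity \<mu> = 2"
  shows "bdry d \<mu> vs = (d \<odot>\<^bsub>1\<^esub> \<mu>) vs - sign_pow (degree \<mu>) *\<^sub>R ((\<mu> \<odot>\<^bsub>1\<^esub> d) vs + (\<mu> \<odot>\<^bsub>2\<^esub> d) vs)"
  using assms by (simp add: bdry_def scaleR_fun_def numeral_2_eq_2)

lemma bdry_3:
  assumes "arity \<mu> = 3"
  shows "bdry d \<mu> vs = (d \<odot>\<^bsub>1\<^esub> \<mu>) vs -
    sign_pow (degree \<mu>) *\<^sub>R ((\<mu> \<odot>\<^bsub>1\<^esub> d) vs + (\<mu> \<odot>\<^bsub>2\<^esub> d) vs + (\<mu> \<odot>\<^bsub>3\<^esub> d) vs)"
  using assms by (simp add: bdry_def scaleR_fun_def numeral_3_eq_3 numeral_2_eq_2)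

lemma perm_12_pair: "perm (cyc [1, 2]) F [a, b] = sign_pow (fst a * fst b) *\<^sub>R F [b, a]"
proof -
  have "{(k, l). k \<in> {1..2} \<and> l \<in> {1..2} \<and> k < l \<and> cyc [1, 2] k > cyc [1, 2] l} = {(1, 2::nat)}"
    by (auto simp: Transposition.transpose_def)
  moreover have "[1..<Suc (Suc (Suc 0))] = [1, 2]" by (simp add: upt_conv_Cons)
  ultimately show ?thesis by (simp add: perm_def koszul_def numeral_2_eq_2)
qed

lemma perm_12_triple: "perm (cyc [1, 2]) F [a, b, c] = sign_pow (fst a * fst b) *\<^sub>R F [b, a, c]"
  and perm_23_triple: "perm (cyc [2, 3]) F [a, b, c] = sign_pow (fst b * fst c) *\<^sub>R F [a, c, b]"
proof -
  have iv: "{1..3} = {1, 2, 3::nat}" by auto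
  have "{(k, l). k \<in> {1..3} \<and> l \<in> {1..3} \<and> k < l \<and> cyc [1, 2] k > cyc [1, 2] l} = {(1, 2::nat)}"
    "{(k, l). k \<in> {1..3} \<and> l \<in> {1..3} \<and> k < l \<and> cyc [2, 3] k > cyc [2, 3] l} = {(2, 3::nat)}"
    unfolding iv by (auto simp: Transposition.transpose_def)
  moreover have "[1..<4] = [1, 2, 3]" by (simp add: upt_conv_Cons)
  moreover have "length [a, b, c] = 3" by simp
  ultimately show "perm (cyc [1, 2]) F [a, b, c] = sign_pow (fst a * fst b) *\<^sub>R F [b, a, c]"
    "perm (cyc [2, 3]) F [a, b, c] = sign_pow (fst b * fst c) *\<^sub>R F [a, c, b]"
    unfolding perm_def koszul_def by (simp_all del: list.size add: Transposition.transpose_def)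
qed

lemma perm_12_quad: "perm (cyc [1, 2]) F [a, b, c, e] = sign_pow (fst a * fst b) *\<^sub>R F [b, a, c, e]"
proof -
  have v: "cyc [1, 2] 1 = (2::nat)" "cyc [1, 2] 2 = (1::nat)" "cyc [1, 2] 3 = (3::nat)" "cyc [1, 2] 4 = (4::nat)"
    by (simp_all add: Transposition.transpose_def)
  note v = v v[unfolded One_nat_def]
  have iv: "{1..4} = {1, 2, 3, 4::nat}" by auto
  have "{(k, l). k \<in> {1..4} \<and> l \<in> {1..4} \<and> k < l \<and> cyc [1, 2] k > cyc [1, 2] l} = {(1, 2::nat)}"
    unfolding iv by (auto simp: v simp del: cycle_of_list.simps)
  moreover have "inv_into UNIV (cyc [1, 2::nat]) = Transposition.transpose 1 2"
    by (rule inv_unique_comp) (auto simp: fun_eq_iff Transposition.transpose_def)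
  moreover have "[1..<5] = [1, 2, 3, 4]" by (simp add: upt_conv_Cons)
  moreover have "length [a, b, c, e] = 4" by simp
  ultimately show ?thesis
    unfolding perm_def koszul_def by (simp del: list.size cycle_of_list.simps add: Transposition.transpose_def)
qed

text \<open>Under 1 to 2 to 3 to 1 the third argument moves to the front, passing the first two;
  these are the two inverted pairs and give the two signs.\<close>

lemma perm_123_quad:
  "perm (cyc [1, 2, 3]) F [a, b, c, e] = (sign_pow (fst a * fst c) * sign_pow (fst b * fst c)) *\<^sub>R F [c, a, b, e]"
proof -
  have iv: "{1..4} = {1, 2, 3, 4::nat}" by auto
  have "{(k, l). k \<in> {1..4} \<and> l \<in> {1..4} \<and> k < l \<and> cyc [1, 2, 3] k > cyc [1, 2, 3] l} = {(1, 3), (2, 3::nat)}"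
    unfolding iv by (auto simp: Transposition.transpose_def)
  moreover have "inv_into UNIV (cyc [1, 2, 3::nat]) = Transposition.transpose 2 3 \<circ> Transposition.transpose 1 2"
    by (rule inv_unique_comp) (auto simp: fun_eq_iff Transposition.transpose_def)
  moreover have "[1..<5] = [1, 2, 3, 4]" by (simp add: upt_conv_Cons)
  moreover have "length [a, b, c, e] = 4" by simp
  ultimately show ?thesis
    unfolding perm_def koszul_def by (simp del: list.size cycle_of_list.simps add: Transposition.transpose_def)
qed

section \<open>Extension by zero from sections to pairs of a section and a function\<close>

lemma cyc_permutes: "distinct cs \<Longrightarrow> set cs \<subseteq> {1..n} \<Longrightarrow> cyc cs permutes {1..n}"
  using cycle_permutes permutes_subset by blast

text \<open>Degrees are kept, so Koszul signs do not change. An element of degree 2 of the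
  associated complex becomes the zero section, still in degree 2, where \<open>GammaE\<close> is
  zero.\<close>

definition fst_tuple :: "(int \<times> 'u \<times> 'w) list \<Rightarrow> 'u tuple"
  where "fst_tuple vs = map (\<lambda>(i, u). (i, fst u)) vs"

lemma fst_tuple_simps [simp]:
  "length (fst_tuple vs) = length vs" "tdeg (fst_tuple vs) = tdeg vs"
  "fst_tuple (us @ vs) = fst_tuple us @ fst_tuple vs" "fst_tuple (v # vs) = (fst v, fst (snd v)) # fst_tuple vs"
  "fst_tuple [] = []"
  "take k (fst_tuple vs) = fst_tuple (take k vs)" "drop k (fst_tuple vs) = fst_tuple (drop k vs)"
  "k < length vs \<Longrightarrow> fst_tuple vs ! k = (fst (vs ! k), fst (snd (vs ! k)))"
  by (auto simp: fst_tuple_def tdeg_def comp_def case_prod_beta take_map drop_map intro!: arg_cong[of _ _ sum_list])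

text \<open>Identities between such extensions by zero hold as soon as they hold for the restrictions.\<close>

definition ext0 :: "(int \<Rightarrow> ('u \<times> 'w) set) \<Rightarrow> nat \<Rightarrow>
    (('u \<times> 'w) tuple \<Rightarrow> 'u \<times> 'w::real_vector) \<Rightarrow> ('u::real_vector tuple \<Rightarrow> 'u) \<Rightarrow> bool"
  where "ext0 L n F G \<longleftrightarrow> (\<forall>vs. homogeneous L n vs \<longrightarrow> F vs = (G (fst_tuple vs), 0))"

lemma ext0_add: "ext0 L n F G \<Longrightarrow> ext0 L n F' G' \<Longrightarrow> ext0 L n (F + F') (G + G')"
  and ext0_diff: "ext0 L n F G \<Longrightarrow> ext0 L n F' G' \<Longrightarrow> ext0 L n (F - F') (G - G')"
  and ext0_zero: "ext0 L n 0 0"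
  by (auto simp: ext0_def zero_prod_def)

lemma homogeneous_permute:
  assumes "homogeneous L n vs" "\<sigma> permutes {1..n}"
  shows "homogeneous L n (map (\<lambda>j. vs ! (inv_into UNIV \<sigma> j - 1)) [1..<length vs + 1])"
proof -
  have len: "length vs = n" using assms(1) by (simp add: homogeneous_def)
  have "vs ! (inv_into UNIV \<sigma> j - 1) \<in> set vs" if "j \<in> {1..n}" for j
  proof -
    have "inv_into UNIV \<sigma> j \<in> {1..n}" using permutes_inv[OF assms(2)] that by (simp add: permutes_in_image del: atLeastAtMost_iff)
    then show ?thesis using len by (intro nth_mem) auto
  qed
  then have "set (map (\<lambda>j. vs ! (inv_into UNIV \<sigma> j - 1)) [1..<length vs + 1]) \<subseteq> set vs"
    using len by auto
  with assms(1) len show ?thesis unfolding homogeneous_def by (auto simp del: set_map)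
qed

lemma ext0_perm:
  assumes "ext0 L n F G" "\<sigma> permutes {1..n}"
  shows "ext0 L n (perm \<sigma> F) (perm \<sigma> G)"
  unfolding ext0_def
proof (intro allI impI)
  fix vs assume hom: "homogeneous L n vs"
  let ?ws = "map (\<lambda>j. vs ! (inv_into UNIV \<sigma> j - 1)) [1..<length vs + 1]"
  have len: "length vs = n" using hom by (simp add: homogeneous_def)
  have "fst_tuple ?ws = map (\<lambda>j. fst_tuple vs ! (inv_into UNIV \<sigma> j - 1)) [1..<length vs + 1]"
  proof -
    have "inv_into UNIV \<sigma> j - 1 < length vs" if "j \<in> {1..n}" for j
    proof -
      have "inv_into UNIV \<sigma> j \<in> {1..n}" using permutes_inv[OF assms(2)] that by (simp add: permutes_in_image del: atLeastAtMost_iff)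
      then show ?thesis using len by auto
    qed
    then show ?thesis using len by (auto simp: fst_tuple_def case_prod_beta)
  qed
  moreover have "koszul \<sigma> (fst_tuple vs) = koszul \<sigma> vs"
    unfolding koszul_def by (auto intro!: prod.cong)
  moreover have "F ?ws = (G (fst_tuple ?ws), 0)"
    using assms(1) homogeneous_permute[OF hom assms(2)] by (simp add: ext0_def del: map_map)
  ultimately show "perm \<sigma> F vs = (perm \<sigma> G (fst_tuple vs), 0)"
    by (simp add: perm_def)
qed

text \<open>Only the first component of the inner map has to match, since the outer map ignores the
  second; this admits \<open>lambda2\<close>, with its function-valued term, inside
  \<open>Omega_map\<close>. The hypotheses speak about all tuples of the right length, so that the
  inserted value needs no degree check.\<close>

lemma ext0_pcomp:
  assumes "\<And>vs. length vs = n \<Longrightarrow> app \<mu> vs = (app \<mu>' (fst_tuple vs), 0)"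
    and "\<And>vs. length vs = arity \<nu> \<Longrightarrow> fst (app \<nu> vs) = app \<nu>' (fst_tuple vs)"
    and "arity \<nu> = arity \<nu>'" "degree \<nu> = degree \<nu>'" "1 \<le> i" "i \<le> n" "m = n + arity \<nu> - 1"
  shows "ext0 L m (\<mu> \<odot>\<^bsub>i\<^esub> \<nu>) (\<mu>' \<odot>\<^bsub>i\<^esub> \<nu>')"
  unfolding ext0_def
proof (intro allI impI)
  fix vs assume "homogeneous L m vs"
  then have len: "length vs = n + arity \<nu> - 1" using assms(7) by (simp add: homogeneous_def)
  define us where "us = take (i - 1) vs"
  define ws where "ws = take (arity \<nu>) (drop (i - 1) vs)"
  define zs where "zs = drop (i - 1 + arity \<nu>) vs"
  have l: "length ws = arity \<nu>" "length (us @ (tdeg ws + degree \<nu>, app \<nu> ws) # zs) = n"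
    using len assms(5,6) by (auto simp: us_def ws_def zs_def)
  have "(\<mu> \<odot>\<^bsub>i\<^esub> \<nu>) vs = sign_pow (degree \<nu> * tdeg us) *\<^sub>R app \<mu> (us @ (tdeg ws + degree \<nu>, app \<nu> ws) # zs)"
    by (simp add: pcomp_def Let_def us_def ws_def zs_def)
  also have "\<dots> = (sign_pow (degree \<nu> * tdeg us) *\<^sub>R
      app \<mu>' (fst_tuple us @ (tdeg ws + degree \<nu>, app \<nu>' (fst_tuple ws)) # fst_tuple zs), 0)"
    using assms(1)[OF l(2)] assms(2)[OF l(1)] by simp
  also have "\<dots> = ((\<mu>' \<odot>\<^bsub>i\<^esub> \<nu>') (fst_tuple vs), 0)"
    using assms(3,4) by (simp add: pcomp_def Let_def us_def ws_def zs_def)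
  finally show "(\<mu> \<odot>\<^bsub>i\<^esub> \<nu>) vs = ((\<mu>' \<odot>\<^bsub>i\<^esub> \<nu>') (fst_tuple vs), 0)" .
qed

lemma eq_on_ext0:
  assumes "eq_on \<Gamma> n G G'" "ext0 L n F G" "ext0 L n F' G'"
    and "\<And>vs. homogeneous L n vs \<Longrightarrow> homogeneous \<Gamma> n (fst_tuple vs)"
  shows "eq_on L n F F'"
  using assms by (auto simp: eq_on_def ext0_def)

section \<open>Identities in a CLWX 2-algebroid\<close>

context clwx_on_manifold
begin

section \<open>Degrees, zeros and linearity of the operations on sections\<close>

lemma circ_product: "circ_product E" and Omega_form: "graded_3_form E"
  and dg_bundle: "dg_vector_bundle_2 E"
  using clwx by (auto simp: clwx_2_algebroid_def)

lemma circ_lin_right: "e \<in> T \<Longrightarrow> lin_on T (circ E e)"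
  and circ_lin_left: "e \<in> T \<Longrightarrow> lin_on T (\<lambda>e'. circ E e' e)"
  and circ_Gamma: "e \<in> \<Gamma> i \<Longrightarrow> e' \<in> \<Gamma> j \<Longrightarrow> circ E e e' \<in> \<Gamma> (i + j)"
proof -
  note c = circ_product[unfolded circ_product_def]
  note c1 = c[THEN conjunct1] and c2 = c[THEN conjunct2]
  note c3 = c2[THEN conjunct2, THEN conjunct1]
  show "e \<in> T \<Longrightarrow> lin_on T (circ E e)" using c1 by simp
  show "e \<in> T \<Longrightarrow> lin_on T (\<lambda>e'. circ E e' e)" using c2[THEN conjunct1] by simp
  show "e \<in> \<Gamma> i \<Longrightarrow> e' \<in> \<Gamma> j \<Longrightarrow> circ E e e' \<in> \<Gamma> (i + j)" using c3 by blast
qed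

lemma circ_zero: "e \<in> T \<Longrightarrow> circ E e 0 = 0" "e \<in> T \<Longrightarrow> circ E 0 e = 0"
  using lin_on_zero[OF circ_lin_right] lin_on_zero[OF circ_lin_left] by auto

lemma circ_T [simp, intro]: "e \<in> T \<Longrightarrow> e' \<in> T \<Longrightarrow> circ E e e' \<in> T"
proof -
  assume "e \<in> T" "e' \<in> T"
  then obtain a b a' b' where "a \<in> \<Gamma> 0" "b \<in> \<Gamma> 1" "a' \<in> \<Gamma> 0" "b' \<in> \<Gamma> 1" "e = a + b" "e' = a' + b'"
    by (metis T_cases)
  then show ?thesis
    using circ_Gamma lin_on_add[OF circ_lin_left, of e' a b] lin_on_add[OF circ_lin_right, of a a' b']
      lin_on_add[OF circ_lin_right, of b a' b']
    by (metis Gamma_subset_T T_closed(2))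
qed

lemma S_bnd: "e1 \<in> T \<Longrightarrow> e2 \<in> T \<Longrightarrow> S (bd e1) e2 = S e1 (bd e2)"
  and rho_S: "e1 \<in> T \<Longrightarrow> e2 \<in> T \<Longrightarrow> e3 \<in> T \<Longrightarrow>
    \<rho> e1 (S e2 e3) = S (circ E e1 e2) e3 + S e2 (circ E e1 e3)"
  and S_Omega: "e1 \<in> T \<Longrightarrow> e2 \<in> T \<Longrightarrow> e3 \<in> T \<Longrightarrow> e4 \<in> T \<Longrightarrow>
    S (Omega E e1 e2 e3) e4 = - S e3 (Omega E e1 e2 e4)"
  and circ_self: "e \<in> T \<Longrightarrow> circ E e e = (1/2) *\<^sub>R D (S e e)"
  using clwx unfolding clwx_2_algebroid_def by simp_all

lemma rho_lin: "f \<in> C \<Longrightarrow> lin_on T (\<lambda>e. \<rho> e f)"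
  using anchor_lin[of f] T_fibre
  by (auto simp: anchor_sec_def lin_on_def fun_eq_iff scaleR_fun_def)

lemma rho_lin_fun: "e \<in> T \<Longrightarrow> lin_on C (\<rho> e)"
  using anchor_tangent[OF T_fibre]
  by (auto simp: anchor_sec_def lin_on_def fun_eq_iff scaleR_fun_def tangent_space_def)

lemma rho_derivation:
  "e \<in> T \<Longrightarrow> f \<in> C \<Longrightarrow> g \<in> C \<Longrightarrow> \<rho> e (\<lambda>y. f y * g y) = (\<lambda>y. f y * \<rho> e g y + g y * \<rho> e f y)"
  using anchor_tangent[OF T_fibre] by (auto simp: anchor_sec_def fun_eq_iff tangent_space_def)

lemma rho_zero: "f \<in> C \<Longrightarrow> \<rho> 0 f = 0" "e \<in> T \<Longrightarrow> \<rho> e 0 = 0"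
  using lin_on_zero[OF rho_lin] lin_on_zero[OF rho_lin_fun] by auto

lemma rho_E1: "e \<in> \<Gamma> i \<Longrightarrow> i \<noteq> 0 \<Longrightarrow> f \<in> C \<Longrightarrow> \<rho> e f = 0"
proof -
  assume e: "e \<in> \<Gamma> i" and i: "i \<noteq> 0" and f: "f \<in> C"
  show ?thesis
  proof (cases "i = 1")
    case True
    then show ?thesis using anchor_E1[OF Gamma_fibre(2) f] e by (auto simp: anchor_sec_def)
  next
    case False
    then show ?thesis using e i Gamma_other rho_zero(1)[OF f] by auto
  qed
qed

lemma bnd_fibre: "lin_on (total_fibre E x) (bnd E x)"
  and bnd_E0: "u \<in> fibre (E0 E) x \<Longrightarrow> bnd E x u = 0"
  and bd_E1: "e \<in> \<Gamma> 1 \<Longrightarrow> bd e \<in> \<Gamma> 0"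
  using dg_bundle unfolding dg_vector_bundle_2_def by simp_all

lemma bd_lin: "lin_on T bd"
  using bnd_fibre T_fibre by (auto simp: bnd_sec_def lin_on_def fun_eq_iff scaleR_fun_def)

lemma bd_zero [simp]: "bd 0 = 0"
  using lin_on_zero[OF bd_lin] by auto

lemma bd_E0: "e \<in> \<Gamma> i \<Longrightarrow> i \<noteq> 1 \<Longrightarrow> bd e = 0"
proof -
  assume e: "e \<in> \<Gamma> i" and i: "i \<noteq> 1"
  show ?thesis
  proof (cases "i = 0")
    case True
    then show ?thesis using bnd_E0[OF Gamma_fibre(1)] e by (auto simp: bnd_sec_def)
  next
    case False
    then show ?thesis using e i Gamma_other by auto
  qed
qed

lemma bd_Gamma: "e \<in> \<Gamma> i \<Longrightarrow> bd e \<in> \<Gamma> (i - 1)"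
  using bd_E1 bd_E0[of e i] by (cases "i = 1") auto

lemma bd_fmult: "e \<in> T \<Longrightarrow> bd (fmult f e) = fmult f (bd e)"
  using lin_on_scale[OF bnd_fibre T_fibre] by (auto simp: bnd_sec_def fmult_def)

lemma rho_bd: "e \<in> \<Gamma> i \<Longrightarrow> f \<in> C \<Longrightarrow> \<rho> (bd e) f = 0"
proof -
  assume e: "e \<in> \<Gamma> i" and f: "f \<in> C"
  show ?thesis
  proof (cases "i = 1")
    case True
    then show ?thesis using anchor_bnd[OF Gamma_fibre(2) f] e by (auto simp: anchor_sec_def bnd_sec_def)
  next
    case False
    then show ?thesis using bd_E0[OF e] rho_zero(1)[OF f] by simp
  qed
qed

lemma S_zero [simp]: "e \<in> T \<Longrightarrow> S e 0 = 0" "e \<in> T \<Longrightarrow> S 0 e = 0"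
  using lin_on_zero[OF S_lin_right] lin_on_zero[OF S_lin_left] by auto

text \<open>In degrees 0 and 1 this is isotropy; in any other degree one of the arguments is the
  zero section.\<close>

lemma S_degree: "e \<in> \<Gamma> i \<Longrightarrow> e' \<in> \<Gamma> j \<Longrightarrow> i + j \<noteq> 1 \<Longrightarrow> S e e' = 0"
proof -
  assume e: "e \<in> \<Gamma> i" "e' \<in> \<Gamma> j" and ij: "i + j \<noteq> 1"
  then consider "i = 0" "j = 0" | "i = 1" "j = 1" | "e = 0" | "e' = 0"
    using Gamma_other[of i] Gamma_other[of j] by force
  then show ?thesis
    by cases (use e S_isotropic in auto)
qed

lemma Omega_Cinf_linear:
  assumes "e1 \<in> T" "e2 \<in> T"
  shows "Cinf_linear_on (base E) T (\<lambda>e. Omega E e e1 e2)"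
    "Cinf_linear_on (base E) T (\<lambda>e. Omega E e1 e e2)"
    "Cinf_linear_on (base E) T (\<lambda>e. Omega E e1 e2 e)"
  using Omega_form[unfolded graded_3_form_def, THEN conjunct1] assms by simp_all

lemma Omega_Gamma: "e1 \<in> \<Gamma> i \<Longrightarrow> e2 \<in> \<Gamma> j \<Longrightarrow> e3 \<in> \<Gamma> k \<Longrightarrow> Omega E e1 e2 e3 \<in> \<Gamma> (i + j + k + 1)"
  using Omega_form[unfolded graded_3_form_def, THEN conjunct2, THEN conjunct1] by blast

lemma Omega_skew: "e1 \<in> \<Gamma> 0 \<Longrightarrow> e2 \<in> \<Gamma> 0 \<Longrightarrow> e3 \<in> \<Gamma> 0 \<Longrightarrow> Omega E e2 e1 e3 = - Omega E e1 e2 e3"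
    "e1 \<in> \<Gamma> 0 \<Longrightarrow> e2 \<in> \<Gamma> 0 \<Longrightarrow> e3 \<in> \<Gamma> 0 \<Longrightarrow> Omega E e1 e3 e2 = - Omega E e1 e2 e3"
  using Omega_form[unfolded graded_3_form_def, THEN conjunct2, THEN conjunct2] by blast+

lemma Cinf_linear_lin_on: "Cinf_linear_on (base E) T F \<Longrightarrow> lin_on T F"
proof -
  assume F: "Cinf_linear_on (base E) T F"
  have "(\<lambda>x. r) \<in> C" for r by (simp add: Cinf_def smooth_fun_on_const)
  moreover have "fmult (\<lambda>x. r) s = r *\<^sub>R s" for r and s :: "'m \<Rightarrow> 'v" by (simp add: fmult_def scaleR_fun_def)
  ultimately show ?thesis using F unfolding lin_on_def Cinf_linear_on_def by metis
qed

lemmas Omega_lin = Omega_Cinf_linear[THEN Cinf_linear_lin_on]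

lemma Omega_zero: "e1 \<in> T \<Longrightarrow> e2 \<in> T \<Longrightarrow> Omega E 0 e1 e2 = 0"
  "e1 \<in> T \<Longrightarrow> e2 \<in> T \<Longrightarrow> Omega E e1 0 e2 = 0" "e1 \<in> T \<Longrightarrow> e2 \<in> T \<Longrightarrow> Omega E e1 e2 0 = 0"
  using lin_on_zero[OF Omega_lin(1)] lin_on_zero[OF Omega_lin(2)] lin_on_zero[OF Omega_lin(3)] by auto

text \<open>If some degree is 1 and the others are 0 or 1, the value has degree at least 2, where
  only the zero section lives.\<close>

lemma Omega_degree:
  assumes e: "e1 \<in> \<Gamma> i" "e2 \<in> \<Gamma> j" "e3 \<in> \<Gamma> k" and ijk: "\<not> (i = 0 \<and> j = 0 \<and> k = 0)"
  shows "Omega E e1 e2 e3 = 0"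
proof -
  consider "e1 = 0" | "e2 = 0" | "e3 = 0" | "i \<in> {0, 1}" "j \<in> {0, 1}" "k \<in> {0, 1}"
    using e Gamma_other[of i] Gamma_other[of j] Gamma_other[of k] by blast
  then show ?thesis
  proof cases
    case 4
    then have "i + j + k + 1 \<noteq> 0" "i + j + k + 1 \<noteq> 1" using ijk by auto
    then show ?thesis using Omega_Gamma[OF e] Gamma_other by auto
  qed (use e Omega_zero in auto)
qed

lemma Omega_Gamma1: "e1 \<in> \<Gamma> i \<Longrightarrow> e2 \<in> \<Gamma> j \<Longrightarrow> e3 \<in> \<Gamma> k \<Longrightarrow> Omega E e1 e2 e3 \<in> \<Gamma> 1"
  using Omega_Gamma[of e1 0 e2 0 e3 0] Omega_degree[of e1 i e2 j e3 k]
  by (cases "i = 0 \<and> j = 0 \<and> k = 0") auto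

section \<open>The operator \<open>D\<close> and its interaction with the differential and the
  product\<close>

lemma D_T [simp, intro]: "f \<in> C \<Longrightarrow> D f \<in> T"
  using D_Gamma Gamma_subset_T by blast

lemma D_zero [simp]: "D 0 = 0"
  by (rule D_eqI) (auto simp: rho_zero)

lemma D_lin: "lin_on C D"
  unfolding lin_on_def
proof safe
  fix f g assume f: "f \<in> C" "g \<in> C"
  show "D (f + g) = D f + D g"
    by (rule D_eqI) (use f in \<open>auto simp: lin_on_add[OF S_lin_right] lin_on_add[OF rho_lin_fun] S_D Gamma_subset_T[OF D_Gamma]\<close>)
next
  fix f r assume f: "f \<in> C"
  show "D (r *\<^sub>R f) = r *\<^sub>R D f"
    by (rule D_eqI) (use f in \<open>auto simp: lin_on_scale[OF S_lin_right] lin_on_scale[OF rho_lin_fun] S_D Gamma_subset_T[OF D_Gamma]\<close>)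
qed

text \<open>Pairing with e in \<open>\<Gamma> 1\<close>, axiom (iv) gives S(bd e, D f) = \<rho>(bd
  e) f, which is zero because the anchor is a chain map into a complex concentrated in degree
  0.\<close>

lemma bd_D: "f \<in> C \<Longrightarrow> bd (D f) = 0"
proof (rule Gamma0_eqI)
  assume f: "f \<in> C"
  show "bd (D f) \<in> \<Gamma> 0" using f bd_E1 by blast
  fix e assume e: "e \<in> \<Gamma> 1"
  have "S e (bd (D f)) = S (bd e) (D f)" using S_bnd[of e "D f"] e f by auto
  also have "\<dots> = \<rho> (bd e) f" using S_D[OF f, of "bd e"] bd_E1[OF e] by auto
  also have "\<dots> = 0" by (rule rho_bd[OF e f])
  finally show "S e (bd (D f)) = S e 0" using e by auto
qed auto

text \<open>Paired with \<open>e3\<close> in \<open>\<Gamma> 1\<close>, axiom (v) trades the product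
  for \<open>\<rho> e1\<close> applied to the function f S(e3, e2). There the derivation property of
  tangent vectors produces the extra term.\<close>

lemma circ_fmult:
  assumes e: "e1 \<in> \<Gamma> 0" "e2 \<in> \<Gamma> 0" and f: "f \<in> C"
  shows "circ E e1 (fmult f e2) = fmult f (circ E e1 e2) + fmult (\<rho> e1 f) e2"
proof (rule Gamma0_eqI)
  have T: "e1 \<in> T" "e2 \<in> T" "fmult f e2 \<in> T" "\<rho> e1 f \<in> C" "circ E e1 e2 \<in> T"
    using e f Gamma_fmult by auto
  have c: "circ E e1 e2 \<in> \<Gamma> 0" using circ_Gamma[OF e] by simp
  show "circ E e1 (fmult f e2) \<in> \<Gamma> 0" using circ_Gamma[OF e(1) Gamma_fmult[OF f e(2)]] by simp
  show "fmult f (circ E e1 e2) + fmult (\<rho> e1 f) e2 \<in> \<Gamma> 0"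
    using Gamma_fmult[OF f c] Gamma_fmult[OF T(4) e(2)] by blast
  fix e3 assume e3: "e3 \<in> \<Gamma> 1"
  then have T3: "e3 \<in> T" "circ E e1 e3 \<in> T" using T by auto
  have Sf: "S a (fmult h b) = (\<lambda>y. h y * S a b y)" if "a \<in> T" "b \<in> T" for a b h
    using lin_on_scale[OF pair_lin[OF T_fibre[OF that(1)]] T_fibre[OF that(2)]] by (simp add: pair_sec_def fmult_def)
  have "S e3 (circ E e1 (fmult f e2)) = \<rho> e1 (S e3 (fmult f e2)) - S (circ E e1 e3) (fmult f e2)"
    using rho_S[OF T(1) T3(1) T(3)] by simp
  also have "\<dots> = (\<lambda>y. f y * \<rho> e1 (S e3 e2) y + S e3 e2 y * \<rho> e1 f y) - (\<lambda>y. f y * S (circ E e1 e3) e2 y)"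
    using rho_derivation[OF T(1) f, of "S e3 e2"] T T3 by (simp add: Sf)
  also have "\<dots> = (\<lambda>y. f y * S e3 (circ E e1 e2) y) + (\<lambda>y. \<rho> e1 f y * S e3 e2 y)"
    unfolding rho_S[OF T(1) T3(1) T(2)] by (auto simp: fun_eq_iff algebra_simps)
  also have "\<dots> = S e3 (fmult f (circ E e1 e2)) + S e3 (fmult (\<rho> e1 f) e2)"
    using T T3 by (simp add: Sf)
  also have "\<dots> = S e3 (fmult f (circ E e1 e2) + fmult (\<rho> e1 f) e2)"
    using T T3 T_fmult f by (simp add: lin_on_add[OF S_lin_right])
  finally show "S e3 (circ E e1 (fmult f e2)) = S e3 (fmult f (circ E e1 e2) + fmult (\<rho> e1 f) e2)" .
qed

abbreviation "bd_map \<equiv> GMap 1 (- 1) (\<lambda>vs. bd (snd (vs ! 0)))"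
abbreviation "circ_sec \<equiv> GMap 2 0 (\<lambda>vs. circ E (snd (vs ! 0)) (snd (vs ! 1)))"
abbreviation "Omega_sec \<equiv> GMap 3 1 (\<lambda>vs. Omega E (snd (vs ! 0)) (snd (vs ! 1)) (snd (vs ! 2)))"

lemmas leibniz_unfolded = leibniz[unfolded leibniz_3_algebra_def]
lemmas leibniz_identities = leibniz_unfolded[THEN conjunct2, THEN conjunct2, THEN conjunct2, THEN conjunct2]
lemmas leibniz_2 = leibniz_identities[THEN conjunct1]
lemmas leibniz_3 = leibniz_identities[THEN conjunct2, THEN conjunct1]
lemmas leibniz_4 = leibniz_identities[THEN conjunct2, THEN conjunct2, THEN conjunct1]
lemmas leibniz_5 = leibniz_identities[THEN conjunct2, THEN conjunct2, THEN conjunct2]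

lemma circ_chain:
  assumes e: "e1 \<in> \<Gamma> i" "e2 \<in> \<Gamma> j"
  shows "bd (circ E e1 e2) = circ E (bd e1) e2 + sign_pow i *\<^sub>R circ E e1 (bd e2)"
proof -
  have "homogeneous \<Gamma> 2 [(i, e1), (j, e2)]" using e by (simp add: homogeneous_def)
  from leibniz_2[unfolded eq_on_def, rule_format, OF this] show ?thesis
    unfolding bdry_2[OF gmap.sel(1)] by (simp add: pcomp_def Let_def tdeg_def)
qed

text \<open>Kept in arbitrary degrees with its signs, because it reappears as the section component
  of the same identity for \<open>lambda2\<close>.\<close>

lemma jacobi_general:
  assumes e: "e1 \<in> \<Gamma> i" "e2 \<in> \<Gamma> j" "e3 \<in> \<Gamma> k"
  shows "circ E e1 (circ E e2 e3) - circ E (circ E e1 e2) e3 - sign_pow (i * j) *\<^sub>R circ E e2 (circ E e1 e3) =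
    bd (Omega E e1 e2 e3) + (Omega E (bd e1) e2 e3 + sign_pow i *\<^sub>R Omega E e1 (bd e2) e3
      + sign_pow (i + j) *\<^sub>R Omega E e1 e2 (bd e3))"
proof -
  have "homogeneous \<Gamma> 3 [(i, e1), (j, e2), (k, e3)]" using e by (simp add: homogeneous_def)
  from leibniz_3[unfolded eq_on_def, rule_format, OF this] show ?thesis
    unfolding bdry_3[OF gmap.sel(1)] minus_apply perm_12_triple
    by (simp add: pcomp_def Let_def tdeg_def fun_eq_iff algebra_simps)
qed

lemma jacobi:
  assumes e: "e1 \<in> \<Gamma> 0" "e2 \<in> \<Gamma> 0" "e3 \<in> \<Gamma> 0"
  shows "circ E e1 (circ E e2 e3) - circ E (circ E e1 e2) e3 - circ E e2 (circ E e1 e3) = bd (Omega E e1 e2 e3)"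
  using jacobi_general[OF e] e by (simp add: bd_E0[where i = 0] Omega_zero)

text \<open>Replacing \<open>e3\<close> by \<open>f e3\<close> in the Jacobi identity leaves the defect of the anchor times \<open>e3\<close>;
  at a point where that defect is nonzero all sections of \<open>E0\<close> would vanish, hence the defect too.\<close>

lemma rho_circ:
  assumes e: "e1 \<in> \<Gamma> 0" "e2 \<in> \<Gamma> 0" and f: "f \<in> C"
  shows "\<rho> (circ E e1 e2) f = \<rho> e1 (\<rho> e2 f) - \<rho> e2 (\<rho> e1 f)"
proof
  fix x
  define h where "h = \<rho> e1 (\<rho> e2 f) - \<rho> e2 (\<rho> e1 f) - \<rho> (circ E e1 e2) f"
  have c0: "circ E a b \<in> \<Gamma> 0" if "a \<in> \<Gamma> 0" "b \<in> \<Gamma> 0" for a b using circ_Gamma[OF that] by simp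
  note g = Gamma_fmult[of _ _ 0]
  have rC: "\<rho> a k \<in> C" if "a \<in> \<Gamma> 0" "k \<in> C" for a k using that by auto
  \<comment> \<open>The two mixed terms are exchanged when \<open>a\<close> and \<open>b\<close> are
    swapped, so they cancel in the Jacobi identity and only the second derivatives of f
    survive.\<close>
  have nest: "circ E a (circ E b (fmult f e3)) = fmult f (circ E a (circ E b e3)) + fmult (\<rho> a f) (circ E b e3)
     + fmult (\<rho> b f) (circ E a e3) + fmult (\<rho> a (\<rho> b f)) e3"
    if a: "a \<in> \<Gamma> 0" and b: "b \<in> \<Gamma> 0" and e3: "e3 \<in> \<Gamma> 0" for a b e3
  proof -
    have "circ E a (circ E b (fmult f e3)) = circ E a (fmult f (circ E b e3)) + circ E a (fmult (\<rho> b f) e3)"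
      unfolding circ_fmult[OF b e3 f]
      using lin_on_add[OF circ_lin_right, of a] g[OF f c0[OF b e3]] g[OF rC[OF b f] e3] a by blast
    then show ?thesis
      unfolding circ_fmult[OF a c0[OF b e3] f] circ_fmult[OF a e3 rC[OF b f]] by (simp add: add_ac)
  qed
  have "h x *\<^sub>R e3 x = 0" if e3: "e3 \<in> \<Gamma> 0" for e3
  proof -
    have "bd (Omega E e1 e2 (fmult f e3)) = fmult f (bd (Omega E e1 e2 e3))"
    proof -
      have "Omega E e1 e2 (fmult f e3) = fmult f (Omega E e1 e2 e3)"
        using Omega_Cinf_linear(3)[of e1 e2] e e3 f unfolding Cinf_linear_on_def by blast
      then show ?thesis using bd_fmult[of "Omega E e1 e2 e3"] Omega_Gamma1[OF e e3] by auto
    qed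
    then have "circ E e1 (circ E e2 (fmult f e3)) - circ E (circ E e1 e2) (fmult f e3) - circ E e2 (circ E e1 (fmult f e3))
      = fmult f (circ E e1 (circ E e2 e3) - circ E (circ E e1 e2) e3 - circ E e2 (circ E e1 e3))"
      using jacobi[OF e e3] jacobi[OF e g[OF f e3]] by simp
    from fun_cong[OF this, of x] show ?thesis
      unfolding nest[OF e e3] nest[OF e(2,1) e3] circ_fmult[OF c0[OF e] e3 f]
      by (simp add: fmult_def h_def algebra_simps)
  qed
  moreover have "h x = 0" if "\<And>e3. e3 \<in> \<Gamma> 0 \<Longrightarrow> e3 x = 0"
  proof -
    have "\<rho> a k x = 0" if "a \<in> \<Gamma> 0" "k \<in> C" for a k
      using lin_on_zero[OF anchor_lin[OF that(2)] subspace_0[OF total_fibre_subspace]] \<open>\<And>e3. e3 \<in> \<Gamma> 0 \<Longrightarrow> e3 x = 0\<close>[OF that(1)]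
      by (simp add: anchor_sec_def)
    then show ?thesis using e f c0 rC by (simp add: h_def)
  qed
  ultimately have "h x = 0" by (metis scaleR_eq_0_iff)
  then show "\<rho> (circ E e1 e2) f x = (\<rho> e1 (\<rho> e2 f) - \<rho> e2 (\<rho> e1 f)) x" by (simp add: h_def)
qed

lemma circ_polarized:
  assumes "a \<in> T" "b \<in> T"
  shows "circ E a b + circ E b a = D (S a b)"
proof -
  have "circ E (a + b) (a + b) = circ E a a + circ E a b + (circ E b a + circ E b b)"
    using assms by (simp add: lin_on_add[OF circ_lin_left] lin_on_add[OF circ_lin_right])
  moreover have "S (a + b) (a + b) = S a a + S b b + 2 *\<^sub>R S a b"
    using assms S_commute[of b a]
    by (simp add: lin_on_add[OF S_lin_left] lin_on_add[OF S_lin_right] scaleR_2)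
  moreover have "D (S a a + S b b + 2 *\<^sub>R S a b) = D (S a a) + D (S b b) + 2 *\<^sub>R D (S a b)"
    using assms by (simp add: lin_on_add[OF D_lin] lin_on_scale[OF D_lin])
  ultimately show ?thesis
    using circ_self[of "a + b"] circ_self[of a] circ_self[of b] assms by (simp add: scaleR_right_distrib)
qed

text \<open>Pairing with a in \<open>\<Gamma> 0\<close>, axiom (v) turns the right side into
  \<rho>(e) \<rho>(a) f - \<rho>(e \<circ> a) f, which equals \<rho>(a) \<rho>(e) f by
  \<open>rho_circ\<close>.\<close>

lemma D_rho:
  assumes e: "e \<in> \<Gamma> 0" and f: "f \<in> C"
  shows "D (\<rho> e f) = circ E e (D f)"
proof (rule D_eqI)
  show "\<rho> e f \<in> C" using e f by auto
  show "circ E e (D f) \<in> \<Gamma> 1" using circ_Gamma[OF e D_Gamma[OF f]] by simp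
  fix a assume a: "a \<in> \<Gamma> 0"
  have "circ E e a \<in> \<Gamma> 0" using circ_Gamma[OF e a] by simp
  then show "S a (circ E e (D f)) = \<rho> a (\<rho> e f)"
    using rho_S[of e a "D f"] S_D[OF f, of a] S_D[OF f, of "circ E e a"] rho_circ[OF e a f] a e f by auto
qed

text \<open>In degree 0 the sum of e \<circ> D f and D f \<circ> e is D(S(e, D f)) = D(\<rho>(e) f),
  which \<open>D_rho\<close> shows to be the first summand alone. In degree 1 the product lands in
  degree 2, which is zero.\<close>

lemma circ_D:
  assumes e: "e \<in> \<Gamma> i" and f: "f \<in> C"
  shows "circ E (D f) e = 0"
proof -
  consider "i = 0" | "i = 1" | "e = 0" using e Gamma_other[of i] by blast
  then show ?thesis
  proof cases
    case 1
    then show ?thesis using circ_polarized[of "D f" e] D_rho[of e f] S_D[OF f, of e] S_commute[of e "D f"] e f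
      by auto
  next
    case 2
    then show ?thesis using circ_Gamma[OF D_Gamma[OF f] e] Gamma_other[of 2] by auto
  qed (use circ_zero f in auto)
qed

end

section \<open>The associated weak Lie 3-algebra\<close>

lemma pcomp_zero_left [simp]: "(GMap n k 0 \<odot>\<^bsub>i\<^esub> \<nu>) = 0"
  by (simp add: pcomp_def Let_def fun_eq_iff)

lemma perm_zero [simp]: "perm \<sigma> 0 = 0"
  by (simp add: perm_def fun_eq_iff)

lemma tdeg_Nil [simp]: "tdeg [] = 0" and tdeg_Cons [simp]: "tdeg (v # vs) = fst v + tdeg vs"
  by (simp_all add: tdeg_def)

lemma bdry_zero:
  assumes "\<And>t. app d [(t, 0)] = 0" "length vs = n"
  shows "bdry d (GMap n k 0) vs = 0"
proof -
  have "(d \<odot>\<^bsub>1\<^esub> GMap n k 0) vs = 0" using assms by (simp add: pcomp_def Let_def)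
  then show ?thesis by (simp add: bdry_def)
qed

lemma homogeneous_1D: "homogeneous L 1 vs \<Longrightarrow> \<exists>i u. vs = [(i, u)] \<and> u \<in> L i"
  by (auto simp: homogeneous_def length_Suc_conv)

lemma homogeneous_2D: "homogeneous L 2 vs \<Longrightarrow> \<exists>i u j v. vs = [(i, u), (j, v)] \<and> u \<in> L i \<and> v \<in> L j"
  by (auto simp: homogeneous_def length_Suc_conv numeral_2_eq_2)

lemma homogeneous_3D:
  "homogeneous L 3 vs \<Longrightarrow> \<exists>i u j v k w. vs = [(i, u), (j, v), (k, w)] \<and> u \<in> L i \<and> v \<in> L j \<and> w \<in> L k"
  by (auto simp: homogeneous_def length_Suc_conv numeral_3_eq_3)

lemma homogeneous_4D:
  "homogeneous L 4 vs \<Longrightarrow> \<exists>i u j v k w l z. vs = [(i, u), (j, v), (k, w), (l, z)] \<and>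
    u \<in> L i \<and> v \<in> L j \<and> w \<in> L k \<and> z \<in> L l"
proof -
  assume h: "homogeneous L 4 vs"
  moreover have "4 = Suc (Suc (Suc (Suc 0)))" by simp
  ultimately show ?thesis by (auto simp: homogeneous_def length_Suc_conv)
qed

lemma eq_on_1I: "(\<And>i u. u \<in> L i \<Longrightarrow> F [(i, u)] = G [(i, u)]) \<Longrightarrow> eq_on L 1 F G"
  unfolding eq_on_def using homogeneous_1D by metis

lemma eq_on_2I:
  "(\<And>i u j v. u \<in> L i \<Longrightarrow> v \<in> L j \<Longrightarrow> F [(i, u), (j, v)] = G [(i, u), (j, v)]) \<Longrightarrow> eq_on L 2 F G"
  unfolding eq_on_def using homogeneous_2D by metis

lemma eq_on_3I:
  "(\<And>i u j v k w. u \<in> L i \<Longrightarrow> v \<in> L j \<Longrightarrow> w \<in> L k \<Longrightarrow>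
    F [(i, u), (j, v), (k, w)] = G [(i, u), (j, v), (k, w)]) \<Longrightarrow> eq_on L 3 F G"
  unfolding eq_on_def using homogeneous_3D by metis

lemma eq_on_4I:
  "(\<And>i u j v k w l z. u \<in> L i \<Longrightarrow> v \<in> L j \<Longrightarrow> w \<in> L k \<Longrightarrow> z \<in> L l \<Longrightarrow>
    F [(i, u), (j, v), (k, w), (l, z)] = G [(i, u), (j, v), (k, w), (l, z)]) \<Longrightarrow> eq_on L 4 F G"
  unfolding eq_on_def by (auto dest!: homogeneous_4D)

lemma is_gmap_1I:
  assumes "arity \<mu> = 1" "degree \<mu> = k" "\<And>i u. u \<in> L i \<Longrightarrow> app \<mu> [(i, u)] \<in> L (i + k)"
    "\<And>i. lin_on (L i) (\<lambda>u. app \<mu> [(i, u)])"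
  shows "is_gmap L 1 k \<mu>"
  unfolding is_gmap_def using assms by (auto simp: tdeg_def dest!: homogeneous_1D[unfolded One_nat_def])

lemma is_gmap_2I:
  assumes "arity \<mu> = 2" "degree \<mu> = k"
    "\<And>i u j v. u \<in> L i \<Longrightarrow> v \<in> L j \<Longrightarrow> app \<mu> [(i, u), (j, v)] \<in> L (i + j + k)"
    "\<And>i j v. v \<in> L j \<Longrightarrow> lin_on (L i) (\<lambda>u. app \<mu> [(i, u), (j, v)])"
    "\<And>i j u. u \<in> L i \<Longrightarrow> lin_on (L j) (\<lambda>v. app \<mu> [(i, u), (j, v)])"
  shows "is_gmap L 2 k \<mu>"
  unfolding is_gmap_def using assms
  by (auto simp: tdeg_def less_Suc_eq numeral_2_eq_2[symmetric] add.assoc dest!: homogeneous_2D)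
    (auto simp: less_Suc_eq numeral_2_eq_2)

lemma is_gmap_3I:
  assumes "arity \<mu> = 3" "degree \<mu> = k"
    "\<And>i u j v l w. u \<in> L i \<Longrightarrow> v \<in> L j \<Longrightarrow> w \<in> L l \<Longrightarrow> app \<mu> [(i, u), (j, v), (l, w)] \<in> L (i + j + l + k)"
    "\<And>i j v l w. v \<in> L j \<Longrightarrow> w \<in> L l \<Longrightarrow> lin_on (L i) (\<lambda>u. app \<mu> [(i, u), (j, v), (l, w)])"
    "\<And>i j u l w. u \<in> L i \<Longrightarrow> w \<in> L l \<Longrightarrow> lin_on (L j) (\<lambda>v. app \<mu> [(i, u), (j, v), (l, w)])"
    "\<And>i j u l v. u \<in> L i \<Longrightarrow> v \<in> L j \<Longrightarrow> lin_on (L l) (\<lambda>w. app \<mu> [(i, u), (j, v), (l, w)])"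
  shows "is_gmap L 3 k \<mu>"
proof -
  have "app \<mu> vs \<in> L (tdeg vs + k) \<and> (\<forall>m<3. lin_on (L (fst (vs ! m))) (\<lambda>u. app \<mu> (vs[m := (fst (vs ! m), u)])))"
    if hom: "homogeneous L 3 vs" for vs
  proof -
    obtain i u j v l w where vs: "vs = [(i, u), (j, v), (l, w)]" "u \<in> L i" "v \<in> L j" "w \<in> L l"
      using homogeneous_3D[OF hom] by blast
    have "lin_on (L (fst (vs ! m))) (\<lambda>u. app \<mu> (vs[m := (fst (vs ! m), u)]))" if "m < 3" for m
    proof -
      from that consider "m = 0" | "m = 1" | "m = 2" by linarith
      then show ?thesis by cases (use assms vs in \<open>auto simp: numeral_2_eq_2\<close>)
    qed
    then show ?thesis using assms(3)[OF vs(2-4)] by (simp add: vs(1) tdeg_def add.assoc)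
  qed
  then show ?thesis using assms(1,2) by (simp add: is_gmap_def)
qed

lemma is_gmap_zero: "(\<And>i. subspace (L i)) \<Longrightarrow> is_gmap L n k (GMap n k 0)"
  by (auto simp: is_gmap_def lin_on_def subspace_0)

lemma lin_on_cong: "lin_on V G \<Longrightarrow> subspace V \<Longrightarrow> (\<And>u. u \<in> V \<Longrightarrow> F u = G u) \<Longrightarrow> lin_on V F"
  by (auto simp: lin_on_def subspace_add subspace_scale)

lemma lin_on_Pair: "lin_on V F \<Longrightarrow> lin_on V G \<Longrightarrow> lin_on V (\<lambda>u. (F u, G u))"
  by (auto simp: lin_on_def)

lemma lin_on_fst: "lin_on W F \<Longrightarrow> (\<And>u. u \<in> V \<Longrightarrow> fst u \<in> W) \<Longrightarrow> lin_on V (\<lambda>u. F (fst u))"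
  and lin_on_snd: "lin_on W' F' \<Longrightarrow> (\<And>u. u \<in> V \<Longrightarrow> snd u \<in> W') \<Longrightarrow> lin_on V (\<lambda>u. F' (snd u))"
  by (auto simp: lin_on_def)

lemma lin_on_const_zero: "lin_on V (\<lambda>u. 0)"
  by (simp add: lin_on_def)

lemma lin_on_plus: "lin_on V F \<Longrightarrow> lin_on V G \<Longrightarrow> lin_on V (\<lambda>u. F u + G u)"
  by (auto simp: lin_on_def scaleR_right_distrib)

context clwx_on_manifold
begin

section \<open>The graded space, its operations and the first Leibniz identities\<close>

abbreviation "L \<equiv> assoc_space E"

text \<open>A description uniform in the degree: in degree 2 the section component is confined to
  \<open>\<Gamma> 2\<close>, which is zero. It spares the case distinction of
  \<open>assoc_space\<close>.\<close>

lemma assoc_iff: "v \<in> L i \<longleftrightarrow> fst v \<in> \<Gamma> i \<and> snd v \<in> C \<and> (i \<noteq> 2 \<longrightarrow> snd v = 0)"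
  using Gamma_other[of i] by (cases v) (auto simp: assoc_space_def zero_prod_def)

lemma assocD:
  assumes "v \<in> L i"
  shows "fst v \<in> \<Gamma> i" "snd v \<in> C" "fst v \<in> T" "bd (fst v) \<in> T"
  using assms Gamma_subset_T[OF bd_Gamma] by (auto simp: assoc_iff)

lemma assoc_subspace: "subspace (L i)"
  by (auto simp: subspace_def assoc_iff)

lemma arity_degree [simp]:
  "arity (lambda2 E) = 2" "degree (lambda2 E) = 0" "arity (assoc_d E) = 1" "degree (assoc_d E) = - 1"
  "arity (S_map E) = 2" "degree (S_map E) = 1" "arity (Omega_map E) = 3" "degree (Omega_map E) = 1"
  by (simp_all add: lambda2_def assoc_d_def S_map_def Omega_map_def)

lemma app_d [simp]: "app (assoc_d E) [(i, u)] = (bd (fst u) + D (snd u), 0)"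
  and app_S [simp]: "app (S_map E) [(i, u), (j, v)] = (0, S (fst u) (fst v))"
  and app_Omega [simp]: "app (Omega_map E) [(i, u), (j, v), (k, w)] = (Omega E (fst u) (fst v) (fst w), 0)"
  by (simp_all add: assoc_d_def S_map_def Omega_map_def)

text \<open>Composing with \<open>D_map\<close>, of degree -1, creates a sign depending on the
  degree of \<open>u\<close>. It disappears because the anchor vanishes unless that degree is
  0.\<close>

lemma app_lambda2:
  assumes "fst u \<in> \<Gamma> i" "snd v \<in> C"
  shows "app (lambda2 E) [(i, u), (j, v)] = (circ E (fst u) (fst v), \<rho> (fst u) (snd v))"
proof -
  have "sign_pow (- i) *\<^sub>R S (fst u) (D (snd v)) = \<rho> (fst u) (snd v)"
    using S_D[OF assms(2), of "fst u"] rho_E1[OF assms(1) _ assms(2)] assms(1) by (cases "i = 0") auto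
  then show ?thesis
    by (simp add: lambda2_def circ_map_def S_map_def D_map_def pcomp_def Let_def)
qed

text \<open>Free of degrees, as \<open>ext0_pcomp\<close> requires.\<close>

lemma fst_app_lambda2: "length vs = 2 \<Longrightarrow> fst (app (lambda2 E) vs) = circ E (fst (snd (vs ! 0))) (fst (snd (vs ! 1)))"
  by (simp add: lambda2_def circ_map_def S_map_def D_map_def pcomp_def Let_def)

lemma d_in: "u \<in> L i \<Longrightarrow> bd (fst u) + D (snd u) \<in> \<Gamma> (i - 1)"
  using bd_Gamma[of "fst u" i] by (cases "i = 2") (auto simp: assoc_iff)

lemma rho_degree: "u \<in> L i \<Longrightarrow> v \<in> L j \<Longrightarrow> \<not> (i = 0 \<and> j = 2) \<Longrightarrow> \<rho> (fst u) (snd v) = 0"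
  using rho_E1[of "fst u" i "snd v"] rho_zero(2)[of "fst u"] by (cases "j = 2") (auto simp: assoc_iff)

lemma three_term: "three_term_complex L (assoc_d E)"
  unfolding three_term_complex_def
proof (intro conjI allI impI)
  show "subspace (L i)" for i by (rule assoc_subspace)
  show "L i = {0}" if "i \<notin> {0, 1, 2}" for i using that by (simp add: assoc_space_def)
  show "is_gmap L 1 (- 1) (assoc_d E)"
  proof (rule is_gmap_1I)
    show "app (assoc_d E) [(i, u)] \<in> L (i + - 1)" if "u \<in> L i" for i u
      using d_in[OF that] by (auto simp: assoc_iff)
    show "lin_on (L i) (\<lambda>u. app (assoc_d E) [(i, u)])" for i
      by (simp, intro lin_on_Pair lin_on_plus lin_on_const_zero lin_on_fst[OF bd_lin] lin_on_snd[OF D_lin])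
        (auto dest: assocD)
  qed auto
  show "eq_on L 1 (assoc_d E \<odot>\<^bsub>1\<^esub> assoc_d E) 0"
  proof (rule eq_on_1I)
    fix i u assume u: "u \<in> L i"
    have "bd (bd (fst u)) = 0"
      using bd_E0[OF bd_E1, of "fst u"] bd_E0[of "fst u" i] assocD(1)[OF u] by (cases "i = 1") auto
    then show "(assoc_d E \<odot>\<^bsub>1\<^esub> assoc_d E) [(i, u)] = 0 [(i, u)]"
      using assocD[OF u] by (simp add: pcomp_def Let_def lin_on_add[OF bd_lin] bd_D zero_prod_def)
  qed
qed

lemma lambda2_gmap: "is_gmap L 2 0 (lambda2 E)"
proof (rule is_gmap_2I)
  fix i u j v assume u: "u \<in> L i" and v: "v \<in> L j"
  show "app (lambda2 E) [(i, u), (j, v)] \<in> L (i + j + 0)"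
    using assocD[OF u] assocD[OF v] circ_Gamma[of "fst u" i "fst v" j] rho_degree[OF u v]
    by (auto simp: app_lambda2 assoc_iff)
next
  fix i j v assume v: "v \<in> L j"
  show "lin_on (L i) (\<lambda>u. app (lambda2 E) [(i, u), (j, v)])"
    by (rule lin_on_cong[OF lin_on_Pair[OF lin_on_fst[OF circ_lin_left[OF assocD(3)[OF v]]] lin_on_fst[OF rho_lin[OF assocD(2)[OF v]]]] assoc_subspace])
      (use assocD[OF v] in \<open>auto simp: app_lambda2 dest: assocD\<close>)
next
  fix i j u assume u: "u \<in> L i"
  show "lin_on (L j) (\<lambda>v. app (lambda2 E) [(i, u), (j, v)])"
    by (rule lin_on_cong[OF lin_on_Pair[OF lin_on_fst[OF circ_lin_right[OF assocD(3)[OF u]]] lin_on_snd[OF rho_lin_fun[OF assocD(3)[OF u]]]] assoc_subspace])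
      (use assocD[OF u] in \<open>auto simp: app_lambda2 dest: assocD\<close>)
qed auto

lemma S_gmap: "is_gmap L 2 1 (S_map E)"
proof (rule is_gmap_2I)
  fix i u j v assume u: "u \<in> L i" and v: "v \<in> L j"
  show "app (S_map E) [(i, u), (j, v)] \<in> L (i + j + 1)"
    using assocD[OF u] assocD[OF v] S_degree[of "fst u" i "fst v" j] by (auto simp: assoc_iff)
next
  fix i j v assume v: "v \<in> L j"
  show "lin_on (L i) (\<lambda>u. app (S_map E) [(i, u), (j, v)])"
    by (simp, rule lin_on_Pair[OF lin_on_const_zero lin_on_fst[OF S_lin_left]]) (use v in \<open>auto dest: assocD\<close>)
next
  fix i j u assume u: "u \<in> L i"
  show "lin_on (L j) (\<lambda>v. app (S_map E) [(i, u), (j, v)])"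
    by (simp, rule lin_on_Pair[OF lin_on_const_zero lin_on_fst[OF S_lin_right]]) (use u in \<open>auto dest: assocD\<close>)
qed auto

lemma Omega_gmap: "is_gmap L 3 1 (Omega_map E)"
proof (rule is_gmap_3I)
  fix i u j v l w assume m: "u \<in> L i" "v \<in> L j" "w \<in> L l"
  show "app (Omega_map E) [(i, u), (j, v), (l, w)] \<in> L (i + j + l + 1)"
    using Omega_Gamma[of "fst u" i "fst v" j "fst w" l] m[THEN assocD(1)] by (auto simp: assoc_iff)
next
  fix i j v l w assume m: "v \<in> L j" "w \<in> L l"
  show "lin_on (L i) (\<lambda>u. app (Omega_map E) [(i, u), (j, v), (l, w)])"
    by (simp, rule lin_on_Pair[OF lin_on_fst[OF Omega_lin(1)] lin_on_const_zero]) (use m in \<open>auto dest: assocD\<close>)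
next
  fix i j u l w assume m: "u \<in> L i" "w \<in> L l"
  show "lin_on (L j) (\<lambda>v. app (Omega_map E) [(i, u), (j, v), (l, w)])"
    by (simp, rule lin_on_Pair[OF lin_on_fst[OF Omega_lin(2)] lin_on_const_zero]) (use m in \<open>auto dest: assocD\<close>)
next
  fix i j u l v assume m: "u \<in> L i" "v \<in> L j"
  show "lin_on (L l) (\<lambda>w. app (Omega_map E) [(i, u), (j, v), (l, w)])"
    by (simp, rule lin_on_Pair[OF lin_on_fst[OF Omega_lin(3)] lin_on_const_zero]) (use m in \<open>auto dest: assocD\<close>)
qed auto

text \<open>Beyond the chain rule for \<open>circ\<close>, what remains are facts 1 to 3: the anchor
  kills boundaries, \<open>D\<close> intertwines the anchor with left multiplication, and left
  multiplication by \<open>D f\<close> is zero.\<close>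

lemma lambda2_chain: "eq_on L 2 (bdry (assoc_d E) (lambda2 E)) 0"
proof (rule eq_on_2I)
  fix i u j v assume u: "u \<in> L i" and v: "v \<in> L j"
  define a f b g where ab: "a = fst u" "f = snd u" "b = fst v" "g = snd v"
  have m: "a \<in> \<Gamma> i" "f \<in> C" "b \<in> \<Gamma> j" "g \<in> C" "a \<in> T" "b \<in> T" "bd a \<in> T" "bd b \<in> T"
    using assocD[OF u] assocD[OF v] by (simp_all add: ab)
  have 1: "\<rho> (bd a + D f) g = 0"
    using m rho_bd[OF m(1,4)] rho_E1[OF D_Gamma[OF m(2)] _ m(4)] by (simp add: lin_on_add[OF rho_lin])
  have 2: "D (\<rho> a g) = sign_pow i *\<^sub>R circ E a (D g)"
  proof -
    consider "i = 0" | "i = 1" | "a = 0" using m(1) Gamma_other[of i] by blast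
    then show ?thesis
    proof cases
      case 2
      then show ?thesis using circ_Gamma[OF m(1) D_Gamma[OF m(4)]] Gamma_other[of 2] rho_E1[OF m(1) _ m(4)] by auto
    qed (use D_rho[of a g] m rho_zero circ_zero in auto)
  qed
  have 3: "circ E (D f) b = 0" by (rule circ_D[OF m(3,2)])
  have d: "bd a + D f \<in> \<Gamma> (i - 1)" "bd b + D g \<in> T" using d_in[OF u] d_in[OF v] by (auto simp: ab)
  have l1: "app (lambda2 E) [(i - 1, (bd a + D f, 0)), (j, v)] = (circ E (bd a + D f) b, \<rho> (bd a + D f) g)"
    and l2: "app (lambda2 E) [(i, u), (j - 1, (bd b + D g, 0))] = (circ E a (bd b + D g), \<rho> a 0)"
    and l3: "app (lambda2 E) [(i, u), (j, v)] = (circ E a b, \<rho> a g)"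
    using d m app_lambda2[of "(bd a + D f, 0)" "i - 1" v j] app_lambda2[of u i "(bd b + D g, 0)" "j - 1"]
      app_lambda2[of u i v j] by (simp_all add: ab)
  have c: "circ E (bd a + D f) b = circ E (bd a) b" "circ E a (bd b + D g) = circ E a (bd b) + circ E a (D g)"
    using m 3 by (simp_all add: lin_on_add[OF circ_lin_left] lin_on_add[OF circ_lin_right])
  show "bdry (assoc_d E) (lambda2 E) [(i, u), (j, v)] = 0 [(i, u), (j, v)]"
    using m by (simp add: bdry_2 pcomp_def Let_def l1[unfolded ab] l2[unfolded ab] l3[unfolded ab]
        c[unfolded ab] 1[unfolded ab] 2[unfolded ab] rho_zero circ_chain[OF m(1,3), unfolded ab] scaleR_right_distrib
        zero_prod_def ab)
qed

text \<open>\<open>Omega\<close> vanishes on the degree 1 sections \<open>D f\<close>, so the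
  section component is \<open>jacobi_general\<close>. The function component says that the anchor
  takes products to commutators, which is \<open>rho_circ\<close> in degree 0.\<close>

lemma lambda2_jacobi:
  "eq_on L 3 (bdry (assoc_d E) (Omega_map E))
    ((lambda2 E \<odot>\<^bsub>2\<^esub> lambda2 E) - (lambda2 E \<odot>\<^bsub>1\<^esub> lambda2 E) - perm (cyc [1,2]) (lambda2 E \<odot>\<^bsub>2\<^esub> lambda2 E))"
proof (rule eq_on_3I)
  fix i u j v k w assume u: "u \<in> L i" and v: "v \<in> L j" and w: "w \<in> L k"
  define a f b g c h where ab: "a = fst u" "f = snd u" "b = fst v" "g = snd v" "c = fst w" "h = snd w"
  have m: "a \<in> \<Gamma> i" "b \<in> \<Gamma> j" "c \<in> \<Gamma> k" "f \<in> C" "g \<in> C" "h \<in> C"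
    "a \<in> T" "b \<in> T" "c \<in> T" "bd a \<in> T" "bd b \<in> T" "bd c \<in> T"
    using assocD[OF u] assocD[OF v] assocD[OF w] by (simp_all add: ab)
  have O1: "Omega E (bd a + D f) b c = Omega E (bd a) b c"
    using lin_on_add[OF Omega_lin(1)] Omega_degree[OF D_Gamma[OF m(4)] m(2,3)] m by simp
  have O2: "Omega E a (bd b + D g) c = Omega E a (bd b) c"
    using lin_on_add[OF Omega_lin(2)] Omega_degree[OF m(1) D_Gamma[OF m(5)] m(3)] m by simp
  have O3: "Omega E a b (bd c + D h) = Omega E a b (bd c)"
    using lin_on_add[OF Omega_lin(3)] Omega_degree[OF m(1,2) D_Gamma[OF m(6)]] m by simp
  have rho: "\<rho> a (\<rho> b h) - \<rho> (circ E a b) h - sign_pow (i * j) *\<^sub>R \<rho> b (\<rho> a h) = 0"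
  proof -
    consider "i = 0" "j = 0" | "a = 0" | "b = 0" | "i = 1" "j = 0" | "i = 0" "j = 1" | "i = 1" "j = 1"
      using m(1,2) Gamma_other[of i] Gamma_other[of j] by blast
    then show ?thesis
    proof cases
      case 1
      then show ?thesis using rho_circ[of a b h] m by simp
    qed (use m circ_Gamma[OF m(1,2)] rho_E1[of "circ E a b" "i + j" h] rho_E1[of a i] rho_E1[of b j]
        in \<open>auto simp: rho_zero circ_zero\<close>)
  qed
  have l: "app (lambda2 E) [(p, x), (q, y)] = (circ E (fst x) (fst y), \<rho> (fst x) (snd y))"
    if "fst x \<in> \<Gamma> p" "snd y \<in> C" for p x q y using app_lambda2[OF that] .
  have cab: "circ E a b \<in> \<Gamma> (i + j)" by (rule circ_Gamma[OF m(1,2)])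
  have "bdry (assoc_d E) (Omega_map E) [(i, u), (j, v), (k, w)] =
      (bd (Omega E a b c) + (Omega E (bd a) b c + sign_pow i *\<^sub>R Omega E a (bd b) c
      + sign_pow (i + j) *\<^sub>R Omega E a b (bd c)), 0)"
    unfolding bdry_3[OF arity_degree(7)]
    using sign_pow_minus[of "i + j"]
    by (simp add: pcomp_def Let_def O1[unfolded ab] O2[unfolded ab] O3[unfolded ab] ab)
  also have "\<dots> = (circ E a (circ E b c) - circ E (circ E a b) c - sign_pow (i * j) *\<^sub>R circ E b (circ E a c),
      \<rho> a (\<rho> b h) - \<rho> (circ E a b) h - sign_pow (i * j) *\<^sub>R \<rho> b (\<rho> a h))"
    using jacobi_general[OF m(1-3)] rho by simp
  also have "\<dots> = ((lambda2 E \<odot>\<^bsub>2\<^esub> lambda2 E) - (lambda2 E \<odot>\<^bsub>1\<^esub> lambda2 E) -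
      perm (cyc [1,2]) (lambda2 E \<odot>\<^bsub>2\<^esub> lambda2 E)) [(i, u), (j, v), (k, w)]"
    unfolding minus_apply perm_12_triple
    using m cab by (simp add: pcomp_def Let_def l ab fun_eq_iff)
  finally show "bdry (assoc_d E) (Omega_map E) [(i, u), (j, v), (k, w)] =
      ((lambda2 E \<odot>\<^bsub>2\<^esub> lambda2 E) - (lambda2 E \<odot>\<^bsub>1\<^esub> lambda2 E) -
      perm (cyc [1,2]) (lambda2 E \<odot>\<^bsub>2\<^esub> lambda2 E)) [(i, u), (j, v), (k, w)]" .
qed

section \<open>Transfer of the higher Leibniz identities from sections\<close>

lemma homogeneous_fst_tuple: "homogeneous L n vs \<Longrightarrow> homogeneous \<Gamma> n (fst_tuple vs)"
  by (auto simp: homogeneous_def fst_tuple_def dest: assocD(1))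

lemma ext0_Omega_pcomp:
  assumes "1 \<le> i" "i \<le> 3"
  shows "ext0 L 4 (Omega_map E \<odot>\<^bsub>i\<^esub> lambda2 E) (Omega_sec \<odot>\<^bsub>i\<^esub> circ_sec)"
    and "ext0 L 5 (Omega_map E \<odot>\<^bsub>i\<^esub> Omega_map E) (Omega_sec \<odot>\<^bsub>i\<^esub> Omega_sec)"
  by (rule ext0_pcomp[where n = 3]; use assms in \<open>simp add: Omega_map_def fst_app_lambda2\<close>)+

text \<open>Because of its term \<rho>(u) g, \<open>lambda2\<close> itself does not extend
  \<open>circ\<close> by zero. Its composites with \<nu> do: in the first slot if the anchor kills
  the values of \<nu>, in the second since these values have no function component.\<close>

lemma ext0_lambda2_pcomp:
  assumes gm: "is_gmap L m d \<nu>" and ar: "arity \<nu>' = m" "degree \<nu>' = d"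
    and \<nu>: "\<And>vs. homogeneous L m vs \<Longrightarrow> app \<nu> vs = (app \<nu>' (fst_tuple vs), 0)"
    and rho: "\<And>vs f. homogeneous L m vs \<Longrightarrow> f \<in> C \<Longrightarrow> \<rho> (app \<nu>' (fst_tuple vs)) f = 0"
  shows "ext0 L (Suc m) (lambda2 E \<odot>\<^bsub>1\<^esub> \<nu>) (circ_sec \<odot>\<^bsub>1\<^esub> \<nu>')"
    and "ext0 L (Suc m) (lambda2 E \<odot>\<^bsub>2\<^esub> \<nu>) (circ_sec \<odot>\<^bsub>2\<^esub> \<nu>')"
proof -
  have n: "arity \<nu> = m" "degree \<nu> = d" using gm by (simp_all add: is_gmap_def)
  have mem: "fst (app \<nu> vs) \<in> \<Gamma> (tdeg vs + d)" if "homogeneous L m vs" for vs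
    using gm that assocD(1) unfolding is_gmap_def by blast
  show "ext0 L (Suc m) (lambda2 E \<odot>\<^bsub>1\<^esub> \<nu>) (circ_sec \<odot>\<^bsub>1\<^esub> \<nu>')"
    unfolding ext0_def
  proof (intro allI impI)
    fix vs assume hom: "homogeneous L (Suc m) vs"
    then have "length vs = m + 1" by (simp add: homogeneous_def)
    then obtain ws j v where vs: "vs = ws @ [(j, v)]" "length ws = m"
      by (metis add_diff_cancel_right' append_butlast_last_id length_0_conv length_butlast nat.simps(3) old.prod.exhaust Suc_eq_plus1)
    have h: "homogeneous L m ws" "v \<in> L j" using hom vs by (auto simp: homogeneous_def)
    have "app (lambda2 E) [(tdeg ws + d, app \<nu> ws), (j, v)] = (circ E (app \<nu>' (fst_tuple ws)) (fst v), 0)"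
      using app_lambda2[of "app \<nu> ws" "tdeg ws + d" v j] mem[OF h(1)] assocD(2)[OF h(2)] \<nu>[OF h(1)] rho[OF h(1)]
      by simp
    then show "(lambda2 E \<odot>\<^bsub>1\<^esub> \<nu>) vs = ((circ_sec \<odot>\<^bsub>1\<^esub> \<nu>') (fst_tuple vs), 0)"
      using vs n ar by (simp add: pcomp_def Let_def)
  qed
  show "ext0 L (Suc m) (lambda2 E \<odot>\<^bsub>2\<^esub> \<nu>) (circ_sec \<odot>\<^bsub>2\<^esub> \<nu>')"
    unfolding ext0_def
  proof (intro allI impI)
    fix vs assume hom: "homogeneous L (Suc m) vs"
    then obtain i u ws where vs: "vs = (i, u) # ws" "length ws = m"
      by (auto simp: homogeneous_def length_Suc_conv)
    have h: "homogeneous L m ws" "u \<in> L i" using hom vs by (auto simp: homogeneous_def)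
    have "app (lambda2 E) [(i, u), (tdeg ws + d, app \<nu> ws)] = (circ E (fst u) (app \<nu>' (fst_tuple ws)), 0)"
      using app_lambda2[of u i "app \<nu> ws" "tdeg ws + d"] assocD[OF h(2)] \<nu>[OF h(1)] rho_zero(2)
      by simp
    then show "(lambda2 E \<odot>\<^bsub>2\<^esub> \<nu>) vs = ((circ_sec \<odot>\<^bsub>2\<^esub> \<nu>') (fst_tuple vs), 0)"
      using vs n ar by (simp add: pcomp_def Let_def)
  qed
qed

lemma ext0_lambda2_Omega:
  "ext0 L 4 (lambda2 E \<odot>\<^bsub>1\<^esub> Omega_map E) (circ_sec \<odot>\<^bsub>1\<^esub> Omega_sec)"
  "ext0 L 4 (lambda2 E \<odot>\<^bsub>2\<^esub> Omega_map E) (circ_sec \<odot>\<^bsub>2\<^esub> Omega_sec)"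
proof -
  \<comment> \<open>Values of \<open>Omega\<close> have degree 1, where the anchor is zero.\<close>
  have r: "\<rho> (app Omega_sec (fst_tuple vs)) f = 0" if h: "homogeneous L 3 vs" and f: "f \<in> C" for vs f
  proof -
    obtain i u j v k w where "vs = [(i, u), (j, v), (k, w)]" "u \<in> L i" "v \<in> L j" "w \<in> L k"
      using homogeneous_3D[OF h] by blast
    then show ?thesis
      using rho_E1[OF Omega_Gamma1[of "fst u" i "fst v" j "fst w" k] _ f] by (simp add: assocD(1))
  qed
  have o: "app (Omega_map E) vs = (app Omega_sec (fst_tuple vs), 0)" if "homogeneous L 3 vs" for vs
    using that by (simp add: Omega_map_def homogeneous_def)
  show "ext0 L 4 (lambda2 E \<odot>\<^bsub>1\<^esub> Omega_map E) (circ_sec \<odot>\<^bsub>1\<^esub> Omega_sec)"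
    "ext0 L 4 (lambda2 E \<odot>\<^bsub>2\<^esub> Omega_map E) (circ_sec \<odot>\<^bsub>2\<^esub> Omega_sec)"
    using ext0_lambda2_pcomp[OF Omega_gmap _ _ o r] by simp_all
qed

lemma ext0_lambda2_zero:
  "ext0 L 5 (lambda2 E \<odot>\<^bsub>1\<^esub> GMap 4 2 0) (circ_sec \<odot>\<^bsub>1\<^esub> GMap 4 2 0)"
  "ext0 L 5 (lambda2 E \<odot>\<^bsub>2\<^esub> GMap 4 2 0) (circ_sec \<odot>\<^bsub>2\<^esub> GMap 4 2 0)"
  using ext0_lambda2_pcomp[OF is_gmap_zero[of L 4 2, OF assoc_subspace], of "GMap 4 2 0"]
  by (simp_all add: rho_zero zero_prod_def)

lemma leibniz_assoc: "leibniz_3_algebra L (assoc_d E) (lambda2 E) (Omega_map E) (GMap 4 2 0)"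
  unfolding leibniz_3_algebra_def
proof (intro conjI three_term lambda2_gmap Omega_gmap is_gmap_zero assoc_subspace lambda2_chain lambda2_jacobi)
  have bz: "ext0 L 4 (bdry (assoc_d E) (GMap 4 2 0)) (bdry bd_map (GMap 4 2 0))"
    using bdry_zero[of "assoc_d E"] bdry_zero[of bd_map] by (simp add: ext0_def homogeneous_def zero_prod_def)
  have p: "cyc [1,2] permutes {1..4}" "cyc [2,3] permutes {1..4}" "cyc [1,2,3] permutes {1..4}"
    "cyc [1,3,2] permutes {1..4}" by (intro cyc_permutes; simp)+
  show "eq_on L 4 (bdry (assoc_d E) (GMap 4 2 0))
      ((lambda2 E \<odot>\<^bsub>1\<^esub> Omega_map E) + (lambda2 E \<odot>\<^bsub>2\<^esub> Omega_map E)
       - perm (cyc [1,2]) (lambda2 E \<odot>\<^bsub>2\<^esub> Omega_map E) + perm (cyc [1,2,3]) (lambda2 E \<odot>\<^bsub>2\<^esub> Omega_map E)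
       - (Omega_map E \<odot>\<^bsub>1\<^esub> lambda2 E) + (Omega_map E \<odot>\<^bsub>2\<^esub> lambda2 E) - perm (cyc [1,2]) (Omega_map E \<odot>\<^bsub>2\<^esub> lambda2 E)
       - (Omega_map E \<odot>\<^bsub>3\<^esub> lambda2 E) + perm (cyc [2,3]) (Omega_map E \<odot>\<^bsub>3\<^esub> lambda2 E)
       - perm (cyc [1,3,2]) (Omega_map E \<odot>\<^bsub>3\<^esub> lambda2 E))"
    by (rule eq_on_ext0[OF leibniz_4 bz _ homogeneous_fst_tuple])
      (intro ext0_add ext0_diff ext0_perm ext0_lambda2_Omega ext0_Omega_pcomp p; simp)
  have z: "GMap 4 2 0 \<odot>\<^bsub>i\<^esub> circ_sec = 0" "GMap 4 2 0 \<odot>\<^bsub>i\<^esub> lambda2 E = 0" for i by simp_all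
  have q: "cyc [1,2] permutes {1..5}" "cyc [2,3] permutes {1..5}" "cyc [1,2,3] permutes {1..5}"
    "cyc [1,3,2] permutes {1..5}" "cyc [1,2,3,4] permutes {1..5}" "cyc [2,3,4] permutes {1..5}"
    "cyc [1,3,4,2] permutes {1..5}" "cyc [3,4] permutes {1..5}" "cyc [2,4,3] permutes {1..5}"
    "cyc [1,4,3,2] permutes {1..5}" "cyc [1,3] permutes {1..5}" "cyc [2,4] permutes {1..5}"
    by (intro cyc_permutes; simp)+
  note q' = permutes_compose[OF q(12,11)]
  show "eq_on L 5 0
      ((lambda2 E \<odot>\<^bsub>1\<^esub> GMap 4 2 0) - (lambda2 E \<odot>\<^bsub>2\<^esub> GMap 4 2 0)
       + perm (cyc [1,2]) (lambda2 E \<odot>\<^bsub>2\<^esub> GMap 4 2 0) - perm (cyc [1,2,3]) (lambda2 E \<odot>\<^bsub>2\<^esub> GMap 4 2 0)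
       + perm (cyc [1,2,3,4]) (lambda2 E \<odot>\<^bsub>2\<^esub> GMap 4 2 0)
       + (Omega_map E \<odot>\<^bsub>1\<^esub> Omega_map E)
       + (Omega_map E \<odot>\<^bsub>2\<^esub> Omega_map E) - perm (cyc [1,2]) (Omega_map E \<odot>\<^bsub>2\<^esub> Omega_map E)
       + perm (cyc [1,2,3]) (Omega_map E \<odot>\<^bsub>2\<^esub> Omega_map E)
       + (Omega_map E \<odot>\<^bsub>3\<^esub> Omega_map E) - perm (cyc [2,3]) (Omega_map E \<odot>\<^bsub>3\<^esub> Omega_map E)
       + perm (cyc [1,3,2]) (Omega_map E \<odot>\<^bsub>3\<^esub> Omega_map E)
       + perm (cyc [2,3,4]) (Omega_map E \<odot>\<^bsub>3\<^esub> Omega_map E) - perm (cyc [1,3,4,2]) (Omega_map E \<odot>\<^bsub>3\<^esub> Omega_map E)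
       + perm (cyc [1,3] \<circ> cyc [2,4]) (Omega_map E \<odot>\<^bsub>3\<^esub> Omega_map E)
       + (GMap 4 2 0 \<odot>\<^bsub>1\<^esub> lambda2 E)
       - (GMap 4 2 0 \<odot>\<^bsub>2\<^esub> lambda2 E) + perm (cyc [1,2]) (GMap 4 2 0 \<odot>\<^bsub>2\<^esub> lambda2 E)
       + (GMap 4 2 0 \<odot>\<^bsub>3\<^esub> lambda2 E) - perm (cyc [2,3]) (GMap 4 2 0 \<odot>\<^bsub>3\<^esub> lambda2 E)
       + perm (cyc [1,3,2]) (GMap 4 2 0 \<odot>\<^bsub>3\<^esub> lambda2 E)
       - (GMap 4 2 0 \<odot>\<^bsub>4\<^esub> lambda2 E) + perm (cyc [3,4]) (GMap 4 2 0 \<odot>\<^bsub>4\<^esub> lambda2 E)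
       - perm (cyc [2,4,3]) (GMap 4 2 0 \<odot>\<^bsub>4\<^esub> lambda2 E) + perm (cyc [1,4,3,2]) (GMap 4 2 0 \<odot>\<^bsub>4\<^esub> lambda2 E))"
    unfolding z
    by (rule eq_on_ext0[OF leibniz_5[unfolded z] ext0_zero _ homogeneous_fst_tuple])
      (intro ext0_add ext0_diff ext0_perm ext0_lambda2_zero ext0_Omega_pcomp ext0_zero q q'; simp)
qed

text \<open>The section component is axiom (iii), polarised. In the function component the terms
  with \<open>bd\<close> cancel by axiom (iv), and those with \<open>D\<close> give the anchor terms
  of \<open>lambda2\<close> and of its transpose.\<close>

lemma S_boundary: "eq_on L 2 (bdry (assoc_d E) (S_map E)) (app (lambda2 E) + perm (cyc [1,2]) (app (lambda2 E)))"
proof (rule eq_on_2I)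
  fix i u j v assume u: "u \<in> L i" and v: "v \<in> L j"
  define a f b g where ab: "a = fst u" "f = snd u" "b = fst v" "g = snd v"
  have m: "a \<in> \<Gamma> i" "f \<in> C" "b \<in> \<Gamma> j" "g \<in> C" "a \<in> T" "b \<in> T" "bd a \<in> T" "bd b \<in> T"
    using assocD[OF u] assocD[OF v] by (simp_all add: ab)
  have 1: "D (S a b) = circ E a b + sign_pow (i * j) *\<^sub>R circ E b a"
  proof -
    \<comment> \<open>For nonzero sections the sign can be negative only if both degrees are 1, and
      then S(a, b) and both products vanish.\<close>
    consider "a = 0" | "b = 0" | "i = 1" "j = 1" | "even (i * j)"
      using m(1,3) Gamma_other[of i] Gamma_other[of j] by fastforce
    then show ?thesis
    proof cases
      case 3
      then show ?thesis
        using circ_Gamma[OF m(1,3)] circ_Gamma[OF m(3,1)] Gamma_other[of 2] S_degree[OF m(1,3)] by simp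
    qed (use circ_polarized[of a b] m in \<open>auto simp: circ_zero sign_pow_def\<close>)
  qed
  have 2: "S (bd a) b + sign_pow i *\<^sub>R S a (bd b) = 0"
  proof -
    consider "a = 0" | "i = 1" | "bd a = 0" using m(1) Gamma_other[of i] bd_E0[OF m(1)] by fastforce
    then show ?thesis
      by cases (use S_bnd[OF m(5,6)] m in auto)
  qed
  have 3: "sign_pow i *\<^sub>R S a (D g) = \<rho> a g"
    using S_D[OF m(4,5)] rho_E1[OF m(1) _ m(4)] by (cases "i = 0") auto
  have 4: "S (D f) b = sign_pow (i * j) *\<^sub>R \<rho> b f"
    using S_D[OF m(2,6)] S_commute[of "D f" b] rho_E1[OF m(3) _ m(2)] m by (cases "j = 0") auto
  have "bdry (assoc_d E) (S_map E) [(i, u), (j, v)] =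
      (D (S a b), S (bd a + D f) b + sign_pow i *\<^sub>R S a (bd b + D g))"
    unfolding bdry_2[OF arity_degree(5)] by (simp add: pcomp_def Let_def ab)
  also have "S (bd a + D f) b + sign_pow i *\<^sub>R S a (bd b + D g) =
      (S (bd a) b + sign_pow i *\<^sub>R S a (bd b)) + (S (D f) b + sign_pow i *\<^sub>R S a (D g))"
    using m by (simp add: lin_on_add[OF S_lin_left] lin_on_add[OF S_lin_right] scaleR_right_distrib add_ac)
  also have "\<dots> = \<rho> a g + sign_pow (i * j) *\<^sub>R \<rho> b f"
    unfolding 2 3 4 by simp
  finally show "bdry (assoc_d E) (S_map E) [(i, u), (j, v)] =
      (app (lambda2 E) + perm (cyc [1,2]) (app (lambda2 E))) [(i, u), (j, v)]"
    unfolding plus_fun_apply perm_12_pair using m 1 by (simp add: app_lambda2 ab fun_eq_iff)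
qed

lemma weak_lie_assoc:
  "weak_lie_3_algebra L (assoc_d E) (lambda2 E) (S_map E) (Omega_map E)
    (GMap 2 2 0) (GMap 3 2 0) (GMap 3 2 0) (GMap 4 2 0)"
proof -
  \<comment> \<open>Boundaries of the zero operations vanish, so the identities for them reduce to
    statements that their right sides are zero.\<close>
  have bz: "eq_on L n (bdry (assoc_d E) (GMap n k 0)) G = eq_on L n 0 G" for n k G
    using bdry_zero[of "assoc_d E"] by (simp add: eq_on_def homogeneous_def zero_prod_def)
  have Oz: "Omega E 0 b c = 0" "Omega E b 0 c = 0" "Omega E b c 0 = 0" if "b \<in> T" "c \<in> T" for b c
    using that by (simp_all add: Omega_zero)
  have lz: "app (lambda2 E) [(t, 0), (j, v)] = 0" if "v \<in> L j" for t j v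
    using app_lambda2[of 0 t v j] assocD[OF that] by (simp add: circ_zero rho_zero zero_prod_def)
  have lz': "app (lambda2 E) [(i, u), (t, 0)] = 0" if "u \<in> L i" for t i u
    using app_lambda2[of u i 0 t] assocD[OF that] by (simp add: circ_zero rho_zero zero_prod_def)
  note lz0 = lz lz' lz[unfolded zero_prod_def] lz'[unfolded zero_prod_def]
  have skew12: "Omega E a b c + sign_pow (i * j) *\<^sub>R Omega E b a c = 0"
    if "a \<in> \<Gamma> i" "b \<in> \<Gamma> j" "c \<in> \<Gamma> k" for a b c i j k
    using Omega_degree[OF that] Omega_degree[OF that(2,1,3)] Omega_skew(1)[of a b c] that
    by (cases "i = 0 \<and> j = 0 \<and> k = 0") auto
  have skew23: "Omega E a b c + sign_pow (j * k) *\<^sub>R Omega E a c b = 0"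
    if "a \<in> \<Gamma> i" "b \<in> \<Gamma> j" "c \<in> \<Gamma> k" for a b c i j k
    using Omega_degree[OF that] Omega_degree[OF that(1,3,2)] Omega_skew(2)[of a b c] that
    by (cases "i = 0 \<and> j = 0 \<and> k = 0") auto
  show ?thesis
    unfolding weak_lie_3_algebra_def bz pcomp_zero_left perm_zero gmap.sel
  proof (intro conjI leibniz_assoc S_gmap is_gmap_zero assoc_subspace S_boundary)
    show "eq_on L 2 0 (app (S_map E) - perm (cyc [1,2]) (app (S_map E)))"
    proof (rule eq_on_2I)
      fix i u j v assume u: "u \<in> L i" and v: "v \<in> L j"
      \<comment> \<open>\<open>S\<close> is nonzero only on total degree 1, where one degree is even
        and the Koszul sign is positive.\<close>
      have "S (fst u) (fst v) = sign_pow (i * j) *\<^sub>R S (fst v) (fst u)"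
      proof (cases "i + j = 1")
        case True
        then have "even (i * j)" by presburger
        then show ?thesis using S_commute assocD(3)[OF u] assocD(3)[OF v] by (simp add: sign_pow_def)
      next
        case False
        then show ?thesis using S_degree[OF assocD(1)[OF u] assocD(1)[OF v]] S_degree[OF assocD(1)[OF v] assocD(1)[OF u]]
          by (simp add: add.commute)
      qed
      then show "0 [(i, u), (j, v)] = (app (S_map E) - perm (cyc [1,2]) (app (S_map E))) [(i, u), (j, v)]"
        unfolding minus_apply perm_12_pair by (simp add: zero_prod_def)
    qed
    \<comment> \<open>Values of \<open>S_map\<close> have zero section component, which annihilates
      the composite; skew-symmetry of \<open>Omega\<close> remains.\<close>
    show "eq_on L 3 0 (app (Omega_map E) + perm (cyc [1,2]) (app (Omega_map E)) + (lambda2 E \<odot>\<^bsub>1\<^esub> S_map E))"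
    proof (rule eq_on_3I)
      fix i u j v k w assume m: "u \<in> L i" "v \<in> L j" "w \<in> L k"
      show "0 [(i, u), (j, v), (k, w)] = (app (Omega_map E) + perm (cyc [1,2]) (app (Omega_map E))
          + (lambda2 E \<odot>\<^bsub>1\<^esub> S_map E)) [(i, u), (j, v), (k, w)]"
        unfolding plus_fun_apply perm_12_triple
        using skew12[OF m[THEN assocD(1)]] assocD[OF m(3)]
        by (simp add: pcomp_def Let_def app_lambda2 circ_zero rho_zero zero_prod_def)
    qed
    show "eq_on L 3 0 (app (Omega_map E) + perm (cyc [2,3]) (app (Omega_map E)) - (lambda2 E \<odot>\<^bsub>2\<^esub> S_map E)
        + (S_map E \<odot>\<^bsub>1\<^esub> lambda2 E) + perm (cyc [1,2]) (S_map E \<odot>\<^bsub>2\<^esub> lambda2 E))"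
    proof (rule eq_on_3I)
      fix i u j v k w assume m: "u \<in> L i" "v \<in> L j" "w \<in> L k"
      define a b c where ab: "a = fst u" "b = fst v" "c = fst w"
      have g: "a \<in> \<Gamma> i" "b \<in> \<Gamma> j" "c \<in> \<Gamma> k" "a \<in> T" "b \<in> T" "c \<in> T"
        using m[THEN assocD(1)] m[THEN assocD(3)] by (simp_all add: ab)
      \<comment> \<open>Axiom (v) with Koszul signs. For i = 0 there are none. Otherwise the anchor
        term is zero, and the sign of the second pairing could matter only in total degree 1 with i
        and j odd; then some degree lies outside 0 and 1, and the corresponding section is
        zero.\<close>
      have "S (circ E a b) c + sign_pow (i * j) *\<^sub>R S b (circ E a c) = sign_pow i *\<^sub>R \<rho> a (S b c)"
      proof (cases "i = 0")
        case True
        then show ?thesis using rho_S[OF g(4-6)] by simp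
      next
        case False
        then have r: "\<rho> a (S b c) = 0" using rho_E1[OF g(1)] g by auto
        then have s: "S (circ E a b) c + S b (circ E a c) = 0" using rho_S[OF g(4-6)] by simp
        show ?thesis
        proof (cases "i + j + k = 1 \<and> odd (i * j)")
          case False
          then show ?thesis
            using s r S_degree[OF circ_Gamma[OF g(1,2)] g(3)] S_degree[OF g(2) circ_Gamma[OF g(1,3)]]
            by (cases "i + j + k = 1") (auto simp: sign_pow_def algebra_simps)
        next
          case True
          then have "k \<noteq> 0 \<and> k \<noteq> 1 \<or> i \<noteq> 1 \<or> j \<noteq> 1" by auto
          then have "a = 0 \<or> b = 0 \<or> c = 0"
            using True g(1-3) Gamma_other[of i] Gamma_other[of j] Gamma_other[of k]
            by (metis add.right_neutral add_cancel_left_left empty_iff even_mult_iff even_zero insert_iff)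
          then show ?thesis using g circ_zero r s by auto
        qed
      qed
      moreover have "Omega E a b c + sign_pow (j * k) *\<^sub>R Omega E a c b = 0" by (rule skew23[OF g(1-3)])
      moreover have "app (lambda2 E) [(i, u), (j + k + 1, (0, S b c))] = (0, \<rho> a (S b c))"
        using app_lambda2[of u i "(0, S b c)"] g by (simp add: ab circ_zero)
      moreover have "app (lambda2 E) [(i, u), (j, v)] = (circ E a b, \<rho> a (snd v))"
        "app (lambda2 E) [(i, u), (k, w)] = (circ E a c, \<rho> a (snd w))"
        using app_lambda2[of u i v j] app_lambda2[of u i w k] g m[THEN assocD(2)] by (simp_all add: ab)
      ultimately show "0 [(i, u), (j, v), (k, w)] = (app (Omega_map E) + perm (cyc [2,3]) (app (Omega_map E))
          - (lambda2 E \<odot>\<^bsub>2\<^esub> S_map E) + (S_map E \<odot>\<^bsub>1\<^esub> lambda2 E)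
          + perm (cyc [1,2]) (S_map E \<odot>\<^bsub>2\<^esub> lambda2 E)) [(i, u), (j, v), (k, w)]"
        unfolding plus_fun_apply minus_apply perm_12_triple perm_23_triple
        by (simp add: pcomp_def Let_def zero_prod_def ab fun_eq_iff algebra_simps)
    qed
    show "eq_on L 3 (0 - 0) (lambda2 E \<odot>\<^bsub>1\<^esub> GMap 2 2 0)"
      by (rule eq_on_3I) (simp add: pcomp_def Let_def lz)
    show "eq_on L 3 (0 - 0 + 0 - 0 + 0 - 0)
      ((S_map E \<odot>\<^bsub>2\<^esub> S_map E) + (S_map E \<odot>\<^bsub>1\<^esub> S_map E) + perm (cyc [1,2]) (S_map E \<odot>\<^bsub>2\<^esub> S_map E) + 0)"
    proof (rule eq_on_3I)
      fix i u j v k w assume m: "u \<in> L i" "v \<in> L j" "w \<in> L k"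
      show "(0 - 0 + 0 - 0 + 0 - 0) [(i, u), (j, v), (k, w)] =
        ((S_map E \<odot>\<^bsub>2\<^esub> S_map E) + (S_map E \<odot>\<^bsub>1\<^esub> S_map E) + perm (cyc [1,2]) (S_map E \<odot>\<^bsub>2\<^esub> S_map E) + 0)
          [(i, u), (j, v), (k, w)]"
        unfolding plus_fun_apply perm_12_triple
        using m[THEN assocD(3)] by (simp add: pcomp_def Let_def zero_prod_def)
    qed
    show "eq_on L 3 (0 - 0) (- (lambda2 E \<odot>\<^bsub>2\<^esub> GMap 2 2 0) + 0 + 0)"
      by (rule eq_on_3I) (simp add: pcomp_def Let_def lz')
    show "eq_on L 4 (0 + 0) ((lambda2 E \<odot>\<^bsub>1\<^esub> GMap 3 2 0) - 0 + perm (cyc [1,2,3]) (lambda2 E \<odot>\<^bsub>2\<^esub> GMap 3 2 0)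
        + (Omega_map E \<odot>\<^bsub>1\<^esub> S_map E))"
    proof (rule eq_on_4I)
      fix i u j v k w l z assume m: "u \<in> L i" "v \<in> L j" "w \<in> L k" "z \<in> L l"
      show "(0 + 0) [(i, u), (j, v), (k, w), (l, z)] = ((lambda2 E \<odot>\<^bsub>1\<^esub> GMap 3 2 0) - 0
          + perm (cyc [1,2,3]) (lambda2 E \<odot>\<^bsub>2\<^esub> GMap 3 2 0) + (Omega_map E \<odot>\<^bsub>1\<^esub> S_map E)) [(i, u), (j, v), (k, w), (l, z)]"
        unfolding plus_fun_apply perm_123_quad
        using m m[THEN assocD(3)] by (simp add: pcomp_def Let_def lz0 Oz zero_prod_def)
    qed
    show "eq_on L 4 (0 + 0) ((lambda2 E \<odot>\<^bsub>1\<^esub> GMap 3 2 0) - (Omega_map E \<odot>\<^bsub>2\<^esub> S_map E)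
        + (lambda2 E \<odot>\<^bsub>2\<^esub> GMap 3 2 0) - 0 - 0 - 0)"
    proof (rule eq_on_4I)
      fix i u j v k w l z assume m: "u \<in> L i" "v \<in> L j" "w \<in> L k" "z \<in> L l"
      show "(0 + 0) [(i, u), (j, v), (k, w), (l, z)] = ((lambda2 E \<odot>\<^bsub>1\<^esub> GMap 3 2 0) - (Omega_map E \<odot>\<^bsub>2\<^esub> S_map E)
          + (lambda2 E \<odot>\<^bsub>2\<^esub> GMap 3 2 0) - 0 - 0 - 0) [(i, u), (j, v), (k, w), (l, z)]"
        using m m[THEN assocD(3)] by (simp add: pcomp_def Let_def lz0 Oz zero_prod_def)
    qed
    show "eq_on L 4 (0 + 0)
      ((S_map E \<odot>\<^bsub>1\<^esub> Omega_map E) - 0 + 0 - 0 + (Omega_map E \<odot>\<^bsub>3\<^esub> S_map E) + 0 - 0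
       + (lambda2 E \<odot>\<^bsub>2\<^esub> GMap 3 2 0) - perm (cyc [1,2]) (lambda2 E \<odot>\<^bsub>2\<^esub> GMap 3 2 0)
       + perm (cyc [1,2,3]) (S_map E \<odot>\<^bsub>2\<^esub> Omega_map E))"
    proof (rule eq_on_4I)
      fix i u j v k w l z assume m: "u \<in> L i" "v \<in> L j" "w \<in> L k" "z \<in> L l"
      define a b c e where ab: "a = fst u" "b = fst v" "c = fst w" "e = fst z"
      have g: "a \<in> \<Gamma> i" "b \<in> \<Gamma> j" "c \<in> \<Gamma> k" "e \<in> \<Gamma> l" "a \<in> T" "b \<in> T" "c \<in> T" "e \<in> T"
        using m[THEN assocD(1)] m[THEN assocD(3)] by (simp_all add: ab)
      \<comment> \<open>Axiom (vi) again: the first two signs come from moving \<open>c\<close> to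
        the front, the third from \<open>Omega\<close>, of degree 1, passing \<open>c\<close>. For k
        = 0 they are all positive; otherwise the first pairing vanishes by degree, and then by (vi)
        so does the second.\<close>
      have "S (Omega E a b c) e + (sign_pow (i * k) * sign_pow (j * k) * sign_pow k) *\<^sub>R S c (Omega E a b e) = 0"
      proof (cases "k = 0")
        case True
        then show ?thesis using S_Omega[OF g(5-8)] by simp
      next
        case False
        then have "Omega E a b c = 0" using Omega_degree[OF g(1-3)] by simp
        moreover then have "S c (Omega E a b e) = 0" using S_Omega[OF g(5-8)] g by simp
        ultimately show ?thesis using g by simp
      qed
      then show "(0 + 0) [(i, u), (j, v), (k, w), (l, z)] =
        ((S_map E \<odot>\<^bsub>1\<^esub> Omega_map E) - 0 + 0 - 0 + (Omega_map E \<odot>\<^bsub>3\<^esub> S_map E) + 0 - 0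
         + (lambda2 E \<odot>\<^bsub>2\<^esub> GMap 3 2 0) - perm (cyc [1,2]) (lambda2 E \<odot>\<^bsub>2\<^esub> GMap 3 2 0)
         + perm (cyc [1,2,3]) (S_map E \<odot>\<^bsub>2\<^esub> Omega_map E)) [(i, u), (j, v), (k, w), (l, z)]"
        unfolding plus_fun_apply minus_apply perm_12_quad perm_123_quad
        using m m[THEN assocD(3)] by (simp add: pcomp_def Let_def lz0 Oz zero_prod_def ab fun_eq_iff)
    qed
    show "eq_on L 2 (0 + 0) 0" by (simp add: eq_on_def)
  qed
qed

end

theorem proposition5p4:
  fixes E :: "('m::{t2_space, second_countable_topology}, 'a::real_inner, 'v::real_vector) clwx"
  assumes "smooth_manifold (base E)"
    and "clwx_2_algebroid E"
  shows "(\<forall>f\<in>Cinf (base E). Dop E f \<in> GammaE E 1 \<and>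
            (\<forall>e\<in>total_GammaE E. pair_sec E e (Dop E f) = anchor_sec E e f)) \<and>
         three_term_complex (assoc_space E) (assoc_d E) \<and>
         weak_lie_3_algebra (assoc_space E) (assoc_d E)
           (lambda2 E) (S_map E) (Omega_map E) (GMap 2 2 0) (GMap 3 2 0) (GMap 3 2 0) (GMap 4 2 0)"
proof -
  interpret clwx_on_manifold E by (rule clwx_on_manifold.intro[OF assms])
  show ?thesis using D_Gamma S_D three_term weak_lie_assoc by blast
qed

end
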